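(* Let $n$ be a positive integer and let $a_1,\ldots,a_n,b_1,\ldots,b_n>0$ be real numbers. For every measurable set $A\subseteq(\mathbb{R}^2)^n$ satisfying $\overline{\delta}(A)>0$ there is a positive number $\lambda_0=\lambda_0(A,a_1,\ldots,a_n,b_1,\ldots,b_n)$ such that for each $\lambda\in[\lambda_0,\infty)$ one can find $x_1,\ldots,x_n,y_1,\ldots,y_n\in\mathbb{R}^2$ satisfying \[ \big\{(x_1+r_1y_1,\,x_2+r_2y_2,\ldots,x_n+r_ny_n) : (r_1,\ldots,r_n)\in\{0,1\}^n\big\}\subseteq A \] and \[ |y_k|=\lambda^{a_k}b_k\quad\text{for } k=1,2,\ldots,n. \] In other words, for each $\lambda\in[\lambda_0,\infty)$ the set $A$ contains an isometric copy of $\{0,\lambda^{a_1}b_1\}\times\{0,\lambda^{a_2}b_2\}\times\cdots\times\{0,\lambda^{a_n}b_n\}\subset\mathbb{R}^n$ with sides parallel to the distinguished $2$-dimensional coordinate planes of $(\mathbb{R}^2)^n$.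
   Context: Measurability is with respect to Lebesgue measure; $|\cdot|$ of a set denotes its Lebesgue measure and $|v|$ denotes the Euclidean norm of a vector $v$. The space $(\mathbb{R}^2)^n=\mathbb{R}^2\times\cdots\times\mathbb{R}^2$ is identified with $\mathbb{R}^{2n}$; the distinguished coordinate planes are its $n$ factors $\mathbb{R}^2$. For a measurable set $A\subseteq\mathbb{R}^d$ the upper Banach density is \[ \overline{\delta}(A):=\limsup_{R\to\infty}\,\sup_{x\in\mathbb{R}^d}\frac{|A\cap(x+[0,R]^d)|}{R^d}. \] Here $d=2n$. *)

theory Defs
  imports "HOL-Analysis.Analysis"
begin

text \<open>
  Here \<open>cbox 0 (R *\<^sub>R One)\<close> is the cube \<open>[0,R]\<^sup>d\<close> with \<open>d = DIM('a)\<close>. The density takes values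
  in \<^typ>\<open>ereal\<close> so that the supremum and the upper limit are the honest ones of a complete lattice.
\<close>

definition upper_banach_density :: "'a::euclidean_space set \<Rightarrow> ereal" where
  "upper_banach_density A =
     Limsup at_top (\<lambda>R::real. SUP x::'a.
       ereal (measure lebesgue (A \<inter> ((+) x ` cbox 0 (R *\<^sub>R One))) / R ^ DIM('a)))"

end

theory Submission
  imports Defs "HOL-Probability.Infinite_Product_Measure"
begin

text \<open>
  After rescaling, \<open>A\<close> is a subset of density \<open>\<delta>\<close> of the unit cube \<open>([0,1)\<^sup>2)\<^sup>n\<close>. Given a measure
  \<open>M\<^sub>k\<close> on pairs \<open>(p\<^sub>k, q\<^sub>k)\<close> of points of the plane for each coordinate \<open>k\<close>, let \<open>N(M)\<close> be the integral
  of the product of the indicator of \<open>A\<close> over all \<open>2\<^sup>n\<close> corners of the box spanned by \<open>p\<close> and \<open>q\<close>. In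
  each coordinate separately the integrand has the form \<open>g(p\<^sub>k) g(q\<^sub>k)\<close>, so inequalities between the
  quadratic forms \<open>g \<mapsto> \<integral> g(p) g(q) dM\<^sub>k\<close> pass to \<open>N\<close> one coordinate at a time.

  For the coupling \<open>U\<^sub>m\<close> of two independent uniform points of a common dyadic cell of side \<open>2\<^sup>-\<^sup>m\<close> the
  quadratic form increases with \<open>m\<close>; hence \<open>G(m\<^sub>1,\<dots>,m\<^sub>n) = N(U)\<close> is monotone, bounded by \<open>1\<close>, and at
  least \<open>\<delta>\<close> to the power \<open>2\<^sup>n\<close>. Let \<open>T\<close> be the coupling of a point with its translate by a random vector
  of length \<open>\<tau>\<close>. First, \<open>T\<close> may be averaged over cells much finer than \<open>\<tau>\<close>, because the difference of
  two random vectors on a circular arc has an integrable density. Secondly, the averaged coupling has a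
  bounded density with respect to \<open>U\<^sub>m\<close>, for \<open>2\<^sup>-\<^sup>m\<close> a large constant times \<open>\<tau>\<close>, and differs from \<open>U\<^sub>m\<close> by
  at most a small constant plus a multiple of \<open>U\<^sub>m\<^sub>+\<^sub>L - U\<^sub>m\<close>. Therefore \<open>N(T)\<close> is bounded below by
  \<open>G(m)\<close> up to a small constant and a multiple of \<open>G(m + L) - G(m)\<close>. If the theorem failed, there would be
  arbitrarily many widely separated bad scales; the increments of \<open>G\<close> over these scales telescope, so at
  one of them the increment is small and \<open>N(T) > 0\<close>, which yields a box.
\<close>

section \<open>Box forms\<close>

definition mix :: "('n \<Rightarrow> 'p \<times> 'p) \<Rightarrow> 'n set \<Rightarrow> 'n \<Rightarrow> 'p" where
  "mix z S = (\<lambda>k. if k \<in> S then snd (z k) else fst (z k))"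

text \<open>Only the coordinates in \<open>I\<close> are doubled; the others stay at their first
  point. This lets coordinates be doubled one at a time, starting from \<open>I = {}\<close>, where
  \<open>f\<close> is evaluated at the base point alone.\<close>

definition corners :: "(('n \<Rightarrow> 'p) \<Rightarrow> real) \<Rightarrow> 'n set \<Rightarrow> ('n \<Rightarrow> 'p \<times> 'p) \<Rightarrow> real" where
  "corners f I z = (\<Prod>S\<in>Pow I. f (mix z S))"

text \<open>When every \<open>M k\<close> is the square of one probability measure, this is the
  Gowers box norm of \<open>f\<close> raised to the power \<open>2 ^ CARD('n)\<close>.\<close>

definition box_form :: "(('n \<Rightarrow> 'p::topological_space) \<Rightarrow> real) \<Rightarrow> ('n \<Rightarrow> ('p \<times> 'p) measure) \<Rightarrow> real" where
  "box_form f M = (\<integral>z. corners f UNIV z \<partial>Pi\<^sub>M UNIV M)"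

definition test_fun :: "'p::topological_space set \<Rightarrow> ('p \<Rightarrow> real) \<Rightarrow> bool" where
  "test_fun X g \<longleftrightarrow> g \<in> borel_measurable borel \<and> (\<forall>p. 0 \<le> g p \<and> g p \<le> 1) \<and> (\<forall>p. p \<notin> X \<longrightarrow> g p = 0)"

text \<open>Total mass below 1 is allowed because \<open>smooth_coupling\<close> discards some
  pairs.\<close>

definition sub_coupling :: "('p::topological_space \<times> 'p) measure \<Rightarrow> bool" where
  "sub_coupling M \<longleftrightarrow> sets M = sets borel \<and> emeasure M (space M) \<le> 1"

definition quad_form :: "('p \<times> 'p) measure \<Rightarrow> ('p \<Rightarrow> real) \<Rightarrow> real" where
  "quad_form M g = (\<integral>z. g (fst z) * g (snd z) \<partial>M)"

text \<open>The subsets of \<open>insert k I\<close> split by whether they contain \<open>k\<close>.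
  A corner without \<open>k\<close> sees only \<open>p\<close> in that coordinate, a corner with
  \<open>k\<close> only \<open>q\<close>. This is what makes a box form a quadratic form in each
  coordinate.\<close>

lemma corners_insert_split:
  fixes z :: "'n::finite \<Rightarrow> 'p \<times> 'p"
  assumes "k \<notin> I"
  shows "corners f (insert k I) (z(k := (p, q))) =
    corners f I (z(k := (p, p))) * corners f I (z(k := (q, q)))"
proof -
  have 1: "f (mix (z(k := (p, q))) S) = f (mix (z(k := (p, p))) S)"
    and 2: "f (mix (z(k := (p, q))) (insert k S)) = f (mix (z(k := (q, q))) S)" if "S \<subseteq> I" for S
    using that assms by (auto simp: mix_def fun_eq_iff intro!: arg_cong[where f=f])
  have "inj_on (insert k) (Pow I)"
    using assms by (metis (no_types, lifting) PowD inj_onI insert_ident subsetD)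
  moreover have "Pow I \<inter> insert k ` Pow I = {}"
    using assms by auto
  ultimately show ?thesis
    unfolding corners_def Pow_insert
    by (subst prod.union_disjoint) (auto simp: prod.reindex 1 2 intro!: arg_cong2[where f="(*)"] prod.cong)
qed

lemma corners_cong_coordinate:
  fixes z :: "'n::finite \<Rightarrow> 'p \<times> 'p"
  assumes "k \<notin> I"
  shows "corners f I (z(k := (p, q))) = corners f I (z(k := (p, p)))"
  unfolding corners_def
  using assms by (intro prod.cong refl arg_cong[where f=f]) (auto simp: mix_def fun_eq_iff)

text \<open>In the application \<open>f\<close> is the indicator of the rescaled set, read in planar
  coordinates, and \<open>X\<close> is the unit square.\<close>

locale box_weight =
  fixes f :: "('n::finite \<Rightarrow> 'p::second_countable_topology) \<Rightarrow> real" and X :: "'p set"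
  assumes f_meas: "f \<in> borel_measurable (Pi\<^sub>M UNIV (\<lambda>_. borel))"
    and f_nonneg: "\<And>w. 0 \<le> f w" and f_le_1: "\<And>w. f w \<le> 1"
    and f_support: "\<And>w k. w k \<notin> X \<Longrightarrow> f w = 0"
begin

lemma corners_bounds: "0 \<le> corners f I z" "corners f I z \<le> 1"
  unfolding corners_def by (auto intro!: prod_nonneg prod_le_1 simp: f_nonneg f_le_1)

lemma corners_measurable: "corners f I \<in> borel_measurable (Pi\<^sub>M UNIV (\<lambda>_. borel))"
proof -
  have "(\<lambda>z. mix z S) \<in> Pi\<^sub>M UNIV (\<lambda>_. borel) \<rightarrow>\<^sub>M Pi\<^sub>M UNIV (\<lambda>_. borel :: 'p measure)" for S :: "'n set"
    unfolding mix_def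
  proof (rule measurable_PiM_single')
    fix i :: 'n
    have c: "(\<lambda>z. z i) \<in> Pi\<^sub>M UNIV (\<lambda>_::'n. borel :: ('p \<times> 'p) measure) \<rightarrow>\<^sub>M borel"
      by (rule measurable_component_singleton) simp
    have "fst \<in> (borel :: ('p\<times>'p) measure) \<rightarrow>\<^sub>M borel" "snd \<in> (borel :: ('p\<times>'p) measure) \<rightarrow>\<^sub>M borel"
      by (simp_all add: borel_prod[symmetric])
    from measurable_compose[OF c this(1)] measurable_compose[OF c this(2)]
    show "(\<lambda>z. if i \<in> S then snd (z i) else fst (z i)) \<in> Pi\<^sub>M UNIV (\<lambda>_::'n. borel) \<rightarrow>\<^sub>M (borel :: 'p measure)"
      by auto
  qed auto
  from measurable_compose[OF this f_meas] show ?thesis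
    unfolding corners_def by (intro borel_measurable_prod) auto
qed

lemma test_fun_slice:
  assumes "k \<notin> I"
  shows "test_fun X (\<lambda>p. corners f I (z(k := (p, p))))"
proof -
  have 1: "(\<lambda>p. z(k := (p, p))) \<in> borel \<rightarrow>\<^sub>M Pi\<^sub>M UNIV (\<lambda>_. borel)"
  proof (rule measurable_PiM_single')
    fix i :: 'n
    have "(\<lambda>p::'p. (p, p)) \<in> borel \<rightarrow>\<^sub>M borel"
      by (simp add: borel_prod[symmetric])
    then show "(\<lambda>p. (z(k := (p, p))) i) \<in> borel \<rightarrow>\<^sub>M borel"
      by (cases "i = k") auto
  qed auto
  \<comment> \<open>The factor of the empty set already vanishes: that corner has \<open>p\<close>
    in coordinate \<open>k\<close>.\<close>
  have 2: "corners f I (z(k := (p, p))) = 0" if "p \<notin> X" for p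
    unfolding corners_def
    using that by (auto intro!: prod_zero bexI[of _ "{}"] f_support[of _ k] simp: mix_def)
  show ?thesis
    unfolding test_fun_def
    using measurable_compose[OF 1 corners_measurable] corners_bounds 2 by auto
qed

end

section \<open>Products of sub-couplings\<close>

lemma sub_couplingD:
  assumes "sub_coupling M"
  shows "sets M = sets borel" "finite_measure M" "measure M (space M) \<le> 1" "space M = UNIV"
proof -
  show "sets M = sets borel" using assms by (simp add: sub_coupling_def)
  then show "space M = UNIV" using sets_eq_imp_space_eq by fastforce
  show 1: "finite_measure M" using assms by (intro finite_measureI) (auto simp: sub_coupling_def top_unique)
  show "measure M (space M) \<le> 1"
    using assms by (simp add: sub_coupling_def finite_measure.emeasure_eq_measure[OF 1])
qed

lemma sub_coupling_PiM:
  assumes "\<forall>k. sub_coupling (M k)" and "finite I"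
  shows "product_sigma_finite M" "finite_measure (Pi\<^sub>M I M)" "measure (Pi\<^sub>M I M) (space (Pi\<^sub>M I M)) \<le> 1"
proof -
  interpret product_sigma_finite M
    using sub_couplingD(2) assms(1) by (auto simp: product_sigma_finite_def finite_measure_def)
  show "product_sigma_finite M" ..
  have "emeasure (Pi\<^sub>M I M) (space (Pi\<^sub>M I M)) = (\<Prod>i\<in>I. emeasure (M i) (space (M i)))"
    unfolding space_PiM using assms(2) by (rule emeasure_PiM) auto
  also have "\<dots> \<le> 1"
    using assms by (intro prod_le_1) (auto simp: sub_coupling_def)
  finally have 1: "emeasure (Pi\<^sub>M I M) (space (Pi\<^sub>M I M)) \<le> 1" .
  then show fin: "finite_measure (Pi\<^sub>M I M)"
    by (intro finite_measureI) (auto simp: top_unique)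
  show "measure (Pi\<^sub>M I M) (space (Pi\<^sub>M I M)) \<le> 1"
    using 1 by (simp add: finite_measure.emeasure_eq_measure[OF fin])
qed

lemma integrable_bounded_finite:
  fixes g :: "'a \<Rightarrow> real"
  assumes "finite_measure M" "g \<in> borel_measurable M" "\<And>x. \<bar>g x\<bar> \<le> B"
  shows "integrable M g"
  using finite_measure.integrable_const_bound[OF assms(1), of g B] assms by auto

text \<open>Comparing measures of rectangles is enough, since the second factors have mass 1. This
  removes the second points from averages over base points.\<close>

lemma distr_PiM_fst:
  assumes "prob_space P"
  shows "distr (Pi\<^sub>M (UNIV :: 'n::finite set) (\<lambda>_. P \<Otimes>\<^sub>M P)) (Pi\<^sub>M UNIV (\<lambda>_. P)) (\<lambda>z k. fst (z k))
    = Pi\<^sub>M UNIV (\<lambda>_. P)"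
proof -
  interpret P: prob_space P by fact
  interpret PP: pair_prob_space P P ..
  interpret PI: product_prob_space "\<lambda>_::'n. P" ..
  interpret PPI: product_prob_space "\<lambda>_::'n. P \<Otimes>\<^sub>M P" ..
  have meas: "(\<lambda>z k. fst (z k)) \<in> Pi\<^sub>M UNIV (\<lambda>_::'n. P \<Otimes>\<^sub>M P) \<rightarrow>\<^sub>M Pi\<^sub>M UNIV (\<lambda>_. P)"
    by (rule measurable_PiM_single') (auto simp: space_PiM space_pair_measure PiE_iff mem_Times_iff)
  show ?thesis
  proof (rule PI.PiM_eqI)
    fix Y :: "'n \<Rightarrow> 'a set" assume Y: "\<And>i. i \<in> UNIV \<Longrightarrow> Y i \<in> sets P"
    have "(\<lambda>z k. fst (z k)) -` Pi\<^sub>E UNIV Y \<inter> space (Pi\<^sub>M UNIV (\<lambda>_::'n. P \<Otimes>\<^sub>M P)) = (\<Pi>\<^sub>E k\<in>UNIV. Y k \<times> space P)"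
      using Y[THEN sets.sets_into_space]
      by (fastforce simp: space_PiM space_pair_measure PiE_iff mem_Times_iff)
    moreover have "Pi\<^sub>E UNIV Y \<in> sets (Pi\<^sub>M UNIV (\<lambda>_. P))"
      using Y by (intro sets_PiM_I_finite) auto
    ultimately show "emeasure (distr (Pi\<^sub>M UNIV (\<lambda>_. P \<Otimes>\<^sub>M P)) (Pi\<^sub>M UNIV (\<lambda>_. P)) (\<lambda>z k. fst (z k))) (Pi\<^sub>E UNIV Y)
      = (\<Prod>i\<in>UNIV. emeasure P (Y i))"
      using Y meas
      by (simp add: emeasure_distr PPI.emeasure_PiM P.emeasure_pair_measure_Times P.emeasure_space_1)
  qed auto
qed

section \<open>Slicing in one coordinate and hybrid arguments\<close>

context box_weight
begin

lemma corners_integrable: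
  assumes "\<forall>k. sub_coupling (M k)"
  shows "integrable (Pi\<^sub>M UNIV M) (corners f I)"
proof (rule integrable_bounded_finite[where B=1])
  show "finite_measure (Pi\<^sub>M UNIV M)" using sub_coupling_PiM[OF assms] by simp
  have "sets (Pi\<^sub>M UNIV M) = sets (Pi\<^sub>M UNIV (\<lambda>_. borel))"
    using sub_couplingD(1) assms by (intro sets_PiM_cong) auto
  with corners_measurable show "corners f I \<in> borel_measurable (Pi\<^sub>M UNIV M)"
    by (simp cong: measurable_cong_sets)
  show "\<And>x. \<bar>corners f I x\<bar> \<le> 1" using corners_bounds by auto
qed

lemma corners_update_measurable:
  assumes "\<forall>k. sub_coupling (M k)" "sub_coupling N"
  shows "(\<lambda>(x, y). corners f I (x(k := y))) \<in> borel_measurable (Pi\<^sub>M (UNIV - {k}) M \<Otimes>\<^sub>M N)"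
proof -
  have "(\<lambda>(f, y). f(k := y)) \<in> Pi\<^sub>M (UNIV - {k}) (\<lambda>_. borel) \<Otimes>\<^sub>M borel
      \<rightarrow>\<^sub>M Pi\<^sub>M (insert k (UNIV - {k})) (\<lambda>_. borel :: ('p \<times> 'p) measure)"
    by (rule measurable_add_dim)
  moreover have "insert k (UNIV - {k}) = UNIV" by auto
  ultimately have "(\<lambda>(f, y). f(k := y)) \<in> Pi\<^sub>M (UNIV - {k}) (\<lambda>_. borel) \<Otimes>\<^sub>M borel
      \<rightarrow>\<^sub>M Pi\<^sub>M UNIV (\<lambda>_. borel :: ('p \<times> 'p) measure)" by simp
  from measurable_compose[OF this corners_measurable[of I]]
  have 1: "(\<lambda>(x, y). corners f I (x(k := y))) \<in> borel_measurable (Pi\<^sub>M (UNIV - {k}) (\<lambda>_. borel) \<Otimes>\<^sub>M borel)"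
    by (simp add: case_prod_beta')
  have "sets (Pi\<^sub>M (UNIV - {k}) M) = sets (Pi\<^sub>M (UNIV - {k}) (\<lambda>_. borel))"
    using sub_couplingD(1) assms(1) by (intro sets_PiM_cong) auto
  then have "sets (Pi\<^sub>M (UNIV - {k}) M \<Otimes>\<^sub>M N) = sets (Pi\<^sub>M (UNIV - {k}) (\<lambda>_. borel) \<Otimes>\<^sub>M borel)"
    using sub_couplingD(1)[OF assms(2)] by (intro sets_pair_measure_cong)
  then show ?thesis using 1 by (simp cong: measurable_cong_sets)
qed

text \<open>Fubini isolates coordinate \<open>k\<close>. Integrating over its pair first gives
  quadratic forms for fixed other coordinates; integrating over it last gives a function of that
  pair, as used in \<open>box_form_diff_dominated\<close>.\<close>

lemma integral_corners_split:
  assumes "\<forall>k. sub_coupling (M k)" "sub_coupling N"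
  shows "(\<integral>z. corners f I z \<partial>Pi\<^sub>M UNIV (M(k := N))) =
    (\<integral>x. (\<integral>y. corners f I (x(k := y)) \<partial>N) \<partial>Pi\<^sub>M (UNIV - {k}) M)" (is ?A)
    and "(\<integral>z. corners f I z \<partial>Pi\<^sub>M UNIV (M(k := N))) =
    (\<integral>y. (\<integral>x. corners f I (x(k := y)) \<partial>Pi\<^sub>M (UNIV - {k}) M) \<partial>N)"
    and "integrable (Pi\<^sub>M (UNIV - {k}) M) (\<lambda>x. \<integral>y. corners f I (x(k := y)) \<partial>N)"
    and "integrable N (\<lambda>y. \<integral>x. corners f I (x(k := y)) \<partial>Pi\<^sub>M (UNIV - {k}) M)"
proof -
  have sub: "\<forall>i. sub_coupling ((M(k := N)) i)" using assms by auto
  interpret product_sigma_finite "M(k := N)"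
    using sub_coupling_PiM(1)[of "M(k := N)" UNIV] sub by simp
  have ins: "insert k (UNIV - {k}) = UNIV" by auto
  have eq: "Pi\<^sub>M (UNIV - {k}) (M(k := N)) = Pi\<^sub>M (UNIV - {k}) M"
    by (intro PiM_cong) auto
  show ?A
    using product_integral_insert[of "UNIV - {k}" k "corners f I"] corners_integrable[OF sub]
    by (simp add: ins eq)
  interpret P: finite_measure "Pi\<^sub>M (UNIV - {k}) M"
    using sub_coupling_PiM(2)[of M "UNIV - {k}"] assms by simp
  interpret N: finite_measure N using sub_couplingD[OF assms(2)] by simp
  interpret PN: pair_sigma_finite "Pi\<^sub>M (UNIV - {k}) M" N ..
  have "finite_measure (Pi\<^sub>M (UNIV - {k}) M \<Otimes>\<^sub>M N)"
    by (intro finite_measure_pair_measure P.finite_measure_axioms N.finite_measure_axioms)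
  then have int: "integrable (Pi\<^sub>M (UNIV - {k}) M \<Otimes>\<^sub>M N) (\<lambda>(x, y). corners f I (x(k := y)))"
    by (rule integrable_bounded_finite[where B=1])
       (auto intro!: corners_update_measurable assms simp: corners_bounds abs_le_iff
          intro: order_trans[OF _ corners_bounds(1)])
  from PN.Fubini_integral[OF int] show "(\<integral>z. corners f I z \<partial>Pi\<^sub>M UNIV (M(k := N))) =
    (\<integral>y. (\<integral>x. corners f I (x(k := y)) \<partial>Pi\<^sub>M (UNIV - {k}) M) \<partial>N)"
    using \<open>?A\<close> by simp
  from PN.integrable_fst[OF int]
  show "integrable (Pi\<^sub>M (UNIV - {k}) M) (\<lambda>x. \<integral>y. corners f I (x(k := y)) \<partial>N)" .
  from PN.integrable_snd[OF int]
  show "integrable N (\<lambda>y. \<integral>x. corners f I (x(k := y)) \<partial>Pi\<^sub>M (UNIV - {k}) M)" .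
qed

text \<open>For fixed other coordinates the full product is g(p) g(q), where g collects the corners
  that do not double \<open>k\<close>. A box form is thus an integral of quadratic forms of test
  functions.\<close>

lemma box_form_slice:
  assumes "\<forall>k. sub_coupling (M k)" "sub_coupling N"
  shows "box_form f (M(k := N)) =
      (\<integral>x. quad_form N (\<lambda>p. corners f (UNIV - {k}) (x(k := (p, p)))) \<partial>Pi\<^sub>M (UNIV - {k}) M)"
    and "integrable (Pi\<^sub>M (UNIV - {k}) M)
      (\<lambda>x. quad_form N (\<lambda>p. corners f (UNIV - {k}) (x(k := (p, p)))))"
proof -
  have "corners f UNIV (x(k := y)) =
      corners f (UNIV - {k}) (x(k := (fst y, fst y))) * corners f (UNIV - {k}) (x(k := (snd y, snd y)))" for x y
    using corners_insert_split[of k "UNIV - {k}" f x "fst y" "snd y"]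
    by (simp add: insert_absorb)
  then have eq: "quad_form N (\<lambda>p. corners f (UNIV - {k}) (x(k := (p, p)))) = (\<integral>y. corners f UNIV (x(k := y)) \<partial>N)" for x
    by (simp add: quad_form_def)
  show "box_form f (M(k := N)) =
      (\<integral>x. quad_form N (\<lambda>p. corners f (UNIV - {k}) (x(k := (p, p)))) \<partial>Pi\<^sub>M (UNIV - {k}) M)"
    unfolding eq box_form_def by (rule integral_corners_split(1)[OF assms])
  show "integrable (Pi\<^sub>M (UNIV - {k}) M)
      (\<lambda>x. quad_form N (\<lambda>p. corners f (UNIV - {k}) (x(k := (p, p)))))"
    unfolding eq by (rule integral_corners_split(3)[OF assms])
qed

text \<open>The inequality between quadratic forms is integrated over the remaining coordinates.
  Three couplings occur because the comparison of \<open>U\<close> with \<open>V\<close> in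
  \<open>box_form_transfer\<close> also involves the increment from \<open>U\<close> to
  \<open>S\<close>.\<close>

lemma box_form_coordinate_inequality:
  assumes M: "\<forall>k. sub_coupling (M k)" and N: "sub_coupling N1" "sub_coupling N2" "sub_coupling N3"
    and e: "0 \<le> e"
    and le: "\<And>g. test_fun X g \<Longrightarrow> - e \<le> a * quad_form N1 g + b * quad_form N2 g + c * quad_form N3 g"
  shows "- e \<le> a * box_form f (M(k := N1)) + b * box_form f (M(k := N2)) + c * box_form f (M(k := N3))"
proof -
  let ?P = "Pi\<^sub>M (UNIV - {k}) M"
  let ?q = "\<lambda>N x. quad_form N (\<lambda>p. corners f (UNIV - {k}) (x(k := (p, p))))"
  interpret P: finite_measure ?P
    using sub_coupling_PiM(2)[of M "UNIV - {k}"] M by simp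
  note int = box_form_slice(2)[OF M N(1)] box_form_slice(2)[OF M N(2)] box_form_slice(2)[OF M N(3)]
  have "measure ?P (space ?P) \<le> 1"
    using sub_coupling_PiM(3)[of M "UNIV - {k}"] M by simp
  \<comment> \<open>The other couplings have product mass at most 1, so a nonnegative error does not
    grow under integration.\<close>
  then have "- e \<le> (\<integral>x. - e \<partial>?P)"
    using e by (simp add: mult_left_le_one_le)
  also have "\<dots> \<le> (\<integral>x. a * ?q N1 x + b * ?q N2 x + c * ?q N3 x \<partial>?P)"
    using int by (intro integral_mono) (auto intro!: le test_fun_slice)
  also have "\<dots> = a * box_form f (M(k := N1)) + b * box_form f (M(k := N2)) + c * box_form f (M(k := N3))"
    using int by (simp add: box_form_slice(1)[OF M N(1)] box_form_slice(1)[OF M N(2)] box_form_slice(1)[OF M N(3)])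
  finally show ?thesis .
qed

lemma box_form_mono_coordinate:
  assumes M: "\<forall>k. sub_coupling (M k)" and N: "sub_coupling N1" "sub_coupling N2"
    and e: "0 \<le> e"
    and le: "\<And>g. test_fun X g \<Longrightarrow> quad_form N1 g \<le> quad_form N2 g + e"
  shows "box_form f (M(k := N1)) \<le> box_form f (M(k := N2)) + e"
  using box_form_coordinate_inequality[OF M N(1,2,2) e, where a="-1" and b=1 and c=0, of k] le by force

text \<open>Hybrid argument: the couplings are exchanged one coordinate at a time, and each exchange
  costs at most \<open>e\<close>.\<close>

lemma box_form_mono:
  assumes M: "\<forall>k. sub_coupling (M k)" "\<forall>k. sub_coupling (N k)"
    and e: "0 \<le> e"
    and le: "\<And>k g. test_fun X g \<Longrightarrow> quad_form (M k) g \<le> quad_form (N k) g + e"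
  shows "box_form f M \<le> box_form f N + real CARD('n) * e"
proof -
  have "box_form f M \<le> box_form f (override_on M N I) + real (card I) * e" if "finite I" for I
    using that
  proof (induction I)
    case (insert k I)
    have "box_form f ((override_on M N I)(k := M k)) \<le> box_form f ((override_on M N I)(k := N k)) + e"
      by (rule box_form_mono_coordinate) (auto simp: override_on_def M e le)
    moreover have "(override_on M N I)(k := M k) = override_on M N I"
      "(override_on M N I)(k := N k) = override_on M N (insert k I)"
      using insert by (auto simp: override_on_def fun_eq_iff)
    ultimately show ?case using insert by (simp add: algebra_simps)
  qed simp
  moreover have "override_on M N UNIV = N" by (simp add: override_on_def fun_eq_iff)
  ultimately show ?thesis using finite[of "UNIV :: 'n set"] by metis
qed

lemma box_form_bounds:
  assumes M: "\<forall>k. sub_coupling (M k)"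
  shows "0 \<le> box_form f M" "box_form f M \<le> 1"
proof -
  show "0 \<le> box_form f M" unfolding box_form_def by (simp add: corners_bounds)
  interpret P: finite_measure "Pi\<^sub>M UNIV M"
    using sub_coupling_PiM(2)[of M UNIV] M by simp
  have "box_form f M \<le> (\<integral>x. 1 \<partial>Pi\<^sub>M UNIV M)"
    unfolding box_form_def by (intro integral_mono corners_integrable M) (auto simp: corners_bounds)
  also have "\<dots> \<le> 1" using sub_coupling_PiM(3)[of M UNIV] M by simp
  finally show "box_form f M \<le> 1" .
qed

text \<open>As a function of the pair in coordinate \<open>l\<close>, the gain from replacing
  \<open>U\<close> by \<open>S\<close> in coordinate \<open>k\<close> has values in [0, 1], so the
  domination of \<open>V\<close> by \<open>W\<close> can be applied to it.\<close>

lemma box_form_diff_dominated: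
  assumes M: "\<forall>k. sub_coupling (M k)" and sub: "sub_coupling S" "sub_coupling U" "sub_coupling V" "sub_coupling W"
    and "k \<noteq> l"
    and dom: "\<And>\<phi>. \<phi> \<in> borel_measurable borel \<Longrightarrow> (\<And>y. 0 \<le> \<phi> y \<and> \<phi> y \<le> 1) \<Longrightarrow> (\<integral>y. \<phi> y \<partial>V) \<le> C * (\<integral>y. \<phi> y \<partial>W)"
    and mono: "\<And>g. test_fun X g \<Longrightarrow> quad_form U g \<le> quad_form S g"
  shows "box_form f (M(k := S, l := V)) - box_form f (M(k := U, l := V))
    \<le> C * (box_form f (M(k := S, l := W)) - box_form f (M(k := U, l := W)))"
proof -
  define F where "F N y = (\<integral>x. corners f UNIV (x(l := y)) \<partial>Pi\<^sub>M (UNIV - {l}) (M(k := N)))" for N y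
  have MN: "\<forall>i. sub_coupling ((M(k := N)) i)" if "sub_coupling N" for N
    using M that by auto
  have 1: "box_form f (M(k := N, l := R)) = (\<integral>y. F N y \<partial>R)" "integrable R (F N)"
    if "sub_coupling N" "sub_coupling R" for N R
    using integral_corners_split(2,4)[where M="M(k := N)" and N=R and I=UNIV and k=l] MN[OF that(1)] that(2)
    by (simp_all add: F_def[abs_def] box_form_def)
  have ret: "sub_coupling (return borel y)" for y :: "'p \<times> 'p"
    by (simp add: sub_coupling_def)
  have meas: "F N \<in> borel_measurable borel" if "sub_coupling N" for N
    using 1(2)[OF that sub(3)] sub_couplingD(1)[OF sub(3)]
    by (metis borel_measurable_integrable measurable_cong_sets)
  \<comment> \<open>A Dirac coupling in coordinate \<open>l\<close> turns a value of
    \<open>F\<close> into a box form, so inequalities for box forms hold pointwise for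
    \<open>F\<close>.\<close>
  have F: "F N y = box_form f (M(l := return borel y, k := N))" if "sub_coupling N" for N y
    using 1(1)[OF that ret[of y]] meas[OF that] \<open>k \<noteq> l\<close>
    by (simp add: integral_return fun_upd_twist[of k l])
  have "box_form f (M(l := return borel y, k := U)) \<le> box_form f (M(l := return borel y, k := S)) + 0" for y
    by (rule box_form_mono_coordinate) (use M sub ret mono in auto)
  then have d: "0 \<le> F S y - F U y" for y
    using F sub by simp
  have "0 \<le> F N y" "F N y \<le> 1" if "sub_coupling N" for N y
  proof -
    have "\<forall>i. sub_coupling ((M(l := return borel y, k := N)) i)"
      using M sub ret that by auto
    then show "0 \<le> F N y" "F N y \<le> 1"
      unfolding F[OF that] using box_form_bounds[of "M(l := return borel y, k := N)"] by blast+
  qed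
  from this(2)[OF sub(1)] this(1)[OF sub(2)] have "F S y \<le> 1" "0 \<le> F U y" for y by auto
  then have d1: "F S y - F U y \<le> 1" for y
    using diff_mono[of "F S y" 1 0 "F U y"] by simp
  have "(\<integral>y. F S y - F U y \<partial>V) \<le> C * (\<integral>y. F S y - F U y \<partial>W)"
    using d d1 meas sub by (intro dom) auto
  then show ?thesis
    using 1 sub by simp
qed

text \<open>Passing from \<open>T\<close> to \<open>V\<close> costs \<open>e\<close> per coordinate.
  Passing from \<open>V\<close> to \<open>U\<close> costs \<open>e'\<close> per coordinate plus
  \<open>K\<close> times the increment of a hybrid form. Domination by \<open>C\<close> in the
  coordinates still carrying \<open>V\<close> bounds that increment by one of the pure form in
  \<open>U\<close>, and monotonicity bounds the latter by
  \<open>box_form f S - box_form f U\<close>.\<close>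

lemma box_form_transfer:
  assumes sub: "\<forall>k. sub_coupling (T k)" "\<forall>k. sub_coupling (V k)" "\<forall>k. sub_coupling (U k)" "\<forall>k. sub_coupling (S k)"
    and pos: "0 \<le> e" "0 \<le> e'" "0 \<le> K" "1 \<le> C"
    and VT: "\<And>k g. test_fun X g \<Longrightarrow> quad_form (V k) g \<le> quad_form (T k) g + e"
    and UV: "\<And>k g. test_fun X g \<Longrightarrow>
      quad_form (U k) g \<le> quad_form (V k) g + e' + K * (quad_form (S k) g - quad_form (U k) g)"
    and mono: "\<And>k g. test_fun X g \<Longrightarrow> quad_form (U k) g \<le> quad_form (S k) g"
    and dom: "\<And>k \<phi>. \<phi> \<in> borel_measurable borel \<Longrightarrow> (\<And>y. 0 \<le> \<phi> y \<and> \<phi> y \<le> 1) \<Longrightarrow>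
      (\<integral>y. \<phi> y \<partial>V k) \<le> C * (\<integral>y. \<phi> y \<partial>U k)"
  shows "box_form f U \<le> box_form f T + real CARD('n) * (e + e')
    + real CARD('n) * K * C ^ CARD('n) * (box_form f S - box_form f U)"
proof -
  define D where "D M k = box_form f (M(k := S k)) - box_form f (M(k := U k))" for M k
  let ?G = "box_form f S - box_form f U"
  have sub_o: "\<forall>i. sub_coupling (override_on M N I i)" if "\<forall>k. sub_coupling (M k)" "\<forall>k. sub_coupling (N k)"
    for M N :: "'n \<Rightarrow> ('p \<times> 'p) measure" and I
    using that by (auto simp: override_on_def)
  \<comment> \<open>Each coordinate carrying \<open>V\<close> is traded for \<open>U\<close> at the
    price of a factor \<open>C\<close>.\<close>
  have dominated: "D (override_on U V J) k \<le> C ^ card J * D U k" if "finite J" "k \<notin> J" for J k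
    using that
  proof (induction J)
    case (insert l J)
    let ?H = "override_on U V J"
    have "box_form f (?H(k := S k, l := V l)) - box_form f (?H(k := U k, l := V l))
      \<le> C * (box_form f (?H(k := S k, l := U l)) - box_form f (?H(k := U k, l := U l)))"
      by (rule box_form_diff_dominated) (use insert sub sub_o dom mono in auto)
    moreover have "?H(k := N, l := V l) = (override_on U V (insert l J))(k := N)"
      "?H(k := N, l := U l) = ?H(k := N)" for N
      using insert by (auto simp: override_on_def fun_eq_iff)
    ultimately have "D (override_on U V (insert l J)) k \<le> C * D ?H k" by (simp add: D_def)
    also have "\<dots> \<le> C * (C ^ card J * D U k)"
      using insert.IH insert.prems pos(4) by (intro mult_left_mono) (blast, linarith)
    finally show ?case using insert by (simp add: mult.assoc)
  qed simp
  have DU: "0 \<le> D U k" "D U k \<le> ?G" for k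
  proof -
    have "box_form f (U(k := U k)) \<le> box_form f (U(k := S k)) + 0"
      by (rule box_form_mono_coordinate) (use sub mono in auto)
    then show "0 \<le> D U k" by (simp add: D_def)
    have "box_form f (U(k := S k)) \<le> box_form f S + real CARD('n) * 0"
      by (rule box_form_mono) (use sub mono in auto)
    then show "D U k \<le> ?G" by (simp add: D_def)
  qed
  have hyb: "D (override_on V U I) k \<le> C ^ CARD('n) * ?G" if "k \<notin> I" for I k
  proof -
    \<comment> \<open>The coupling at \<open>k\<close> is overwritten in \<open>D\<close>, so
      \<open>k\<close> may be removed from the coordinates carrying \<open>V\<close>, as
      \<open>dominated\<close> demands.\<close>
    let ?J = "- I - {k}"
    have "(override_on V U I)(k := N) = (override_on U V ?J)(k := N)" for N
      by (auto simp: override_on_def fun_eq_iff)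
    then have "D (override_on V U I) k = D (override_on U V ?J) k" by (simp add: D_def)
    also have "\<dots> \<le> C ^ card ?J * D U k"
      by (rule dominated) auto
    also have "\<dots> \<le> C ^ CARD('n) * ?G"
      using pos DU[of k] by (intro mult_mono power_increasing card_mono) auto
    finally show ?thesis .
  qed
  have "box_form f (override_on V U I) \<le> box_form f V + real (card I) * (e' + K * (C ^ CARD('n) * ?G))"
    if "finite I" for I
    using that
  proof (induction I)
    case (insert k I)
    let ?H = "override_on V U I"
    \<comment> \<open>Hypothesis \<open>UV\<close> with all terms on one side: the coefficients 1,
      \<open>K\<close> and \<open>- 1 - K\<close> belong to \<open>V\<close>, \<open>S\<close> and
      \<open>U\<close>.\<close>
    have "- e' \<le> 1 * box_form f (?H(k := V k)) + K * box_form f (?H(k := S k)) + (- 1 - K) * box_form f (?H(k := U k))"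
    proof (rule box_form_coordinate_inequality)
      fix g assume "test_fun X g"
      from UV[OF this, of k] show "- e' \<le> 1 * quad_form (V k) g + K * quad_form (S k) g + (- 1 - K) * quad_form (U k) g"
        by (simp add: algebra_simps)
    qed (use sub sub_o pos in auto)
    then have "box_form f (?H(k := U k)) \<le> box_form f (?H(k := V k)) + e' + K * D ?H k"
      by (simp add: D_def algebra_simps)
    also have "\<dots> \<le> box_form f (?H(k := V k)) + e' + K * (C ^ CARD('n) * ?G)"
      using hyb[of k I] insert pos by (intro add_left_mono mult_left_mono) auto
    finally have "box_form f (?H(k := U k)) \<le> box_form f (?H(k := V k)) + (e' + K * (C ^ CARD('n) * ?G))" by simp
    moreover have "?H(k := V k) = ?H" "?H(k := U k) = override_on V U (insert k I)"
      using insert by (auto simp: override_on_def fun_eq_iff)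
    ultimately show ?case using insert by (simp add: algebra_simps)
  qed simp
  moreover have "override_on V U UNIV = U" by (simp add: override_on_def fun_eq_iff)
  ultimately have "box_form f U \<le> box_form f V + real CARD('n) * (e' + K * (C ^ CARD('n) * ?G))"
    using finite[of "UNIV :: 'n set"] by metis
  moreover have "box_form f V \<le> box_form f T + real CARD('n) * e"
    by (rule box_form_mono) (use sub pos VT in auto)
  ultimately show ?thesis by (simp add: algebra_simps)
qed

text \<open>Iterated Cauchy-Schwarz, as for the Gowers box norm: doubling one coordinate replaces
  the mean of a function by the mean of its square, which is at least the square of the
  mean.\<close>

lemma power_average_le_box_form:
  assumes P: "prob_space P" "sets P = sets borel"
  shows "(\<integral>z. f (\<lambda>k. fst (z k)) \<partial>Pi\<^sub>M UNIV (\<lambda>_. P \<Otimes>\<^sub>M P)) ^ (2 ^ CARD('n)) \<le> box_form f (\<lambda>_. P \<Otimes>\<^sub>M P)"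
proof -
  interpret P: prob_space P by fact
  interpret PP: pair_prob_space P P ..
  have "sets (P \<Otimes>\<^sub>M P) = sets (borel :: ('p \<times> 'p) measure)"
    unfolding borel_prod[symmetric] using P by (intro sets_pair_measure_cong) auto
  then have sub: "sub_coupling (P \<Otimes>\<^sub>M P)"
    by (simp add: sub_coupling_def PP.emeasure_space_1)
  let ?P = "\<lambda>I. Pi\<^sub>M I (\<lambda>_. P \<Otimes>\<^sub>M P) :: ('n \<Rightarrow> 'p \<times> 'p) measure"
  interpret PI: product_prob_space "\<lambda>_::'n. P \<Otimes>\<^sub>M P" ..
  let ?A = "\<lambda>I. \<integral>z. corners f I z \<partial>?P UNIV"
  have "?A {} ^ (2 ^ card I) \<le> ?A I" if "finite I" for I
    using that
  proof (induction I)
    case (insert k I)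
    let ?Q = "?P (UNIV - {k})"
    interpret Q: prob_space ?Q by (intro prob_space_PiM PP.prob_space_axioms)
    define c where "c x p = corners f I (x(k := (p, p)))" for x :: "'n \<Rightarrow> 'p \<times> 'p" and p
    define m where "m x = (\<integral>p. c x p \<partial>P)" for x
    have c_test: "test_fun X (c x)" for x
      unfolding c_def[abs_def] using insert by (intro test_fun_slice) auto
    then have c: "c x \<in> borel_measurable P" "0 \<le> c x p" "c x p \<le> 1" for x p
      using P unfolding test_fun_def by (auto cong: measurable_cong_sets)
    have c_int: "integrable P (c x)" for x
      by (rule integrable_bounded_finite[where B=1]) (use c in \<open>auto intro: P.finite_measure_axioms\<close>)
    have upd: "(\<lambda>_. P \<Otimes>\<^sub>M P)(k := P \<Otimes>\<^sub>M P) = (\<lambda>_::'n. P \<Otimes>\<^sub>M P)" by auto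
    have split: "?A J = (\<integral>x. (\<integral>y. corners f J (x(k := y)) \<partial>(P \<Otimes>\<^sub>M P)) \<partial>?Q)"
      "integrable ?Q (\<lambda>x. \<integral>y. corners f J (x(k := y)) \<partial>(P \<Otimes>\<^sub>M P))" for J
      using integral_corners_split(1,3)[where M="\<lambda>_. P \<Otimes>\<^sub>M P" and N="P \<Otimes>\<^sub>M P" and I=J and k=k] sub unfolding upd by auto
    \<comment> \<open>Before \<open>k\<close> is doubled only the first point of its pair is read,
      and the second integrates to 1.\<close>
    have "(\<integral>y. corners f I (x(k := y)) \<partial>(P \<Otimes>\<^sub>M P)) = m x" for x
    proof -
      have "corners f I (x(k := y)) = c x (fst y)" for y
        using corners_cong_coordinate[of k I f x "fst y" "snd y"] insert by (simp add: c_def)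
      then have "(\<integral>y. corners f I (x(k := y)) \<partial>(P \<Otimes>\<^sub>M P)) = (\<integral>y. c x (fst y) * 1 \<partial>(P \<Otimes>\<^sub>M P))"
        by simp
      also have "\<dots> = (\<integral>p. c x p \<partial>P) * (\<integral>p. 1 \<partial>P)"
        using PP.integral_fst'[of "\<lambda>y. c x (fst y) * 1"] integrable_bounded_finite[where B=1, of "P \<Otimes>\<^sub>M P" "\<lambda>y. c x (fst y)"]
          c PP.finite_measure_axioms by (simp add: measurable_compose[OF measurable_fst] P.prob_space)
      finally show ?thesis by (simp add: m_def P.prob_space)
    qed
    note 1 = split[of I, unfolded this]
    have "(\<integral>y. corners f (insert k I) (x(k := y)) \<partial>(P \<Otimes>\<^sub>M P)) = m x * m x" for x
    proof -
      have "corners f (insert k I) (x(k := y)) = c x (fst y) * c x (snd y)" for y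
        using corners_insert_split[of k I f x "fst y" "snd y"] insert by (simp add: c_def)
      then have "(\<integral>y. corners f (insert k I) (x(k := y)) \<partial>(P \<Otimes>\<^sub>M P)) = (\<integral>(p, q). c x p * c x q \<partial>(P \<Otimes>\<^sub>M P))"
        by (simp add: case_prod_beta')
      also have "\<dots> = (\<integral>p. (\<integral>q. c x p * c x q \<partial>P) \<partial>P)"
      proof (rule PP.integral_fst[symmetric])
        have [measurable]: "c x \<in> borel_measurable P" by (rule c)
        show "integrable (P \<Otimes>\<^sub>M P) (\<lambda>(p, q). c x p * c x q)"
          by (rule integrable_bounded_finite[where B=1])
             (use c in \<open>auto intro!: PP.finite_measure_axioms mult_le_one simp: abs_mult\<close>)
      qed
      finally show ?thesis by (simp add: m_def)
    qed
    note 2 = split[of "insert k I", unfolded this]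
    have "?A {} ^ (2 ^ card (insert k I)) = (?A {} ^ (2 ^ card I))\<^sup>2"
      using insert by (simp add: power_mult[symmetric] mult.commute)
    also have "\<dots> \<le> (?A I)\<^sup>2"
      using insert by (intro power_mono) (auto simp: corners_bounds)
    \<comment> \<open>Cauchy-Schwarz on a probability space, in the form that the variance of
      \<open>m\<close> is nonnegative.\<close>
    also have "\<dots> = (\<integral>x. 2 * ?A I * m x - (?A I)\<^sup>2 \<partial>?Q)"
      using 1 by (simp add: Q.prob_space power2_eq_square)
    also have "\<dots> \<le> (\<integral>x. m x * m x \<partial>?Q)"
    proof (rule integral_mono)
      fix x
      have "0 \<le> (m x - ?A I)\<^sup>2" by simp
      then show "2 * ?A I * m x - (?A I)\<^sup>2 \<le> m x * m x"
        by (simp add: power2_eq_square algebra_simps)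
    qed (use 1 2 in auto)
    finally show ?case using 2 by simp
  qed simp
  from this[of UNIV]
  have "(\<integral>z. corners f {} z \<partial>?P UNIV) ^ (2 ^ CARD('n)) \<le> box_form f (\<lambda>_. P \<Otimes>\<^sub>M P)"
    by (simp add: box_form_def)
  then show ?thesis by (simp add: corners_def mix_def)
qed

end

section \<open>Differences of points on a circular arc\<close>

text \<open>A bounded oscillating function: its integral vanishes over every union of cells of some
  partition into pieces of diameter at most \<open>s\<close>. As the labelling \<open>c\<close> is
  measurable into a discrete space, every such union is Borel.\<close>

definition balanced_on_cells :: "real \<Rightarrow> ('a::euclidean_space \<Rightarrow> real) \<Rightarrow> bool" where
  "balanced_on_cells s h \<longleftrightarrow> integrable lborel h \<and> (\<forall>z. \<bar>h z\<bar> \<le> 1) \<and>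
     (\<exists>c :: 'a \<Rightarrow> int \<times> int. c \<in> borel \<rightarrow>\<^sub>M count_space UNIV \<and> (\<forall>z z'. c z = c z' \<longrightarrow> dist z z' \<le> s) \<and>
        (\<forall>J. (\<integral>z. h z * indicator (c -` J) z \<partial>lborel) = 0))"

section \<open>Balanced functions against integrable functions\<close>

lemma measure_compact_neighbourhood:
  fixes K :: "'a::euclidean_space set"
  assumes "compact K" "0 < e"
  shows "\<exists>s>0. measure lborel (\<Union>x\<in>K. cball x s) < measure lborel K + e"
proof -
  \<comment> \<open>These closed neighbourhoods decrease to \<open>K\<close> and have finite
    measure, so their measures converge to that of \<open>K\<close>.\<close>
  define N where "N n = (\<Union>x\<in>K. cball x (1 / real (Suc n)))" for n
  have cN: "compact (N n)" for n
    unfolding N_def by (rule compact_minkowski_sum_cball) fact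
  have "(\<Inter>n. N n) = K"
  proof
    show "K \<subseteq> (\<Inter>n. N n)" by (auto simp: N_def intro!: bexI)
    show "(\<Inter>n. N n) \<subseteq> K"
    proof
      fix z assume z: "z \<in> (\<Inter>n. N n)"
      have "z \<in> closure K"
        unfolding closure_approachable
      proof (intro allI impI)
        fix r :: real assume "0 < r"
        then obtain n where "1 / real (Suc n) < r" using nat_approx_posE by metis
        moreover from z obtain x where "x \<in> K" "dist x z \<le> 1 / real (Suc n)"
          by (auto simp: N_def)
        ultimately show "\<exists>y\<in>K. dist y z < r" by (meson le_less_trans)
      qed
      then show "z \<in> K" using assms(1) by (simp add: compact_imp_closed closure_closed)
    qed
  qed
  moreover have "(\<lambda>n. measure lborel (N n)) \<longlonglongrightarrow> measure lborel (\<Inter>n. N n)"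
  proof (rule Lim_measure_decseq)
    show "range N \<subseteq> sets lborel" using cN by (auto intro: borel_compact)
    have "N m \<subseteq> N n" if "n \<le> m" for m n
      unfolding N_def using that by (intro UN_mono subset_cball) (auto simp: frac_le)
    then show "decseq N" by (auto simp: decseq_def)
    show "emeasure lborel (N i) \<noteq> \<infinity>" for i
      using emeasure_compact_finite[OF cN] by (simp add: less_top)
  qed
  ultimately have "eventually (\<lambda>n. measure lborel (N n) < measure lborel K + e) sequentially"
    using assms(2) by (intro order_tendstoD) auto
  then obtain n where "measure lborel (N n) < measure lborel K + e"
    by (auto simp: eventually_sequentially)
  then show ?thesis unfolding N_def by (intro exI[of _ "1 / real (Suc n)"]) auto
qed

lemma inner_compact_lborel:
  fixes B :: "'a::euclidean_space set"
  assumes "B \<in> sets borel" "emeasure lborel B < \<infinity>" "0 < e"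
  shows "\<exists>K. compact K \<and> K \<subseteq> B \<and> measure lborel B < measure lborel K + e"
proof -
  \<comment> \<open>Half of \<open>e\<close> is spent on a closed subset, half on cutting it off by
    a large ball.\<close>
  obtain T where T: "closed T" "T \<subseteq> B" "B - T \<in> lmeasurable" "emeasure lebesgue (B - T) < ennreal (e/2)"
    using sets_lebesgue_inner_closed[of B "e/2"] assms by auto
  define K where "K n = T \<inter> cball 0 (real n)" for n
  have TB: "emeasure lborel T < \<infinity>"
    using T emeasure_mono[of T B lborel] assms by (auto intro: le_less_trans)
  have "(\<lambda>n. measure lborel (K n)) \<longlonglongrightarrow> measure lborel (\<Union>n. K n)"
  proof (rule Lim_measure_incseq)
    have U: "(\<Union>n. K n) = T"
      by (auto simp: K_def) (meson real_arch_simple)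
    show "range K \<subseteq> sets lborel" using T by (auto simp: K_def)
    show "incseq K" unfolding incseq_def K_def using subset_cball[of "real _" "real _" 0]
      by fastforce
    show "emeasure lborel (\<Union>n. K n) \<noteq> \<infinity>" using TB U by auto
  qed
  moreover have "(\<Union>n. K n) = T"
    by (auto simp: K_def) (meson real_arch_simple)
  ultimately have "eventually (\<lambda>n. measure lborel T - e/2 < measure lborel (K n)) sequentially"
    using assms(3) by (intro order_tendstoD) auto
  then obtain n where n: "measure lborel T - e/2 < measure lborel (K n)"
    by (auto simp: eventually_sequentially)
  have "emeasure lborel (B - T) < ennreal (e/2)" using T assms by simp
  then have "measure lborel (B - T) < e/2"
    using assms(3) by (metis emeasure_eq_ennreal_measure ennreal_less_iff less_top measure_nonneg not_less_iff_gr_or_eq order_less_trans top.not_eq_extremum)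
  moreover have "measure lborel (B - T) = measure lborel B - measure lborel T"
    using assms T TB by (intro measure_Diff) auto
  ultimately show ?thesis
    using n T by (intro exI[of _ "K n"]) (auto simp: K_def compact_Int_closed closed_Int_compact)
qed

text \<open>Approximate \<open>B\<close> from inside by a compact \<open>K\<close> and let
  \<open>D\<close> be the union of the cells meeting \<open>K\<close>. The integral of
  \<open>h\<close> over \<open>D\<close> vanishes, and \<open>D\<close> lies between
  \<open>K\<close> and its \<open>s\<close>-neighbourhood, so \<open>B\<close> and \<open>D\<close>
  differ by a small set. The choice of \<open>s\<close> does not depend on \<open>h\<close>.\<close>

lemma balanced_integral_indicator_small:
  fixes B :: "'a::euclidean_space set"
  assumes B: "B \<in> sets borel" "emeasure lborel B < \<infinity>" and e: "0 < e"
  shows "\<exists>s>0. \<forall>h. balanced_on_cells s h \<longrightarrow> \<bar>\<integral>z. h z * indicator B z \<partial>lborel\<bar> \<le> e"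
proof -
  obtain K where K: "compact K" "K \<subseteq> B" "measure lborel B < measure lborel K + e/2"
    using inner_compact_lborel[OF B, of "e/2"] e by auto
  obtain s where s: "s > 0" "measure lborel (\<Union>x\<in>K. cball x s) < measure lborel K + e/2"
    using measure_compact_neighbourhood[OF K(1), of "e/2"] e by auto
  define N where "N = (\<Union>x\<in>K. cball x s)"
  have cN: "compact N" unfolding N_def by (rule compact_minkowski_sum_cball) fact
  have [measurable]: "K \<in> sets borel" "N \<in> sets borel" "B \<in> sets borel"
    using K cN B by (auto intro: borel_compact)
  have finN: "emeasure lborel N < \<infinity>" "emeasure lborel K < \<infinity>"
    using emeasure_compact_finite[OF cN] emeasure_compact_finite[OF K(1)] by auto
  have KN: "K \<subseteq> N" using s(1) by (auto simp: N_def intro!: bexI)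
  show ?thesis
  proof (intro exI[of _ s] conjI allI impI)
    fix h :: "'a \<Rightarrow> real" assume "balanced_on_cells s h"
    then obtain c :: "'a \<Rightarrow> int \<times> int" where h: "integrable lborel h" "\<And>z. \<bar>h z\<bar> \<le> 1"
      and c[measurable]: "c \<in> borel \<rightarrow>\<^sub>M count_space UNIV" and cd: "\<And>z z'. c z = c z' \<Longrightarrow> dist z z' \<le> s"
      and bal: "\<And>J. (\<integral>z. h z * indicator (c -` J) z \<partial>lborel) = 0"
      by (auto simp: balanced_on_cells_def)
    have hm[measurable]: "h \<in> borel_measurable borel" using h by auto
    define D where "D = c -` (c ` K)"
    have D[measurable]: "D \<in> sets borel" unfolding D_def using measurable_sets[OF c, of "c ` K"] by simp
    have KD: "K \<subseteq> D" "D \<subseteq> N"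
      using cd by (auto simp: D_def N_def)
    have int: "integrable lborel (\<lambda>z. h z * indicator E z)" if "E \<in> sets borel" for E
      using that by (intro Bochner_Integration.integrable_bound[OF h(1)]) (auto split: split_indicator)
    have i1: "integrable lborel (\<lambda>z. indicator B z - indicator K z :: real)" "integrable lborel (\<lambda>z. indicator N z - indicator K z :: real)"
      using B finN by auto
    have "\<bar>\<integral>z. h z * indicator B z \<partial>lborel\<bar> = \<bar>\<integral>z. h z * indicator B z - h z * indicator D z \<partial>lborel\<bar>"
      using bal[of "c ` K"] int by (simp add: D_def[symmetric])
    also have "\<dots> \<le> (\<integral>z. \<bar>h z * indicator B z - h z * indicator D z\<bar> \<partial>lborel)"
      by (rule integral_abs_bound)
    also have "\<dots> \<le> (\<integral>z. (indicator B z - indicator K z) + (indicator N z - indicator K z) \<partial>lborel)"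
    proof (rule integral_mono)
      show "integrable lborel (\<lambda>z. \<bar>h z * indicator B z - h z * indicator D z\<bar>)"
        using int by auto
      show "\<bar>h z * indicator B z - h z * indicator D z\<bar> \<le> (indicator B z - indicator K z) + (indicator N z - indicator K z)" for z
        using h(2)[of z] KD K(2) KN by (auto split: split_indicator)
    qed (rule Bochner_Integration.integrable_add[OF i1])
    also have "\<dots> = (measure lborel B - measure lborel K) + (measure lborel N - measure lborel K)"
      using i1 B finN by simp
    also have "\<dots> \<le> e" using K(3) s(2) by (simp add: N_def)
    finally show "\<bar>\<integral>z. h z * indicator B z \<partial>lborel\<bar> \<le> e" .
  qed fact
qed

lemma balanced_on_cells_mono: "balanced_on_cells s h \<Longrightarrow> s \<le> t \<Longrightarrow> balanced_on_cells t h"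
  unfolding balanced_on_cells_def by (meson order_trans)

text \<open>A Riemann-Lebesgue statement, uniform over all balanced functions of one scale. It
  extends from indicators by L1 approximation of \<open>k\<close>, whose error is uniform in
  \<open>h\<close> because \<open>h\<close> is bounded by 1.\<close>

lemma balanced_integral_small:
  fixes k :: "'a::euclidean_space \<Rightarrow> real"
  assumes "integrable lborel k" "0 < e"
  shows "\<exists>s>0. \<forall>h. balanced_on_cells s h \<longrightarrow> \<bar>\<integral>z. h z * k z \<partial>lborel\<bar> \<le> e"
  using assms
proof (induction k arbitrary: e rule: integrable_induct)
  case (base A c)
  \<comment> \<open>Adding 1 avoids a division by zero when \<open>c = 0\<close>.\<close>
  define c' where "c' = \<bar>c\<bar> + 1"
  have c': "c' > 0" "\<bar>c\<bar> \<le> c'" by (auto simp: c'_def)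
  obtain s where s: "s > 0" "\<And>h. balanced_on_cells s h \<Longrightarrow> \<bar>\<integral>z. h z * indicator A z \<partial>lborel\<bar> \<le> e / c'"
    using balanced_integral_indicator_small[of A "e / c'"] base c' by auto
  have "\<bar>\<integral>z. h z * (indicator A z *\<^sub>R c) \<partial>lborel\<bar> \<le> e" if "balanced_on_cells s h" for h
  proof -
    have "\<bar>\<integral>z. h z * (indicator A z *\<^sub>R c) \<partial>lborel\<bar> = \<bar>\<integral>z. h z * indicator A z \<partial>lborel\<bar> * \<bar>c\<bar>"
      by (simp add: mult.assoc[symmetric] abs_mult)
    also have "\<dots> \<le> e / c' * c'"
      using s(2)[OF that] c' by (intro mult_mono) auto
    finally show ?thesis using c' by simp
  qed
  with s(1) show ?case by blast
next
  case (add f g)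
  obtain s t where s: "s > 0" "\<And>h. balanced_on_cells s h \<Longrightarrow> \<bar>\<integral>z. h z * f z \<partial>lborel\<bar> \<le> e / 2"
    and t: "t > 0" "\<And>h. balanced_on_cells t h \<Longrightarrow> \<bar>\<integral>z. h z * g z \<partial>lborel\<bar> \<le> e / 2"
    using add.IH[of "e/2"] add.prems by fastforce
  show ?case
  proof (intro exI[of _ "min s t"] conjI allI impI)
    fix h :: "'a \<Rightarrow> real" assume h: "balanced_on_cells (min s t) h"
    have hm: "h \<in> borel_measurable borel" "\<And>z. \<bar>h z\<bar> \<le> 1"
      using h by (auto simp: balanced_on_cells_def)
    have int: "integrable lborel (\<lambda>z. h z * f z)" if "integrable lborel f" for f
      using that hm by (intro Bochner_Integration.integrable_bound[OF that])
        (auto simp: abs_mult intro!: mult_left_le_one_le)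
    have "\<bar>\<integral>z. h z * f z \<partial>lborel\<bar> \<le> e/2" "\<bar>\<integral>z. h z * g z \<partial>lborel\<bar> \<le> e/2"
      using s(2)[of h] t(2)[of h] balanced_on_cells_mono[OF h] by simp_all
    then show "\<bar>\<integral>z. h z * (f z + g z) \<partial>lborel\<bar> \<le> e"
      using int[OF add(1)] int[OF add(2)] by (simp add: distrib_left)
  qed (use s t in auto)
next
  case (lim f u)
  \<comment> \<open>The approximants are bounded by twice the absolute value of \<open>f\<close>,
    whence the dominating function with factor 3.\<close>
  have "(\<lambda>i. \<integral>z. \<bar>u i z - f z\<bar> \<partial>lborel) \<longlonglongrightarrow> (\<integral>z. 0 \<partial>(lborel :: 'a measure))"
  proof (rule Bochner_Integration.integral_dominated_convergence[where w="\<lambda>z. 3 * \<bar>f z\<bar>"])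
    show "AE z in lborel. (\<lambda>i. \<bar>u i z - f z\<bar>) \<longlonglongrightarrow> 0"
      using lim(2) by (auto intro!: tendsto_eq_intros tendsto_rabs_zero LIM_zero)
    show "AE z in lborel. norm \<bar>u i z - f z\<bar> \<le> 3 * \<bar>f z\<bar>" for i
    proof (rule AE_I2)
      fix z :: 'a
      show "norm \<bar>u i z - f z\<bar> \<le> 3 * \<bar>f z\<bar>"
        using lim(3)[of z i] by simp
    qed
  qed (use lim(1,4) in auto)
  then have "eventually (\<lambda>i. (\<integral>z. \<bar>u i z - f z\<bar> \<partial>lborel) < e/2) sequentially"
    using \<open>0 < e\<close> by (intro order_tendstoD) auto
  then obtain i where i: "(\<integral>z. \<bar>u i z - f z\<bar> \<partial>lborel) < e/2"
    by (auto simp: eventually_sequentially)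
  obtain s where s: "s > 0" "\<And>h. balanced_on_cells s h \<Longrightarrow> \<bar>\<integral>z. h z * u i z \<partial>lborel\<bar> \<le> e / 2"
    using lim.IH[of "e/2" i] \<open>0 < e\<close> by auto
  show ?case
  proof (intro exI[of _ s] conjI allI impI)
    fix h :: "'a \<Rightarrow> real" assume h: "balanced_on_cells s h"
    have hm: "h \<in> borel_measurable borel" "\<And>z. \<bar>h z\<bar> \<le> 1"
      using h by (auto simp: balanced_on_cells_def)
    have int: "integrable lborel (\<lambda>z. h z * f z)" if "integrable lborel f" for f
      using that hm by (intro Bochner_Integration.integrable_bound[OF that])
        (auto simp: abs_mult intro!: mult_left_le_one_le)
    have "\<bar>(\<integral>z. h z * u i z \<partial>lborel) - (\<integral>z. h z * f z \<partial>lborel)\<bar> = \<bar>\<integral>z. h z * (u i z - f z) \<partial>lborel\<bar>"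
      using int lim(1,4) by (simp add: right_diff_distrib)
    also have "\<dots> \<le> (\<integral>z. \<bar>h z * (u i z - f z)\<bar> \<partial>lborel)" by (rule integral_abs_bound)
    also have "\<dots> \<le> (\<integral>z. \<bar>u i z - f z\<bar> \<partial>lborel)"
    proof (rule integral_mono)
      show "integrable lborel (\<lambda>z. \<bar>h z * (u i z - f z)\<bar>)"
        using lim(1,4) by (intro integrable_abs int) auto
      show "\<bar>h z * (u i z - f z)\<bar> \<le> \<bar>u i z - f z\<bar>" for z
        using hm(2)[of z] by (simp add: abs_mult mult_left_le_one_le)
    qed (use lim(1,4) in auto)
    finally show "\<bar>\<integral>z. h z * f z \<partial>lborel\<bar> \<le> e"
      using i s(2)[OF h] by linarith
  qed fact
qed

text \<open>Clipping the parameter makes \<open>circle_arc v\<close> a unit vector in \<open>[0,1]\<^sup>2\<close> for every real \<open>v\<close>.\<close>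

definition circle_arc :: "real \<Rightarrow> real \<times> real" where
  "circle_arc v = (max 0 (min 1 v) / 4, sqrt (1 - (max 0 (min 1 v) / 4)\<^sup>2))"

lemma circle_arc_eq: "v \<in> {0..1} \<Longrightarrow> circle_arc v = (v / 4, sqrt (1 - (v / 4)\<^sup>2))"
  by (simp add: circle_arc_def)

lemma norm_circle_arc: "norm (circle_arc v) = 1"
proof -
  have "(max 0 (min 1 v) / 4)\<^sup>2 \<le> 1\<^sup>2" by (intro power_mono) auto
  then show ?thesis by (simp add: circle_arc_def norm_Pair)
qed

lemma circle_arc_bounds:
  "0 \<le> fst (circle_arc v)" "fst (circle_arc v) \<le> 1" "0 \<le> snd (circle_arc v)" "snd (circle_arc v) \<le> 1"
proof -
  have "(max 0 (min 1 v) / 4)\<^sup>2 \<le> 1\<^sup>2" by (intro power_mono) auto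
  then show "0 \<le> fst (circle_arc v)" "fst (circle_arc v) \<le> 1" "0 \<le> snd (circle_arc v)" "snd (circle_arc v) \<le> 1"
    by (auto simp: circle_arc_def)
qed

definition unit_interval :: "real measure" where
  "unit_interval = density lborel (indicator {0..1})"

section \<open>The difference map of the arc expands off the diagonal\<close>

lemma sqrt_circle_bounds:
  fixes x :: real
  assumes "0 \<le> x" "x \<le> 1/2"
  shows "1/2 \<le> sqrt (1 - x\<^sup>2)" "sqrt (1 - x\<^sup>2) \<le> 1" "(sqrt (1 - x\<^sup>2))\<^sup>2 = 1 - x\<^sup>2"
proof -
  have x2: "x\<^sup>2 \<le> 1/4" using power_mono[of x "1/2" 2] assms by (simp add: power_divide)
  then show "1/2 \<le> sqrt (1 - x\<^sup>2)" by (intro real_le_rsqrt) (simp add: power_divide)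
  show "sqrt (1 - x\<^sup>2) \<le> 1" by simp
  show "(sqrt (1 - x\<^sup>2))\<^sup>2 = 1 - x\<^sup>2" using x2 by simp
qed

text \<open>Difference of squares: the two roots add up to at least 1, while \<open>a + b\<close> is
  at most 1.\<close>

lemma sqrt_circle_lipschitz:
  fixes a b :: real
  assumes "0 \<le> a" "a \<le> 1/2" "0 \<le> b" "b \<le> 1/2"
  shows "\<bar>sqrt (1 - a\<^sup>2) - sqrt (1 - b\<^sup>2)\<bar> \<le> \<bar>a - b\<bar>"
proof -
  have sq: "1/2 \<le> sqrt (1 - a\<^sup>2)" "1/2 \<le> sqrt (1 - b\<^sup>2)"
    using assms sqrt_circle_bounds(1) by blast+
  have "(sqrt (1 - a\<^sup>2))\<^sup>2 = 1 - a\<^sup>2" "(sqrt (1 - b\<^sup>2))\<^sup>2 = 1 - b\<^sup>2"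
    using assms sqrt_circle_bounds(3) by blast+
  then have eq: "(sqrt (1 - a\<^sup>2) - sqrt (1 - b\<^sup>2)) * (sqrt (1 - a\<^sup>2) + sqrt (1 - b\<^sup>2)) = (b - a) * (b + a)"
    by (simp add: algebra_simps power2_eq_square)
  have pos: "0 \<le> sqrt (1 - a\<^sup>2) + sqrt (1 - b\<^sup>2)" "0 \<le> b + a"
    using sq assms by linarith+
  have "\<bar>sqrt (1 - a\<^sup>2) - sqrt (1 - b\<^sup>2)\<bar> * (sqrt (1 - a\<^sup>2) + sqrt (1 - b\<^sup>2)) = \<bar>b - a\<bar> * (b + a)"
    using arg_cong[OF eq, of abs] unfolding abs_mult abs_of_nonneg[OF pos(1)] abs_of_nonneg[OF pos(2)] .
  moreover have "\<bar>sqrt (1 - a\<^sup>2) - sqrt (1 - b\<^sup>2)\<bar> * 1 \<le> \<bar>sqrt (1 - a\<^sup>2) - sqrt (1 - b\<^sup>2)\<bar> * (sqrt (1 - a\<^sup>2) + sqrt (1 - b\<^sup>2))"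
    using sq by (intro mult_left_mono) auto
  moreover have "\<bar>b - a\<bar> * (b + a) \<le> \<bar>b - a\<bar> * 1"
    using assms by (intro mult_left_mono) auto
  ultimately show ?thesis by (simp add: abs_minus_commute)
qed

text \<open>Quantitative concavity: over an interval of length \<open>w\<close> the height drops by
  a quotient whose numerator grows at rate \<open>2 * w\<close> in the base point and whose
  denominator decreases and is at most 2.\<close>

lemma sqrt_circle_increment_decreasing:
  fixes a a' w :: real
  assumes "0 \<le> a" "a \<le> a'" "0 \<le> w" "a' + w \<le> 1/2"
  shows "w * (a' - a) \<le> (sqrt (1 - (a + w)\<^sup>2) - sqrt (1 - a\<^sup>2)) - (sqrt (1 - (a' + w)\<^sup>2) - sqrt (1 - a'\<^sup>2))"
proof -
  note r = sqrt_circle_bounds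
  have inc: "sqrt (1 - x\<^sup>2) - sqrt (1 - (x + w)\<^sup>2) = (2 * x * w + w\<^sup>2) / (sqrt (1 - x\<^sup>2) + sqrt (1 - (x + w)\<^sup>2))"
    if "0 \<le> x" "x + w \<le> 1/2" for x
  proof -
    have "(sqrt (1 - x\<^sup>2) - sqrt (1 - (x + w)\<^sup>2)) * (sqrt (1 - x\<^sup>2) + sqrt (1 - (x + w)\<^sup>2)) = 2 * x * w + w\<^sup>2"
      using r(3)[of x] r(3)[of "x + w"] that assms by (simp add: algebra_simps power2_eq_square)
    moreover have "sqrt (1 - x\<^sup>2) + sqrt (1 - (x + w)\<^sup>2) > 0"
      using r(1)[of x] r(1)[of "x + w"] that assms by linarith
    ultimately show ?thesis by (simp add: field_simps)
  qed
  define d where "d x = sqrt (1 - x\<^sup>2) + sqrt (1 - (x + w)\<^sup>2)" for x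
  have "d a' \<le> d a"
    using assms unfolding d_def by (intro add_mono real_sqrt_le_mono diff_left_mono power_mono) auto
  moreover have "1 \<le> d a'" "d a \<le> 2"
    using assms r(2)[of a] r(2)[of "a + w"] r(1)[of a'] r(1)[of "a' + w"] unfolding d_def by linarith+
  ultimately have d: "d a' \<le> d a" "1 \<le> d a'" "d a \<le> 2" .
  have "(2 * a * w + w\<^sup>2) / d a + w * (a' - a) \<le> (2 * a * w + w\<^sup>2) / d a + 2 * w * (a' - a) / d a"
  proof -
    have "(w * (a' - a)) * d a \<le> (w * (a' - a)) * 2"
      using d assms by (intro mult_left_mono) auto
    moreover have "0 < d a" using d by linarith
    ultimately show ?thesis by (simp add: pos_le_divide_eq mult_ac)
  qed
  also have "\<dots> = (2 * a' * w + w\<^sup>2) / d a" by (simp add: add_divide_distrib[symmetric] algebra_simps)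
  also have "\<dots> \<le> (2 * a' * w + w\<^sup>2) / d a'"
    using d assms by (intro divide_left_mono) auto
  finally show ?thesis using inc[of a] inc[of a'] assms by (simp add: d_def)
qed

text \<open>\<open>E\<close> is the l1 distance between two chords of the arc. Chords of equal width
  are separated by concavity, and a change of width is visible in the first coordinate. So the
  difference map separates points from (a, b) at a rate proportional to the width of the
  chord.\<close>

lemma circle_difference_expanding:
  fixes a b a' b' :: real
  assumes "a \<in> {0..1/4}" "b \<in> {0..1/4}" "a' \<in> {0..1/4}" "b' \<in> {0..1/4}"
  defines "E \<equiv> \<bar>(b' - a') - (b - a)\<bar> + \<bar>(sqrt (1 - b'\<^sup>2) - sqrt (1 - a'\<^sup>2)) - (sqrt (1 - b\<^sup>2) - sqrt (1 - a\<^sup>2))\<bar>"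
  shows "\<bar>a' - a\<bar> * \<bar>b - a\<bar> \<le> 2 * E" "\<bar>b' - b\<bar> * \<bar>b - a\<bar> \<le> 2 * E"
proof -
  have *: "\<bar>a' - a\<bar> * (b - a) \<le> E \<and> \<bar>b' - b\<bar> * (b - a) \<le> 2 * E"
    if "a \<le> b" "a \<in> {0..1/4}" "b \<in> {0..1/4}" "a' \<in> {0..1/4}" "b' \<in> {0..1/4}"
      "E = \<bar>(b' - a') - (b - a)\<bar> + \<bar>(sqrt (1 - b'\<^sup>2) - sqrt (1 - a'\<^sup>2)) - (sqrt (1 - b\<^sup>2) - sqrt (1 - a\<^sup>2))\<bar>"
    for a b a' b' E :: real
  proof -
    \<comment> \<open>Replacing \<open>b'\<close> by \<open>a' + w\<close> gives two chords of equal
      width. The point \<open>a' + w\<close> may exceed 1/4 but not 1/2, the range of the square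
      root estimates.\<close>
    define w where "w = b - a"
    let ?m = "\<lambda>x. sqrt (1 - (x + w)\<^sup>2) - sqrt (1 - x\<^sup>2)"
    have "w * \<bar>a' - a\<bar> \<le> \<bar>?m a - ?m a'\<bar>"
      using sqrt_circle_increment_decreasing[of a a' w] sqrt_circle_increment_decreasing[of a' a w] that
      by (cases "a \<le> a'") (auto simp: w_def)
    moreover have "\<bar>sqrt (1 - (a' + w)\<^sup>2) - sqrt (1 - b'\<^sup>2)\<bar> \<le> \<bar>(a' + w) - b'\<bar>"
      using that by (intro sqrt_circle_lipschitz) (auto simp: w_def)
    moreover have "?m a = sqrt (1 - b\<^sup>2) - sqrt (1 - a\<^sup>2)" by (simp add: w_def)
    ultimately have 1: "w * \<bar>a' - a\<bar> \<le> E" using that(6) by (simp add: w_def)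
    have "\<bar>b' - b\<bar> * w \<le> (\<bar>a' - a\<bar> + \<bar>(b' - a') - (b - a)\<bar>) * w"
      using that by (intro mult_right_mono) (auto simp: w_def)
    also have "\<dots> = w * \<bar>a' - a\<bar> + \<bar>(b' - a') - (b - a)\<bar> * w"
      by (simp add: algebra_simps)
    also have "\<dots> \<le> E + \<bar>(b' - a') - (b - a)\<bar> * 1"
      using that by (intro add_mono mult_left_mono 1) (auto simp: w_def)
    finally have "\<bar>b' - b\<bar> * w \<le> E + \<bar>(b' - a') - (b - a)\<bar>" by simp
    moreover have "\<bar>(b' - a') - (b - a)\<bar> \<le> E" using that(6) by simp
    ultimately have "\<bar>b' - b\<bar> * w \<le> 2 * E" by linarith
    with 1 show ?thesis unfolding w_def[symmetric] by (simp add: mult.commute)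
  qed
  have "0 \<le> E" by (simp add: E_def)
  \<comment> \<open>Exchanging the two endpoints of both chords leaves \<open>E\<close> unchanged,
    which settles the case \<open>b \<le> a\<close>.\<close>
  have E': "E = \<bar>(a' - b') - (a - b)\<bar> + \<bar>(sqrt (1 - a'\<^sup>2) - sqrt (1 - b'\<^sup>2)) - (sqrt (1 - a\<^sup>2) - sqrt (1 - b\<^sup>2))\<bar>"
    unfolding E_def by linarith
  have "\<bar>a' - a\<bar> * \<bar>b - a\<bar> \<le> 2 * E \<and> \<bar>b' - b\<bar> * \<bar>b - a\<bar> \<le> 2 * E"
  proof (cases "a \<le> b")
    case True
    from *[OF this assms(1-4) E_def[THEN meta_eq_to_obj_eq]] True \<open>0 \<le> E\<close> show ?thesis by auto
  next
    case False
    then have "b \<le> a" by simp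
    from *[OF this assms(2,1,4,3) E'] \<open>b \<le> a\<close> \<open>0 \<le> E\<close> show ?thesis by auto
  qed
  then show "\<bar>a' - a\<bar> * \<bar>b - a\<bar> \<le> 2 * E" "\<bar>b' - b\<bar> * \<bar>b - a\<bar> \<le> 2 * E" by auto
qed

text \<open>Off the diagonal the difference map is injective with a locally Lipschitz inverse, and
  such images of null sets are null; the diagonal is a null line. This gives absolute continuity
  without a Jacobian.\<close>

lemma negligible_arc_difference_vimage:
  assumes "negligible N"
  shows "negligible {(u, v). u \<in> {0..1} \<and> v \<in> {0..1} \<and> circle_arc v - circle_arc u \<in> N}"
proof -
  define \<Phi> :: "real \<times> real \<Rightarrow> real \<times> real" where "\<Phi> = (\<lambda>(u, v). circle_arc v - circle_arc u)"
  define S where "S = {(u, v). u \<in> {0..1} \<and> v \<in> {0..1} \<and> u \<noteq> v \<and> circle_arc v - circle_arc u \<in> N}"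
  \<comment> \<open>Parameters are four times the first coordinates, so each parameter difference
    costs \<open>32 * E\<close>. Adding the two and using
    \<open>E \<le> 2 * norm (\<Phi> y - \<Phi> x)\<close> gives the constant.\<close>
  have exp: "norm (y - x) * \<bar>snd x - fst x\<bar> \<le> 64 * (2 * norm (\<Phi> y - \<Phi> x))" if "x \<in> S" "y \<in> S" for x y
  proof -
    obtain u v u' v' where x: "x = (u, v)" and y: "y = (u', v')" by (cases x, cases y)
    define E where "E = \<bar>(v'/4 - u'/4) - (v/4 - u/4)\<bar> + \<bar>(sqrt (1 - (v'/4)\<^sup>2) - sqrt (1 - (u'/4)\<^sup>2)) - (sqrt (1 - (v/4)\<^sup>2) - sqrt (1 - (u/4)\<^sup>2))\<bar>"
    have "\<bar>u'/4 - u/4\<bar> * \<bar>v/4 - u/4\<bar> \<le> 2 * E" "\<bar>v'/4 - v/4\<bar> * \<bar>v/4 - u/4\<bar> \<le> 2 * E"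
    proof -
      have mem: "u/4 \<in> {0..1/4}" "v/4 \<in> {0..1/4}" "u'/4 \<in> {0..1/4}" "v'/4 \<in> {0..1/4}"
        using that by (auto simp: S_def x y)
      show "\<bar>u'/4 - u/4\<bar> * \<bar>v/4 - u/4\<bar> \<le> 2 * E" "\<bar>v'/4 - v/4\<bar> * \<bar>v/4 - u/4\<bar> \<le> 2 * E"
        unfolding E_def by (rule circle_difference_expanding[OF mem])+
    qed
    then have "\<bar>u' - u\<bar> * \<bar>v - u\<bar> \<le> 32 * E" "\<bar>v' - v\<bar> * \<bar>v - u\<bar> \<le> 32 * E"
      by (auto simp: abs_if field_simps split: if_splits)
    moreover have "norm (y - x) \<le> \<bar>u' - u\<bar> + \<bar>v' - v\<bar>"
      using norm_Pair_le[of "u' - u" "v' - v"] by (simp add: x y)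
    then have "norm (y - x) * \<bar>v - u\<bar> \<le> (\<bar>u' - u\<bar> + \<bar>v' - v\<bar>) * \<bar>v - u\<bar>"
      by (intro mult_right_mono) auto
    moreover have "E \<le> 2 * norm (\<Phi> y - \<Phi> x)"
      using norm_fst_le[of "fst (\<Phi> y - \<Phi> x)" "snd (\<Phi> y - \<Phi> x)"] norm_snd_le[of "snd (\<Phi> y - \<Phi> x)" "fst (\<Phi> y - \<Phi> x)"]
      using that by (simp add: E_def \<Phi>_def x y S_def circle_arc_eq)
    ultimately show ?thesis by (simp add: x y distrib_right)
  qed
  have S: "snd x - fst x \<noteq> 0" "\<Phi> x \<in> N" if "x \<in> S" for x
    using that by (auto simp: S_def \<Phi>_def)
  have inj: "inj_on \<Phi> S"
  proof (rule inj_onI)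
    fix x y assume "x \<in> S" "y \<in> S" "\<Phi> x = \<Phi> y"
    then have "norm (y - x) * \<bar>snd x - fst x\<bar> \<le> 0" using exp[of x y] by simp
    moreover have "\<bar>snd x - fst x\<bar> > 0" using S(1)[OF \<open>x \<in> S\<close>] by simp
    ultimately show "x = y" by (simp add: mult_le_0_iff)
  qed
  have "negligible (inv_into S \<Phi> ` (\<Phi> ` S))"
  proof (rule negligible_locally_Lipschitz_image)
    show "negligible (\<Phi> ` S)"
      using S(2) by (intro negligible_subset[OF assms]) auto
    fix z assume "z \<in> \<Phi> ` S"
    then obtain x where x: "x \<in> S" "z = \<Phi> x" by auto
    \<comment> \<open>Lipschitz control centred at one point suffices, so the constant may blow up
      towards the diagonal.\<close>
    have "norm (inv_into S \<Phi> z' - inv_into S \<Phi> z) \<le> (128 / \<bar>snd x - fst x\<bar>) * norm (z' - z)" if z': "z' \<in> \<Phi> ` S" for z'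
    proof -
      obtain y where y: "y \<in> S" "z' = \<Phi> y" using z' by blast
      show ?thesis
        using exp[OF x(1) y(1)] S(1)[OF x(1)] by (simp add: x y inj field_simps)
    qed
    then show "\<exists>T B. open T \<and> z \<in> T \<and> (\<forall>y\<in>\<Phi> ` S \<inter> T. norm (inv_into S \<Phi> y - inv_into S \<Phi> z) \<le> B * norm (y - z))"
      by (intro exI[of _ UNIV] exI[of _ "128 / \<bar>snd x - fst x\<bar>"]) auto
  qed simp
  moreover have "inv_into S \<Phi> ` (\<Phi> ` S) = S"
    using inj by (simp add: inv_into_image_cancel)
  ultimately have "negligible S" by simp
  moreover have "negligible {x :: real \<times> real. (1, -1) \<bullet> x = 0}"
    by (rule negligible_hyperplane) (simp add: zero_prod_def)
  ultimately show ?thesis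
    by (rule negligible_subset[OF negligible_Un]) (auto simp: S_def inner_prod_def)
qed

section \<open>The law of the difference of two points of the arc\<close>

lemma circle_arc_measurable[measurable]: "circle_arc \<in> borel_measurable borel"
  unfolding circle_arc_def[abs_def] by measurable

lemma prob_space_unit_interval: "prob_space unit_interval"
  by (rule prob_spaceI) (simp add: unit_interval_def emeasure_density)

lemma sets_unit_interval[measurable_cong, simp]: "sets unit_interval = sets borel"
  by (simp add: unit_interval_def)

text \<open>Radon-Nikodym for the law of the difference, which is absolutely continuous by
  \<open>negligible_arc_difference_vimage\<close>.\<close>

lemma arc_difference_density:
  obtains k where "integrable lborel k"
    "\<And>h :: real \<times> real \<Rightarrow> real. h \<in> borel_measurable borel \<Longrightarrow>
       (\<integral>x. h (circle_arc (snd x) - circle_arc (fst x)) \<partial>(unit_interval \<Otimes>\<^sub>M unit_interval)) = (\<integral>z. h z * k z \<partial>lborel)"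
proof -
  interpret I: prob_space unit_interval by (rule prob_space_unit_interval)
  interpret II: pair_prob_space unit_interval unit_interval ..
  let ?II = "unit_interval \<Otimes>\<^sub>M unit_interval"
  define \<Phi> :: "real \<times> real \<Rightarrow> real \<times> real" where "\<Phi> = (\<lambda>x. circle_arc (snd x) - circle_arc (fst x))"
  have \<Phi>[measurable]: "\<Phi> \<in> ?II \<rightarrow>\<^sub>M borel" unfolding \<Phi>_def by measurable
  have [measurable]: "fst \<in> borel_measurable (borel :: (real \<times> real) measure)"
      "snd \<in> borel_measurable (borel :: (real \<times> real) measure)"
    by (simp_all add: borel_prod[symmetric])
  have \<Phi>'[measurable]: "\<Phi> \<in> borel \<rightarrow>\<^sub>M borel" unfolding \<Phi>_def by measurable
  have [measurable]: "{0..1::real} \<times> {0..1::real} \<in> sets borel"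
    by (intro borel_closed closed_Times) auto
  have II_eq: "?II = density lborel (indicator ({0..1} \<times> {0..1}))"
    unfolding unit_interval_def
    by (subst pair_measure_density)
       (auto simp: lborel_prod indicator_times case_prod_beta' intro!: density_cong intro: lborel.sigma_finite_measure_axioms
          prob_space_imp_sigma_finite prob_space_unit_interval[unfolded unit_interval_def])
  interpret D: prob_space "distr ?II borel \<Phi>" by (rule II.prob_space_distr) (rule \<Phi>)
  have "absolutely_continuous lborel (distr ?II borel \<Phi>)"
    unfolding absolutely_continuous_def
  proof
    fix N :: "(real \<times> real) set" assume N: "N \<in> null_sets lborel"
    then have [measurable]: "N \<in> sets borel" by auto
    have "negligible N"
      using N by (simp add: negligible_iff_null_sets null_sets_completionI)
    from negligible_arc_difference_vimage[OF this]
    have neg: "{(u, v). u \<in> {0..1} \<and> v \<in> {0..1} \<and> circle_arc v - circle_arc u \<in> N} \<in> null_sets lebesgue"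
      by (simp add: negligible_iff_null_sets)
    have "{x \<in> space (borel \<Otimes>\<^sub>M borel). fst x \<in> {0..1} \<and> snd x \<in> {0..1} \<and> circle_arc (snd x) - circle_arc (fst x) \<in> N}
        \<in> sets (borel \<Otimes>\<^sub>M borel)"
      by measurable
    then have m: "{(u, v). u \<in> {0..1} \<and> v \<in> {0..1} \<and> circle_arc v - circle_arc u \<in> N} \<in> sets borel"
      by (simp add: borel_prod case_prod_beta')
    then have "emeasure lborel {(u, v). u \<in> {0..1} \<and> v \<in> {0..1} \<and> circle_arc v - circle_arc u \<in> N} = 0"
      using null_setsD1[OF neg] by simp
    moreover have "emeasure (distr ?II borel \<Phi>) N = emeasure lborel {(u, v). u \<in> {0..1} \<and> v \<in> {0..1} \<and> circle_arc v - circle_arc u \<in> N}"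
    proof -
      have "emeasure (distr ?II borel \<Phi>) N = emeasure ?II (\<Phi> -` N)"
        by (subst emeasure_distr) (auto simp: II_eq)
      also have "\<dots> = (\<integral>\<^sup>+x. indicator ({0..1} \<times> {0..1}) x * indicator (\<Phi> -` N) x \<partial>lborel)"
        unfolding II_eq using measurable_sets[OF \<Phi>', of N]
        by (subst emeasure_density) auto
      also have "\<dots> = (\<integral>\<^sup>+x. indicator {(u, v). u \<in> {0..1} \<and> v \<in> {0..1} \<and> circle_arc v - circle_arc u \<in> N} x \<partial>lborel)"
        by (intro nn_integral_cong) (auto simp: \<Phi>_def split: split_indicator)
      finally show ?thesis using m by simp
    qed
    ultimately show "N \<in> null_sets (distr ?II borel \<Phi>)" by auto
  qed
  from sigma_finite_measure.Radon_Nikodym[OF sigma_finite_lborel this] obtain f where f: "f \<in> borel_measurable lborel" "density lborel f = distr ?II borel \<Phi>"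
    by auto
  have "integral\<^sup>N lborel f = 1"
    using D.emeasure_space_1 f(1) unfolding f(2)[symmetric] by (simp add: emeasure_density)
  \<comment> \<open>Total mass 1 makes the density finite almost everywhere, so it has a real-valued
    version.\<close>
  then have "AE x in lborel. f x \<noteq> \<infinity>"
    using nn_integral_PInf_AE[OF f(1)] by simp
  then have AE: "AE x in lborel. f x = ennreal (enn2real (f x))"
    by eventually_elim (simp add: less_top)
  define k where "k x = enn2real (f x)" for x
  have [measurable]: "k \<in> borel_measurable lborel" using f by (simp add: k_def[abs_def])
  have dens: "distr ?II borel \<Phi> = density lborel (\<lambda>x. ennreal (k x))"
    unfolding f(2)[symmetric] k_def using f AE by (intro density_cong) auto
  have "integrable lborel k"
  proof (rule integrableI_nonneg)
    have "(\<integral>\<^sup>+x. ennreal (k x) \<partial>lborel) = (\<integral>\<^sup>+x. f x \<partial>lborel)"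
      using AE by (intro nn_integral_cong_AE) (auto simp: k_def)
    then show "(\<integral>\<^sup>+x. ennreal (k x) \<partial>lborel) < \<infinity>" using \<open>integral\<^sup>N lborel f = 1\<close> by simp
  qed (auto simp: k_def)
  moreover have "(\<integral>x. h (circle_arc (snd x) - circle_arc (fst x)) \<partial>?II) = (\<integral>z. h z * k z \<partial>lborel)"
    if h[measurable]: "h \<in> borel_measurable borel" for h :: "real \<times> real \<Rightarrow> real"
  proof -
    have "(\<integral>x. h (circle_arc (snd x) - circle_arc (fst x)) \<partial>?II) = (\<integral>z. h z \<partial>distr ?II borel \<Phi>)"
      by (subst integral_distr) (auto simp: \<Phi>_def)
    also have "\<dots> = (\<integral>z. k z *\<^sub>R h z \<partial>lborel)"
      unfolding dens by (subst integral_density) (auto simp: k_def)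
    finally show ?thesis by (simp add: mult.commute)
  qed
  ultimately show thesis by (rule that)
qed

text \<open>The density belongs to one fixed arc, so \<open>s\<close> depends on \<open>e\<close>
  alone. This is the source of uniformity over all radii and test functions later.\<close>

lemma balanced_arc_difference_small:
  assumes "0 < e"
  shows "\<exists>s>0. \<forall>h. balanced_on_cells s h \<longrightarrow>
    \<bar>\<integral>x. h (circle_arc (snd x) - circle_arc (fst x)) \<partial>(unit_interval \<Otimes>\<^sub>M unit_interval)\<bar> \<le> e"
proof -
  obtain k where k: "integrable lborel k"
    "\<And>h :: real \<times> real \<Rightarrow> real. h \<in> borel_measurable borel \<Longrightarrow>
       (\<integral>x. h (circle_arc (snd x) - circle_arc (fst x)) \<partial>(unit_interval \<Otimes>\<^sub>M unit_interval)) = (\<integral>z. h z * k z \<partial>lborel)"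
    using arc_difference_density by blast
  from balanced_integral_small[OF k(1) assms] obtain s where
    "s > 0" "\<And>h. balanced_on_cells s h \<Longrightarrow> \<bar>\<integral>z. h z * k z \<partial>lborel\<bar> \<le> e" by blast
  moreover have "h \<in> borel_measurable borel" if "balanced_on_cells s h" for h :: "real \<times> real \<Rightarrow> real"
    using that by (auto simp: balanced_on_cells_def)
  ultimately show ?thesis using k(2) by (intro exI[of _ s]) auto
qed

section \<open>Averages over dyadic cells\<close>

definition unit_square :: "(real \<times> real) set" where
  "unit_square = {0..<1} \<times> {0..<1}"

definition cell :: "nat \<Rightarrow> real \<times> real \<Rightarrow> int \<times> int" where
  "cell m p = (\<lfloor>2 ^ m * fst p\<rfloor>, \<lfloor>2 ^ m * snd p\<rfloor>)"

text \<open>The factor \<open>4 ^ m\<close> is the inverse area of a cell, so this is the density of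
  the uniform law on the cell of \<open>p\<close>. It is symmetric in \<open>p\<close> and
  \<open>q\<close>.\<close>

definition cell_kernel :: "nat \<Rightarrow> real \<times> real \<Rightarrow> real \<times> real \<Rightarrow> real" where
  "cell_kernel m p q = (if cell m p = cell m q then 4 ^ m else 0)"

text \<open>The conditional expectation of \<open>g\<close> on the dyadic cells of level
  \<open>m\<close>.\<close>

definition cell_avg :: "nat \<Rightarrow> (real \<times> real \<Rightarrow> real) \<Rightarrow> real \<times> real \<Rightarrow> real" where
  "cell_avg m g p = (\<integral>q. cell_kernel m p q * g q \<partial>lborel)"

section \<open>Dyadic cells and their uniform kernels\<close>

lemma fst_snd_borel[measurable]:
  "fst \<in> (borel :: ('a::second_countable_topology \<times> 'b::second_countable_topology) measure) \<rightarrow>\<^sub>M borel"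
  "snd \<in> (borel :: ('a::second_countable_topology \<times> 'b::second_countable_topology) measure) \<rightarrow>\<^sub>M borel"
  by (simp_all add: borel_prod[symmetric])

lemma unit_square_borel[measurable]: "unit_square \<in> sets borel"
  unfolding unit_square_def borel_prod[symmetric] by measurable

lemma cell_measurable[measurable]: "cell m \<in> borel \<rightarrow>\<^sub>M count_space UNIV"
proof -
  have "cell m \<in> borel \<rightarrow>\<^sub>M count_space UNIV \<Otimes>\<^sub>M count_space UNIV"
    unfolding cell_def[abs_def] by measurable
  then show ?thesis by (simp add: pair_measure_countable)
qed

lemma cell_kernel_measurable[measurable]:
  "(\<lambda>(p, q). cell_kernel m p q) \<in> borel_measurable (borel \<Otimes>\<^sub>M borel)"
  unfolding cell_kernel_def by measurable

lemma cell_coarsen: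
  assumes "cell m p = cell m q" "l \<le> m"
  shows "cell l p = cell l q"
proof -
  \<comment> \<open>The coarser index is the integer quotient of the finer one.\<close>
  have "\<lfloor>2 ^ l * x\<rfloor> = \<lfloor>2 ^ m * x\<rfloor> div 2 ^ (m - l)" for x :: real
  proof -
    have "(2::real) ^ m = 2 ^ l * 2 ^ (m - l)"
      using assms(2) by (simp flip: power_add)
    then have "2 ^ l * x = (2 ^ m * x) / real_of_int (2 ^ (m - l))" by simp
    then show ?thesis using floor_divide_real_eq_div[of "2 ^ (m - l)" "2 ^ m * x"] by simp
  qed
  then show ?thesis using assms(1) by (simp add: cell_def)
qed

text \<open>The square is half-open so that it is exactly one cell of level 0; hence no cell
  straddles its boundary.\<close>

lemma unit_square_iff_cell: "p \<in> unit_square \<longleftrightarrow> cell 0 p = (0, 0)"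
  by (cases p) (auto simp: unit_square_def cell_def floor_eq_iff)

lemma unit_square_cell:
  assumes "cell m p = cell m q"
  shows "p \<in> unit_square \<longleftrightarrow> q \<in> unit_square"
  using cell_coarsen[OF assms, of 0] by (simp add: unit_square_iff_cell)

lemma dist_cell:
  assumes "cell m p = cell m q"
  shows "dist p q \<le> 2 / 2 ^ m"
proof -
  have *: "\<bar>x - y\<bar> \<le> 1 / 2 ^ m" if "\<lfloor>2 ^ m * x\<rfloor> = \<lfloor>2 ^ m * y\<rfloor>" for x y :: real
  proof -
    have "\<bar>2 ^ m * x - 2 ^ m * y\<bar> < 1" using that by linarith
    then have "2 ^ m * \<bar>x - y\<bar> < 1" by (simp add: abs_mult right_diff_distrib[symmetric])
    then show ?thesis by (simp add: field_simps)
  qed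
  have "norm (p - q) \<le> \<bar>fst p - fst q\<bar> + \<bar>snd p - snd q\<bar>"
    using norm_Pair_le[of "fst p - fst q" "snd p - snd q"] by (cases p, cases q) simp
  also have "\<dots> \<le> 1 / 2 ^ m + 1 / 2 ^ m"
    using assms by (intro add_mono *) (auto simp: cell_def)
  finally show ?thesis by (simp add: dist_norm)
qed

lemma cell_vimage: "{q. cell m p = cell m q} \<in> sets borel"
  by measurable

lemma emeasure_cell: "emeasure lborel {q. cell m p = cell m q} = ennreal (1 / 4 ^ m)"
proof -
  define i where "i = \<lfloor>2 ^ m * fst p\<rfloor>"
  define j where "j = \<lfloor>2 ^ m * snd p\<rfloor>"
  have fl: "i = \<lfloor>2 ^ m * x\<rfloor> \<longleftrightarrow> x \<in> {real_of_int i / 2 ^ m ..< (real_of_int i + 1) / 2 ^ m}" for i x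
    by (auto simp: field_simps eq_commute[of i] floor_eq_iff)
  have "{q. cell m p = cell m q} =
      {real_of_int i / 2 ^ m ..< (real_of_int i + 1) / 2 ^ m} \<times> {real_of_int j / 2 ^ m ..< (real_of_int j + 1) / 2 ^ m}"
    by (auto simp: cell_def i_def[symmetric] j_def[symmetric] fl simp del: atLeastLessThan_iff)
  moreover have "emeasure lborel {real_of_int i / 2 ^ m ..< (real_of_int i + 1) / 2 ^ m} = ennreal (1 / 2 ^ m)" for i
    by (subst emeasure_lborel_Ico) (auto simp: divide_right_mono add_divide_distrib)
  ultimately have "emeasure lborel {q. cell m p = cell m q} = ennreal (1 / 2 ^ m) * ennreal (1 / 2 ^ m)"
    by (simp add: lborel_prod[symmetric] lborel.emeasure_pair_measure_Times)
  also have "\<dots> = ennreal (1 / 4 ^ m)"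
    by (simp add: ennreal_mult[symmetric] power_mult_distrib[symmetric])
  finally show ?thesis .
qed

lemma nn_integral_cell_kernel: "(\<integral>\<^sup>+q. ennreal (cell_kernel m p q) \<partial>lborel) = 1"
proof -
  have "(\<integral>\<^sup>+q. ennreal (cell_kernel m p q) \<partial>lborel) = (\<integral>\<^sup>+q. ennreal (4 ^ m) * indicator {q. cell m p = cell m q} q \<partial>lborel)"
    by (intro nn_integral_cong) (auto simp: cell_kernel_def split: split_indicator)
  also have "\<dots> = ennreal (4 ^ m) * ennreal (1 / 4 ^ m)"
    using cell_vimage[of m p] by (subst nn_integral_cmult_indicator) (auto simp: emeasure_cell)
  also have "\<dots> = 1" by (simp add: ennreal_mult[symmetric])
  finally show ?thesis .
qed

lemma cell_kernel_nonneg[simp]: "0 \<le> cell_kernel m p q"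
  by (simp add: cell_kernel_def)

lemma cell_kernel_integral: "integrable lborel (cell_kernel m p)" "(\<integral>q. cell_kernel m p q \<partial>lborel) = 1"
proof -
  have m: "cell_kernel m p \<in> borel_measurable lborel"
    unfolding cell_kernel_def by measurable
  show "integrable lborel (cell_kernel m p)"
    using nn_integral_cell_kernel[of m p] by (intro integrableI_nonneg m) auto
  show "(\<integral>q. cell_kernel m p q \<partial>lborel) = 1"
    using nn_integral_cell_kernel[of m p] m by (subst integral_eq_nn_integral) auto
qed

text \<open>Lebesgue measure is infinite, so integrability for Fubini is drawn from bounded support
  in the first variable.\<close>

lemma integrable_bounded_support:
  fixes F :: "'a::euclidean_space \<times> 'b \<Rightarrow> real"
  assumes "finite_measure N" "F \<in> borel_measurable (lborel \<Otimes>\<^sub>M N)" "\<And>z. \<bar>F z\<bar> \<le> B"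
    "\<And>p x. p \<notin> cbox a b \<Longrightarrow> F (p, x) = 0" 
  shows "integrable (lborel \<Otimes>\<^sub>M N) F"
proof -
  interpret N: finite_measure N by fact
  have "integrable (lborel \<Otimes>\<^sub>M N) (\<lambda>z. B * indicator (cbox a b \<times> space N) z)"
    by (intro integrable_mult_right integrable_real_indicator)
       (auto simp: N.emeasure_pair_measure_Times emeasure_lborel_cbox_eq N.emeasure_eq_measure ennreal_mult_less_top)
  then show ?thesis
  proof (rule Bochner_Integration.integrable_bound)
    show "AE z in lborel \<Otimes>\<^sub>M N. norm (F z) \<le> norm (B * indicator (cbox a b \<times> space N) z)"
    proof (rule AE_I2)
      fix z :: "'a \<times> 'b" assume "z \<in> space (lborel \<Otimes>\<^sub>M N)"
      then show "norm (F z) \<le> norm (B * indicator (cbox a b \<times> space N) z)"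
        using assms(3)[of z] assms(4)[of "fst z" "snd z"]
        by (cases z) (auto simp: space_pair_measure split: split_indicator)
    qed
  qed fact
qed

lemma emeasure_unit_square: "emeasure lborel unit_square = 1"
  unfolding unit_square_def by (simp add: lborel_prod[symmetric] lborel.emeasure_pair_measure_Times)

lemma integrable_unit_square:
  fixes g :: "real \<times> real \<Rightarrow> real"
  assumes "g \<in> borel_measurable borel" "\<And>p. \<bar>g p\<bar> \<le> B" "\<And>p. p \<notin> unit_square \<Longrightarrow> g p = 0"
  shows "integrable lborel g"
proof -
  have "integrable lborel (\<lambda>p. B * indicator unit_square p)"
    by (intro integrable_mult_right integrable_real_indicator) (auto simp: emeasure_unit_square)
  then show ?thesis
  proof (rule Bochner_Integration.integrable_bound)
    show "AE p in lborel. norm (g p) \<le> norm (B * indicator unit_square p)"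
    proof (rule AE_I2)
      fix p
      show "norm (g p) \<le> norm (B * indicator unit_square p)"
        using assms(2)[of p] assms(3)[of p] by (cases "p \<in> unit_square") auto
    qed
  qed (use assms in auto)
qed

section \<open>Cell averages as orthogonal projections\<close>

lemma test_funD:
  assumes "test_fun X g"
  shows "g \<in> borel_measurable borel" "0 \<le> g p" "g p \<le> 1" "p \<notin> X \<Longrightarrow> g p = 0" "\<bar>g p\<bar> \<le> 1"
  using assms by (auto simp: test_fun_def)

lemma cell_avg_measurable:
  assumes [measurable]: "g \<in> borel_measurable borel"
  shows "cell_avg m g \<in> borel_measurable borel"
proof -
  have "(\<lambda>p. \<integral>q. cell_kernel m p q * g q \<partial>lborel) \<in> borel_measurable borel"
    by measurable
  then show ?thesis by (simp add: cell_avg_def[abs_def])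
qed

lemma cell_avg_const: "cell m p = cell m q \<Longrightarrow> cell_avg m g p = cell_avg m g q"
  by (simp add: cell_avg_def cell_kernel_def)

lemma test_fun_cell_avg:
  assumes g: "test_fun unit_square g"
  shows "test_fun unit_square (cell_avg m g)"
proof -
  have [measurable]: "g \<in> borel_measurable borel" using test_funD[OF g] by simp
  have 1: "0 \<le> cell_avg m g p" for p
    unfolding cell_avg_def using test_funD[OF g] by (intro integral_nonneg_AE) auto
  have 2: "cell_avg m g p \<le> 1" for p
  proof -
    have "cell_avg m g p \<le> (\<integral>q. cell_kernel m p q \<partial>lborel)"
      unfolding cell_avg_def
    proof (rule integral_mono)
      show "integrable lborel (\<lambda>q. cell_kernel m p q * g q)"
        using test_funD[OF g]
        by (intro Bochner_Integration.integrable_bound[OF cell_kernel_integral(1)[of m p]])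
           (auto simp: abs_mult intro!: mult_left_le)
      show "cell_kernel m p q * g q \<le> cell_kernel m p q" for q
        using test_funD[OF g] by (intro mult_left_le) auto
    qed (rule cell_kernel_integral)
    then show ?thesis by (simp add: cell_kernel_integral)
  qed
  have 3: "cell_avg m g p = 0" if "p \<notin> unit_square" for p
  proof -
    have "cell_kernel m p q * g q = 0" for q
      using that unit_square_cell[of m p q] test_funD(4)[OF g, of q] by (auto simp: cell_kernel_def)
    then have "(\<lambda>q. cell_kernel m p q * g q) = (\<lambda>q. 0)" by (intro ext)
    then show ?thesis unfolding cell_avg_def by simp
  qed
  show ?thesis
    unfolding test_fun_def using 1 2 3 cell_avg_measurable[of g m] by auto
qed

text \<open>After Fubini, \<open>\<phi>\<close> may be moved from \<open>p\<close> to
  \<open>q\<close> on the support of the symmetric kernel, whose remaining integral is 1.\<close>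

lemma integral_cell_avg_mult:
  assumes g: "test_fun unit_square g" and \<phi>: "\<phi> \<in> borel_measurable borel" "\<And>p. \<bar>\<phi> p\<bar> \<le> 1"
    and const: "\<And>p q. cell m p = cell m q \<Longrightarrow> \<phi> p = \<phi> q"
  shows "(\<integral>p. cell_avg m g p * \<phi> p \<partial>lborel) = (\<integral>p. g p * \<phi> p \<partial>lborel)"
proof -
  have [measurable]: "g \<in> borel_measurable borel" "\<phi> \<in> borel_measurable borel"
    using test_funD[OF g] \<phi> by auto
  define F where "F = (\<lambda>(p, q). cell_kernel m p q * g q * \<phi> p)"
  have "integrable (lborel \<Otimes>\<^sub>M lborel) F"
    unfolding lborel_prod
  proof -
    have S: "emeasure lborel (unit_square \<times> unit_square) < \<infinity>"
      by (subst lborel_prod[symmetric], subst lborel.emeasure_pair_measure_Times) (auto simp: emeasure_unit_square)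
    have [measurable]: "unit_square \<times> unit_square \<in> sets borel"
      by (intro borel_Times) auto
    have "F \<in> borel_measurable (borel \<Otimes>\<^sub>M borel)" unfolding F_def by measurable
    then have Fm: "F \<in> borel_measurable lborel" by (simp add: borel_prod)
    have "integrable lborel (\<lambda>z. 4 ^ m * indicator (unit_square \<times> unit_square) z :: real)"
      using S by (intro integrable_mult_right integrable_real_indicator) auto
    then show "integrable lborel F"
    proof (rule Bochner_Integration.integrable_bound)
      show "AE z in lborel. norm (F z) \<le> norm (4 ^ m * indicator (unit_square \<times> unit_square) z :: real)"
      proof (rule AE_I2, clarify)
        fix p q :: "real \<times> real"
        show "norm (F (p, q)) \<le> norm (4 ^ m * indicator (unit_square \<times> unit_square) (p, q) :: real)"
        proof (cases "q \<in> unit_square \<and> cell m p = cell m q")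
          case True
          then have "p \<in> unit_square" using unit_square_cell[of m p q] by simp
          have "\<bar>g q\<bar> * \<bar>\<phi> p\<bar> \<le> 1 * 1"
            using test_funD[OF g] \<phi> by (intro mult_mono) auto
          with True \<open>p \<in> unit_square\<close> show ?thesis
            by (simp add: F_def cell_kernel_def abs_mult mult.assoc)
        next
          case False
          then have "F (p, q) = 0" using test_funD(4)[OF g, of q] by (auto simp: F_def cell_kernel_def)
          then show ?thesis by simp
        qed
      qed
    qed (rule Fm)
  qed
  then have "integrable (lborel \<Otimes>\<^sub>M lborel) (\<lambda>(p, q). cell_kernel m p q * g q * \<phi> p)" by (simp add: F_def)
  from lborel_pair.Fubini_integral[OF this]
  have "(\<integral>q. (\<integral>p. cell_kernel m p q * g q * \<phi> p \<partial>lborel) \<partial>lborel) = (\<integral>p. (\<integral>q. cell_kernel m p q * g q * \<phi> p \<partial>lborel) \<partial>lborel)"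
    by simp
  also have "(\<lambda>p. \<integral>q. cell_kernel m p q * g q * \<phi> p \<partial>lborel) = (\<lambda>p. cell_avg m g p * \<phi> p)"
    by (simp add: cell_avg_def)
  also have "(\<lambda>q. \<integral>p. cell_kernel m p q * g q * \<phi> p \<partial>lborel) = (\<lambda>q. \<integral>p. cell_kernel m q p * (g q * \<phi> q) \<partial>lborel)"
    by (intro ext Bochner_Integration.integral_cong refl) (auto simp: cell_kernel_def dest: const)
  also have "\<dots> = (\<lambda>q. g q * \<phi> q)"
    by (simp add: cell_kernel_integral)
  finally show ?thesis by simp
qed

text \<open>Tower property: a coarser average is constant on the finer cells.\<close>

lemma integral_mult_cell_avg:
  assumes g: "test_fun unit_square g" and "l \<le> m"
  shows "(\<integral>p. cell_avg m g p * cell_avg l g p \<partial>lborel) = (\<integral>p. g p * cell_avg l g p \<partial>lborel)"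
  using test_funD[OF test_fun_cell_avg[OF g, of l]] assms(2)
  by (intro integral_cell_avg_mult[OF g]) (auto intro: cell_avg_const cell_coarsen)

lemma integrable_test_mult:
  assumes "test_fun unit_square g" "test_fun unit_square h"
  shows "integrable lborel (\<lambda>p. g p * h p)"
  using test_funD[OF assms(1)] test_funD[OF assms(2)]
  by (intro integrable_unit_square[where B=1]) (auto simp: abs_mult intro!: mult_le_one)

text \<open>Pythagoras for nested projections: every product of averages reduces to a pairing of
  \<open>g\<close> with one average.\<close>

lemma integral_cell_avg_diff_square:
  assumes g: "test_fun unit_square g" and "l \<le> m"
  shows "(\<integral>p. (cell_avg m g p - cell_avg l g p)\<^sup>2 \<partial>lborel) =
    (\<integral>p. g p * cell_avg m g p \<partial>lborel) - (\<integral>p. g p * cell_avg l g p \<partial>lborel)"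
proof -
  have "(\<integral>p. (cell_avg m g p - cell_avg l g p)\<^sup>2 \<partial>lborel) =
    (\<integral>p. cell_avg m g p * cell_avg m g p - 2 * (cell_avg m g p * cell_avg l g p) + cell_avg l g p * cell_avg l g p \<partial>lborel)"
    by (intro Bochner_Integration.integral_cong refl) (simp add: power2_eq_square algebra_simps)
  also have "\<dots> = (\<integral>p. cell_avg m g p * cell_avg m g p \<partial>lborel) - 2 * (\<integral>p. cell_avg m g p * cell_avg l g p \<partial>lborel)
      + (\<integral>p. cell_avg l g p * cell_avg l g p \<partial>lborel)"
    by (simp add: integrable_test_mult test_fun_cell_avg g)
  also have "\<dots> = (\<integral>p. g p * cell_avg m g p \<partial>lborel) - (\<integral>p. g p * cell_avg l g p \<partial>lborel)"
    using integral_mult_cell_avg[OF g, of m m] integral_mult_cell_avg[OF g, of l m] integral_mult_cell_avg[OF g, of l l] assms(2)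
    by simp
  finally show ?thesis .
qed

section \<open>Couplings\<close>

definition square_measure :: "(real \<times> real) measure" where
  "square_measure = density lborel (indicator unit_square)"

text \<open>The first point is uniform in the square and the second uniform in its cell; given the
  cell, the two are independent.\<close>

definition cell_coupling :: "nat \<Rightarrow> ((real \<times> real) \<times> (real \<times> real)) measure" where
  "cell_coupling m = density (square_measure \<Otimes>\<^sub>M lborel) (\<lambda>(p, q). ennreal (cell_kernel m p q))"

text \<open>The second point may leave the square; test functions vanish there, so such pairs
  contribute nothing.\<close>

definition circle_coupling :: "real \<Rightarrow> ((real \<times> real) \<times> (real \<times> real)) measure" where
  "circle_coupling \<tau> = distr (square_measure \<Otimes>\<^sub>M unit_interval) borel (\<lambda>(p, v). (p, p + \<tau> *\<^sub>R circle_arc v))"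

text \<open>
  The endpoint of the circle coupling is averaged over its cell of side \<open>2\<^sup>-\<^sup>l\<close>. Pairs that lie in
  different cells of side \<open>2\<^sup>-\<^sup>m\<close> are discarded, so that the result is dominated by \<open>cell_coupling m\<close>.
\<close>

definition smooth_weight :: "real \<Rightarrow> nat \<Rightarrow> nat \<Rightarrow> ((real \<times> real) \<times> real) \<times> (real \<times> real) \<Rightarrow> real" where
  "smooth_weight \<tau> m l = (\<lambda>((p, v), q).
     if cell m p = cell m (p + \<tau> *\<^sub>R circle_arc v) then cell_kernel l (p + \<tau> *\<^sub>R circle_arc v) q else 0)"

definition smooth_coupling :: "real \<Rightarrow> nat \<Rightarrow> nat \<Rightarrow> ((real \<times> real) \<times> (real \<times> real)) measure" where
  "smooth_coupling \<tau> m l =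
     distr (density ((square_measure \<Otimes>\<^sub>M unit_interval) \<Otimes>\<^sub>M lborel) (\<lambda>x. ennreal (smooth_weight \<tau> m l x)))
       borel (\<lambda>x. (fst (fst x), snd x))"

section \<open>Integration against the couplings\<close>

lemma sets_square_measure[measurable_cong, simp]: "sets square_measure = sets borel"
  by (simp add: square_measure_def)

lemma space_square_measure[simp]: "space square_measure = UNIV"
  by (simp add: square_measure_def)

lemma space_unit_interval[simp]: "space unit_interval = UNIV"
  by (simp add: unit_interval_def)

lemma prob_space_square_measure: "prob_space square_measure"
  by (rule prob_spaceI) (simp add: square_measure_def emeasure_density emeasure_unit_square)

interpretation square: prob_space square_measure by (rule prob_space_square_measure)
interpretation interval: prob_space unit_interval by (rule prob_space_unit_interval)
interpretation square_interval: pair_prob_space square_measure unit_interval ..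
interpretation interval_pair: pair_prob_space unit_interval unit_interval ..
interpretation lborel_interval_pair: pair_sigma_finite lborel "unit_interval \<Otimes>\<^sub>M unit_interval" ..

lemma sets_pair_borel:
  "sets M = sets (borel :: 'a::second_countable_topology measure) \<Longrightarrow> sets N = sets (borel :: 'b::second_countable_topology measure)
    \<Longrightarrow> sets (M \<Otimes>\<^sub>M N) = sets borel"
  unfolding borel_prod[symmetric] by (rule sets_pair_measure_cong)

lemma smooth_weight_measurable[measurable]:
  "smooth_weight \<tau> m l \<in> borel_measurable ((borel \<Otimes>\<^sub>M borel) \<Otimes>\<^sub>M borel)"
proof -
  have "(\<lambda>x. cell_kernel l (fst (fst x) + \<tau> *\<^sub>R circle_arc (snd (fst x))) (snd x)) \<in>
      borel_measurable (((borel :: (real \<times> real) measure) \<Otimes>\<^sub>M borel) \<Otimes>\<^sub>M borel)"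
    unfolding cell_kernel_def by measurable
  moreover have "Measurable.pred (((borel :: (real \<times> real) measure) \<Otimes>\<^sub>M borel) \<Otimes>\<^sub>M (borel :: (real \<times> real) measure))
      (\<lambda>x. cell m (fst (fst x)) = cell m (fst (fst x) + \<tau> *\<^sub>R circle_arc (snd (fst x))))"
    by measurable
  ultimately show ?thesis
    unfolding smooth_weight_def case_prod_beta by (intro measurable_If) auto
qed

lemma smooth_weight_nonneg[simp]: "0 \<le> smooth_weight \<tau> m l x"
  by (auto simp: smooth_weight_def split: prod.split)

lemma nn_integral_cell_coupling:
  assumes [measurable]: "\<phi> \<in> borel_measurable borel"
  shows "(\<integral>\<^sup>+z. \<phi> z \<partial>cell_coupling m) =
    (\<integral>\<^sup>+p. (\<integral>\<^sup>+q. ennreal (cell_kernel m p q) * \<phi> (p, q) \<partial>lborel) \<partial>square_measure)"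
proof -
  have \<phi>: "\<phi> \<in> borel_measurable (borel \<Otimes>\<^sub>M borel)" using assms by (simp add: borel_prod)
  then have "(\<integral>\<^sup>+z. \<phi> z \<partial>cell_coupling m) =
      (\<integral>\<^sup>+z. (\<lambda>(p, q). ennreal (cell_kernel m p q)) z * \<phi> z \<partial>(square_measure \<Otimes>\<^sub>M lborel))"
    unfolding cell_coupling_def by (subst nn_integral_density) auto
  also have "\<dots> = (\<integral>\<^sup>+p. (\<integral>\<^sup>+q. ennreal (cell_kernel m p q) * \<phi> (p, q) \<partial>lborel) \<partial>square_measure)"
    using \<phi> by (subst lborel.nn_integral_fst[symmetric]) auto
  finally show ?thesis .
qed

lemma nn_integral_smooth_coupling:
  assumes [measurable]: "\<phi> \<in> borel_measurable borel"
  shows "(\<integral>\<^sup>+z. \<phi> z \<partial>smooth_coupling \<tau> m l) =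
    (\<integral>\<^sup>+x. (\<integral>\<^sup>+q. ennreal (smooth_weight \<tau> m l (x, q)) * \<phi> (fst x, q) \<partial>lborel) \<partial>(square_measure \<Otimes>\<^sub>M unit_interval))"
proof -
  have \<phi>[measurable]: "\<phi> \<in> borel_measurable (borel \<Otimes>\<^sub>M borel)" using assms by (simp add: borel_prod)
  let ?X = "(square_measure \<Otimes>\<^sub>M unit_interval) \<Otimes>\<^sub>M lborel"
  have [measurable]: "(\<lambda>x. (fst (fst x), snd x)) \<in> ?X \<rightarrow>\<^sub>M borel \<Otimes>\<^sub>M borel" by measurable
  then have pr: "(\<lambda>x. (fst (fst x), snd x)) \<in> density ?X (\<lambda>x. ennreal (smooth_weight \<tau> m l x)) \<rightarrow>\<^sub>M borel"
    by (simp add: borel_prod)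
  have "(\<integral>\<^sup>+z. \<phi> z \<partial>smooth_coupling \<tau> m l) = (\<integral>\<^sup>+x. \<phi> (fst (fst x), snd x) \<partial>density ?X (\<lambda>x. ennreal (smooth_weight \<tau> m l x)))"
    unfolding smooth_coupling_def by (subst nn_integral_distr[OF pr]) auto
  also have "\<dots> = (\<integral>\<^sup>+x. ennreal (smooth_weight \<tau> m l x) * \<phi> (fst (fst x), snd x) \<partial>?X)"
    by (subst nn_integral_density) auto
  also have "\<dots> = (\<integral>\<^sup>+x. (\<integral>\<^sup>+q. ennreal (smooth_weight \<tau> m l (x, q)) * \<phi> (fst x, q) \<partial>lborel) \<partial>(square_measure \<Otimes>\<^sub>M unit_interval))"
    by (subst lborel.nn_integral_fst[symmetric]) auto
  finally show ?thesis .
qed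

text \<open>Where the weight is nonzero, \<open>p\<close> shares its cell of level \<open>m\<close>
  with the endpoint, and the endpoint shares a finer cell with \<open>q\<close>; so \<open>p\<close>
  and \<open>q\<close> share a cell of level \<open>m\<close>. The constant is the ratio of the cell
  areas.\<close>

lemma smooth_weight_le:
  assumes "m \<le> l"
  shows "smooth_weight \<tau> m l ((p, v), q) \<le> 4 ^ (l - m) * cell_kernel m p q"
proof (cases "smooth_weight \<tau> m l ((p, v), q) = 0")
  case False
  then have "cell m p = cell m (p + \<tau> *\<^sub>R circle_arc v)" "cell l (p + \<tau> *\<^sub>R circle_arc v) = cell l q"
    by (auto simp: smooth_weight_def cell_kernel_def split: if_splits)
  then have "cell m p = cell m q" using cell_coarsen[OF _ assms] by metis
  then show ?thesis using assms by (simp add: smooth_weight_def cell_kernel_def flip: power_add)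
qed simp

lemma nn_integral_square_interval_fst:
  assumes [measurable]: "f \<in> borel_measurable borel"
  shows "(\<integral>\<^sup>+x. f (fst x) \<partial>(square_measure \<Otimes>\<^sub>M unit_interval)) = (\<integral>\<^sup>+p. f p \<partial>square_measure)"
  by (subst interval.nn_integral_fst[symmetric]) (auto simp: interval.emeasure_space_1[simplified])

text \<open>The pointwise density bound is free of the arc parameter, which therefore integrates to
  1.\<close>

lemma nn_integral_smooth_coupling_le:
  assumes [measurable]: "\<phi> \<in> borel_measurable borel" and "m \<le> l"
  shows "(\<integral>\<^sup>+z. \<phi> z \<partial>smooth_coupling \<tau> m l) \<le> ennreal (4 ^ (l - m)) * (\<integral>\<^sup>+z. \<phi> z \<partial>cell_coupling m)"
proof -
  have \<phi>[measurable]: "\<phi> \<in> borel_measurable (borel \<Otimes>\<^sub>M borel)" using assms by (simp add: borel_prod)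
  have "(\<integral>\<^sup>+z. \<phi> z \<partial>smooth_coupling \<tau> m l) \<le>
    (\<integral>\<^sup>+x. (\<integral>\<^sup>+q. ennreal (4 ^ (l - m)) * (ennreal (cell_kernel m (fst x) q) * \<phi> (fst x, q)) \<partial>lborel) \<partial>(square_measure \<Otimes>\<^sub>M unit_interval))"
    unfolding nn_integral_smooth_coupling[OF assms(1)] mult.assoc[symmetric]
    using smooth_weight_le[OF assms(2)]
    by (intro nn_integral_mono mult_right_mono) (auto simp flip: ennreal_mult intro!: ennreal_leI)
  also have "\<dots> = (\<integral>\<^sup>+p. (\<integral>\<^sup>+q. ennreal (4 ^ (l - m)) * (ennreal (cell_kernel m p q) * \<phi> (p, q)) \<partial>lborel) \<partial>square_measure)"
    by (rule nn_integral_square_interval_fst) measurable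
  also have "\<dots> = ennreal (4 ^ (l - m)) * (\<integral>\<^sup>+z. \<phi> z \<partial>cell_coupling m)"
    by (simp add: nn_integral_cmult nn_integral_cell_coupling[OF assms(1)])
  finally show ?thesis .
qed

lemma sub_coupling_cell: "sub_coupling (cell_coupling m)"
proof -
  have sets: "sets (cell_coupling m) = sets borel"
    unfolding cell_coupling_def by (simp add: sets_pair_borel)
  have "emeasure (cell_coupling m) (space (cell_coupling m)) = (\<integral>\<^sup>+z. 1 \<partial>cell_coupling m)" by simp
  also have "\<dots> = 1"
    by (subst nn_integral_cell_coupling) (auto simp: nn_integral_cell_kernel square.emeasure_space_1[simplified])
  finally show ?thesis using sets by (simp add: sub_coupling_def)
qed

lemma circle_pair_measurable:
  "(\<lambda>(p, v). (p, p + \<tau> *\<^sub>R circle_arc v)) \<in> square_measure \<Otimes>\<^sub>M unit_interval \<rightarrow>\<^sub>M borel"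
proof -
  have "(\<lambda>(p, v). (p, p + \<tau> *\<^sub>R circle_arc v)) \<in> square_measure \<Otimes>\<^sub>M unit_interval \<rightarrow>\<^sub>M borel \<Otimes>\<^sub>M borel"
    by measurable
  then show ?thesis by (simp add: borel_prod)
qed

lemma prob_space_circle_coupling: "prob_space (circle_coupling \<tau>)"
  unfolding circle_coupling_def by (rule square_interval.prob_space_distr[OF circle_pair_measurable])

lemma sub_coupling_circle: "sub_coupling (circle_coupling \<tau>)"
proof -
  interpret D: prob_space "circle_coupling \<tau>" by (rule prob_space_circle_coupling)
  show ?thesis using D.emeasure_space_1 by (simp add: sub_coupling_def) (simp add: circle_coupling_def)
qed

lemma sub_coupling_smooth: "sub_coupling (smooth_coupling \<tau> m l)"
proof -
  have "emeasure (smooth_coupling \<tau> m l) (space (smooth_coupling \<tau> m l)) = (\<integral>\<^sup>+z. 1 \<partial>smooth_coupling \<tau> m l)" by simp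
  also have "\<dots> = (\<integral>\<^sup>+x. (\<integral>\<^sup>+q. ennreal (smooth_weight \<tau> m l (x, q)) \<partial>lborel) \<partial>(square_measure \<Otimes>\<^sub>M unit_interval))"
    by (subst nn_integral_smooth_coupling) auto
  \<comment> \<open>Restoring the discarded pairs only raises the mass, and the full kernel
    integrates to 1.\<close>
  also have "\<dots> \<le> (\<integral>\<^sup>+x. (\<integral>\<^sup>+q. ennreal (cell_kernel l (fst x + \<tau> *\<^sub>R circle_arc (snd x)) q) \<partial>lborel) \<partial>(square_measure \<Otimes>\<^sub>M unit_interval))"
    by (intro nn_integral_mono ennreal_leI) (auto simp: smooth_weight_def split: prod.split)
  also have "\<dots> = 1"
    using square_interval.emeasure_space_1 by (simp add: nn_integral_cell_kernel)
  finally show ?thesis by (simp add: sub_coupling_def) (simp add: smooth_coupling_def)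
qed

lemma smooth_coupling_dominated:
  fixes \<phi> :: "(real \<times> real) \<times> (real \<times> real) \<Rightarrow> real"
  assumes "\<phi> \<in> borel_measurable borel" "\<And>y. 0 \<le> \<phi> y \<and> \<phi> y \<le> 1" "m \<le> l"
  shows "(\<integral>y. \<phi> y \<partial>smooth_coupling \<tau> m l) \<le> 4 ^ (l - m) * (\<integral>y. \<phi> y \<partial>cell_coupling m)"
proof -
  have m: "\<phi> \<in> borel_measurable M" if "sub_coupling M" for M
    using assms(1) sub_couplingD(1)[OF that] by (simp cong: measurable_cong_sets)
  have int: "integrable M \<phi>" if "sub_coupling M" for M
    by (rule integrable_bounded_finite[OF sub_couplingD(2)[OF that] m[OF that], of 1]) (use assms(2) in auto)
  have "ennreal (\<integral>y. \<phi> y \<partial>smooth_coupling \<tau> m l) = (\<integral>\<^sup>+y. ennreal (\<phi> y) \<partial>smooth_coupling \<tau> m l)"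
    using assms(2) by (intro nn_integral_eq_integral[symmetric] int sub_coupling_smooth) auto
  also have "\<dots> \<le> ennreal (4 ^ (l - m)) * (\<integral>\<^sup>+y. ennreal (\<phi> y) \<partial>cell_coupling m)"
    using assms by (intro nn_integral_smooth_coupling_le) auto
  also have "\<dots> = ennreal (4 ^ (l - m)) * ennreal (\<integral>y. \<phi> y \<partial>cell_coupling m)"
    using assms(2) by (subst nn_integral_eq_integral[OF int[OF sub_coupling_cell]]) auto
  also have "\<dots> = ennreal (4 ^ (l - m) * (\<integral>y. \<phi> y \<partial>cell_coupling m))"
    by (simp add: ennreal_mult')
  finally show ?thesis
    using assms(2) by (subst (asm) ennreal_le_iff) (auto intro!: mult_nonneg_nonneg integral_nonneg_AE)
qed

section \<open>Quadratic forms of the couplings\<close>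

lemma integrable_cell_kernel_mult:
  assumes g: "test_fun unit_square g"
  shows "integrable lborel (\<lambda>q. cell_kernel m p q * g q)"
proof -
  have [measurable]: "g \<in> borel_measurable borel" using test_funD[OF g] by simp
  show ?thesis
    using test_funD[OF g]
    by (intro Bochner_Integration.integrable_bound[OF cell_kernel_integral(1)[of m p]])
       (auto simp: abs_mult intro!: mult_left_le)
qed

lemma nn_integral_cell_avg:
  assumes g: "test_fun unit_square g"
  shows "(\<integral>\<^sup>+q. ennreal (cell_kernel m p q * g q) \<partial>lborel) = ennreal (cell_avg m g p)"
  unfolding cell_avg_def
  using test_funD[OF g] by (intro nn_integral_eq_integral integrable_cell_kernel_mult[OF g]) auto

lemma test_fun_pair_measurable:
  assumes g: "test_fun X (g :: 'p::second_countable_topology \<Rightarrow> real)"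
  shows "(\<lambda>z. g (fst z) * g (snd z)) \<in> borel_measurable borel"
proof -
  have [measurable]: "g \<in> borel_measurable borel" using test_funD[OF g] by simp
  show ?thesis by measurable
qed

text \<open>Nonnegative integrals can be iterated without checking integrability.\<close>

lemma quad_form_nn_integral:
  assumes g: "test_fun X (g :: 'p::second_countable_topology \<Rightarrow> real)" and M: "sets M = sets borel"
  shows "quad_form M g = enn2real (\<integral>\<^sup>+z. ennreal (g (fst z) * g (snd z)) \<partial>M)"
  unfolding quad_form_def
proof (rule integral_eq_nn_integral)
  show "(\<lambda>z. g (fst z) * g (snd z)) \<in> borel_measurable M"
    using test_fun_pair_measurable[OF g] M by (simp cong: measurable_cong_sets)
qed (use test_funD[OF g] in auto)

lemma quad_form_cell:
  assumes g: "test_fun unit_square g"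
  shows "quad_form (cell_coupling m) g = (\<integral>p. g p * cell_avg m g p \<partial>square_measure)"
proof -
  note gD = test_funD[OF g] and aD = test_funD[OF test_fun_cell_avg[OF g]]
  have "(\<integral>\<^sup>+z. ennreal (g (fst z) * g (snd z)) \<partial>cell_coupling m) =
      (\<integral>\<^sup>+p. (\<integral>\<^sup>+q. ennreal (g p) * ennreal (cell_kernel m p q * g q) \<partial>lborel) \<partial>square_measure)"
    using gD test_fun_pair_measurable[OF g]
    by (subst nn_integral_cell_coupling) (auto simp flip: ennreal_mult simp: mult_ac)
  also have "\<dots> = (\<integral>\<^sup>+p. ennreal (g p * cell_avg m g p) \<partial>square_measure)"
    using gD aD integrable_cell_kernel_mult[OF g]
    by (subst nn_integral_cmult) (auto simp: nn_integral_cell_avg[OF g] simp flip: ennreal_mult)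
  finally show ?thesis
    using gD aD quad_form_nn_integral[OF g sub_couplingD(1)[OF sub_coupling_cell]]
    by (simp add: integral_eq_nn_integral)
qed

lemma integral_square_measure_indicator:
  fixes f :: "real \<times> real \<Rightarrow> real"
  assumes "f \<in> borel_measurable borel"
  shows "(\<integral>p. f p \<partial>square_measure) = (\<integral>p. indicator unit_square p *\<^sub>R f p \<partial>lborel)"
proof -
  have "square_measure = density lborel (\<lambda>p. ennreal (indicator unit_square p))"
    by (simp add: square_measure_def ennreal_indicator)
  then have "(\<integral>p. f p \<partial>square_measure) = (\<integral>p. f p \<partial>density lborel (\<lambda>p. ennreal (indicator unit_square p)))"
    by simp
  also have "\<dots> = (\<integral>p. indicator unit_square p *\<^sub>R f p \<partial>lborel)"
    using assms by (subst integral_density) auto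
  finally show ?thesis .
qed

lemma integral_square_measure:
  fixes f :: "real \<times> real \<Rightarrow> real"
  assumes "f \<in> borel_measurable borel" "\<And>p. p \<notin> unit_square \<Longrightarrow> f p = 0"
  shows "(\<integral>p. f p \<partial>square_measure) = (\<integral>p. f p \<partial>lborel)"
  unfolding integral_square_measure_indicator[OF assms(1)]
  using assms(2) by (intro Bochner_Integration.integral_cong) (auto split: split_indicator)

lemma quad_form_cell_lborel:
  assumes g: "test_fun unit_square g"
  shows "quad_form (cell_coupling m) g = (\<integral>p. g p * cell_avg m g p \<partial>lborel)"
  unfolding quad_form_cell[OF g]
  using test_funD[OF g] test_funD[OF test_fun_cell_avg[OF g]] by (intro integral_square_measure) auto

text \<open>The increment is the squared L2 distance between the two averages.\<close>

lemma quad_form_cell_mono: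
  assumes g: "test_fun unit_square g" and "l \<le> m"
  shows "quad_form (cell_coupling l) g \<le> quad_form (cell_coupling m) g"
proof -
  have "0 \<le> (\<integral>p. (cell_avg m g p - cell_avg l g p)\<^sup>2 \<partial>lborel)" by simp
  then show ?thesis
    unfolding integral_cell_avg_diff_square[OF assms] quad_form_cell_lborel[OF g] by simp
qed

lemma quad_form_circle:
  assumes g: "test_fun unit_square g"
  shows "quad_form (circle_coupling \<tau>) g =
    (\<integral>x. g (fst x) * g (fst x + \<tau> *\<^sub>R circle_arc (snd x)) \<partial>(square_measure \<Otimes>\<^sub>M unit_interval))"
  unfolding quad_form_def circle_coupling_def
  using test_fun_pair_measurable[OF g] circle_pair_measurable[of \<tau>]
  by (subst integral_distr) (auto simp: case_prod_beta)

lemma quad_form_smooth: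
  assumes g: "test_fun unit_square g"
  shows "quad_form (smooth_coupling \<tau> m l) g =
    (\<integral>x. (if cell m (fst x) = cell m (fst x + \<tau> *\<^sub>R circle_arc (snd x))
        then g (fst x) * cell_avg l g (fst x + \<tau> *\<^sub>R circle_arc (snd x)) else 0)
      \<partial>(square_measure \<Otimes>\<^sub>M unit_interval))"
proof -
  note gD = test_funD[OF g] and aD = test_funD[OF test_fun_cell_avg[OF g]]
  have [measurable]: "g \<in> borel_measurable borel" "cell_avg l g \<in> borel_measurable borel"
    using gD aD by auto
  let ?S = "\<lambda>x. cell m (fst x) = cell m (fst x + \<tau> *\<^sub>R circle_arc (snd x))"
  have inner: "(\<integral>\<^sup>+q. ennreal (smooth_weight \<tau> m l (x, q)) * ennreal (g (fst x) * g q) \<partial>lborel) =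
      ennreal (if ?S x then g (fst x) * cell_avg l g (fst x + \<tau> *\<^sub>R circle_arc (snd x)) else 0)" for x
  proof (cases "?S x")
    case True
    have "(\<integral>\<^sup>+q. ennreal (smooth_weight \<tau> m l (x, q)) * ennreal (g (fst x) * g q) \<partial>lborel) =
      (\<integral>\<^sup>+q. ennreal (g (fst x)) * ennreal (cell_kernel l (fst x + \<tau> *\<^sub>R circle_arc (snd x)) q * g q) \<partial>lborel)"
      using True gD by (intro nn_integral_cong) (cases x, auto simp: smooth_weight_def mult_ac simp flip: ennreal_mult)
    also have "\<dots> = ennreal (g (fst x) * cell_avg l g (fst x + \<tau> *\<^sub>R circle_arc (snd x)))"
      using gD aD integrable_cell_kernel_mult[OF g]
      by (subst nn_integral_cmult) (auto simp: nn_integral_cell_avg[OF g] simp flip: ennreal_mult)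
    finally show ?thesis using True by simp
  qed (cases x, simp add: smooth_weight_def)
  have "(\<integral>\<^sup>+z. ennreal (g (fst z) * g (snd z)) \<partial>smooth_coupling \<tau> m l) =
      (\<integral>\<^sup>+x. ennreal (if ?S x then g (fst x) * cell_avg l g (fst x + \<tau> *\<^sub>R circle_arc (snd x)) else 0)
        \<partial>(square_measure \<Otimes>\<^sub>M unit_interval))"
    using test_fun_pair_measurable[OF g]
    by (subst nn_integral_smooth_coupling) (auto simp: inner)
  then show ?thesis
    using gD aD quad_form_nn_integral[OF g sub_couplingD(1)[OF sub_coupling_smooth]]
    by (simp add: integral_eq_nn_integral)
qed

section \<open>Affine changes of variables and the oscillation of a test function\<close>

lemma lborel_integral_affine:
  fixes f :: "'a::euclidean_space \<Rightarrow> real"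
  assumes [measurable]: "f \<in> borel_measurable borel" and c: "c \<noteq> 0"
  shows "(\<integral>z. f z \<partial>lborel) = \<bar>c\<bar> ^ DIM('a) * (\<integral>z. f (t + c *\<^sub>R z) \<partial>lborel)"
    and "integrable lborel f \<Longrightarrow> integrable lborel (\<lambda>z. f (t + c *\<^sub>R z))"
proof -
  show "(\<integral>z. f z \<partial>lborel) = \<bar>c\<bar> ^ DIM('a) * (\<integral>z. f (t + c *\<^sub>R z) \<partial>lborel)"
    by (subst lborel_affine[OF c, of t]) (simp add: integral_density integral_distr)
  show "integrable lborel (\<lambda>z. f (t + c *\<^sub>R z))" if "integrable lborel f"
    using that c
    by (subst (asm) lborel_affine[OF c, of t]) (simp add: integrable_density integrable_distr_eq)
qed

lemma lborel_integral_translate: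
  fixes f :: "'a::euclidean_space \<Rightarrow> real"
  assumes "f \<in> borel_measurable borel"
  shows "(\<integral>z. f (z + t) \<partial>lborel) = (\<integral>z. f z \<partial>lborel)"
  using lborel_integral_affine(1)[OF assms, of 1 t] by (simp add: add.commute)

text \<open>Subtracting the cell average leaves mean zero on each cell of level \<open>l\<close>.
  Rescaling by \<open>\<tau>\<close> turns displacements of length \<open>\<tau>\<close> into the
  fixed arc and divides the cell diameters by \<open>\<tau>\<close>.\<close>

lemma balanced_oscillation:
  assumes g: "test_fun unit_square g" and \<tau>: "0 < \<tau>"
  shows "balanced_on_cells (2 / (2 ^ l * \<tau>)) (\<lambda>z. g (p + \<tau> *\<^sub>R z) - cell_avg l g (p + \<tau> *\<^sub>R z))"
proof -
  note gD = test_funD[OF g] and aD = test_funD[OF test_fun_cell_avg[OF g, of l]]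
  have [measurable]: "g \<in> borel_measurable borel" "cell_avg l g \<in> borel_measurable borel"
    using gD aD by auto
  define h where "h q = g q - cell_avg l g q" for q
  have hm[measurable]: "h \<in> borel_measurable borel" unfolding h_def by measurable
  have h1: "\<bar>h q\<bar> \<le> 1" for q using gD(2,3)[of q] aD(2,3)[of q] by (simp add: h_def)
  have "integrable lborel g" "integrable lborel (cell_avg l g)"
    using gD aD by (auto intro!: integrable_unit_square[where B=1])
  then have hint: "integrable lborel h" by (simp add: h_def[abs_def])
  define c where "c z = cell l (p + \<tau> *\<^sub>R z)" for z
  have cm: "c \<in> borel \<rightarrow>\<^sub>M count_space UNIV" unfolding c_def by measurable
  have cd: "dist z z' \<le> 2 / (2 ^ l * \<tau>)" if "c z = c z'" for z z'
  proof -
    have "dist (p + \<tau> *\<^sub>R z) (p + \<tau> *\<^sub>R z') \<le> 2 / 2 ^ l"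
      using that by (intro dist_cell) (simp add: c_def)
    moreover have "dist (p + \<tau> *\<^sub>R z) (p + \<tau> *\<^sub>R z') = \<tau> * dist z z'"
      using \<tau> by (simp add: dist_norm flip: scaleR_diff_right)
    ultimately show ?thesis using \<tau> by (simp add: field_simps)
  qed
  have bal: "(\<integral>z. h (p + \<tau> *\<^sub>R z) * indicator (c -` J) z \<partial>lborel) = 0" for J
  proof -
    have [measurable]: "cell l -` J \<in> sets borel"
      using measurable_sets[OF cell_measurable, of J l] by simp
    have "(\<integral>q. cell_avg l g q * indicator (cell l -` J) q \<partial>lborel) = (\<integral>q. g q * indicator (cell l -` J) q \<partial>lborel)"
      by (intro integral_cell_avg_mult g) (auto split: split_indicator)
    moreover have "integrable lborel (\<lambda>q. f q * indicator (cell l -` J) q)" if "test_fun unit_square f" for f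
    proof -
      have [measurable]: "f \<in> borel_measurable borel" using test_funD[OF that] by simp
      show ?thesis using test_funD[OF that]
        by (intro integrable_unit_square[where B=1]) (auto split: split_indicator)
    qed
    ultimately have "(\<integral>q. h q * indicator (cell l -` J) q \<partial>lborel) = 0"
      using g test_fun_cell_avg[OF g, of l] by (simp add: h_def left_diff_distrib)
    moreover have "(\<integral>q. h q * indicator (cell l -` J) q \<partial>lborel) =
        \<bar>\<tau>\<bar> ^ DIM(real \<times> real) * (\<integral>z. h (p + \<tau> *\<^sub>R z) * indicator (cell l -` J) (p + \<tau> *\<^sub>R z) \<partial>lborel)"
      using \<tau> by (intro lborel_integral_affine) auto
    moreover have "indicator (cell l -` J) (p + \<tau> *\<^sub>R z) = (indicator (c -` J) z :: real)" for z
      by (auto simp: c_def split: split_indicator)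
    ultimately show ?thesis using \<tau> by simp
  qed
  have "balanced_on_cells (2 / (2 ^ l * \<tau>)) (\<lambda>z. h (p + \<tau> *\<^sub>R z))"
    unfolding balanced_on_cells_def
    using lborel_integral_affine(2)[OF hm _ hint, of \<tau> p] \<tau> h1 cm cd bal by auto
  then show ?thesis by (simp add: h_def)
qed

section \<open>Comparison of the couplings\<close>

text \<open>A substitute for Cauchy-Schwarz that turns L2 bounds into L1 bounds with a free
  parameter.\<close>

lemma abs_le_square_tradeoff:
  fixes x e :: real
  assumes "0 < e"
  shows "\<bar>x\<bar> \<le> e + x\<^sup>2 / e"
proof -
  have "0 \<le> (\<bar>x\<bar> - e / 2)\<^sup>2" by simp
  then have "\<bar>x\<bar> * e \<le> x\<^sup>2 + e\<^sup>2 / 4" by (simp add: power2_eq_square algebra_simps)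
  also have "\<dots> \<le> x\<^sup>2 + e\<^sup>2" by simp
  finally show ?thesis using assms by (simp add: field_simps power2_eq_square)
qed

lemma integral_square_measure_le:
  fixes f :: "real \<times> real \<Rightarrow> real"
  assumes "integrable lborel f" "\<And>p. 0 \<le> f p"
  shows "(\<integral>p. f p \<partial>square_measure) \<le> (\<integral>p. f p \<partial>lborel)"
proof -
  have "(\<integral>p. f p \<partial>square_measure) = (\<integral>p. indicator unit_square p *\<^sub>R f p \<partial>lborel)"
    using assms by (intro integral_square_measure_indicator) auto
  also have "\<dots> \<le> (\<integral>p. f p \<partial>lborel)"
    using assms integrable_mult_indicator[of unit_square lborel f]
    by (intro integral_mono) (auto split: split_indicator)
  finally show ?thesis .
qed

text \<open>Both coordinates of the arc lie in [0, 1], so a translate can enter the square only from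
  a bounded box. This supplies the support needed for Fubini.\<close>

lemma shift_support:
  assumes "0 < \<tau>" "p \<notin> cbox (- \<tau>, - \<tau>) (1, 1)"
  shows "p + \<tau> *\<^sub>R circle_arc v \<notin> unit_square"
proof
  assume *: "p + \<tau> *\<^sub>R circle_arc v \<in> unit_square"
  have "0 \<le> \<tau> * fst (circle_arc v)" "\<tau> * fst (circle_arc v) \<le> \<tau> * 1" "0 \<le> \<tau> * snd (circle_arc v)" "\<tau> * snd (circle_arc v) \<le> \<tau> * 1"
    using circle_arc_bounds[of v] assms(1) by (auto intro!: mult_nonneg_nonneg mult_left_le)
  with * have "p \<in> cbox (- \<tau>, - \<tau>) (1, 1)"
    by (cases p, cases "circle_arc v") (auto simp: unit_square_def cbox_Pair_iff)
  with assms(2) show False by simp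
qed

text \<open>
  Expanding the square and translating by one of the two vectors leaves only the law of the difference
  of two points of the arc, to which the oscillating function \<open>h\<close> is nearly orthogonal.
\<close>

lemma integral_shift_average_square_le:
  fixes h :: "real \<times> real \<Rightarrow> real"
  assumes \<tau>: "0 < \<tau>" and h[measurable]: "h \<in> borel_measurable borel" and h1: "\<And>p. \<bar>h p\<bar> \<le> 1"
    and supp: "\<And>p. p \<notin> unit_square \<Longrightarrow> h p = 0"
    and small: "\<And>p. \<bar>\<integral>x. h (p + \<tau> *\<^sub>R (circle_arc (snd x) - circle_arc (fst x))) \<partial>(unit_interval \<Otimes>\<^sub>M unit_interval)\<bar> \<le> e"
  shows "(\<integral>p. (\<integral>v. h (p + \<tau> *\<^sub>R circle_arc v) \<partial>unit_interval)\<^sup>2 \<partial>lborel) \<le> e"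
    and "integrable lborel (\<lambda>p. (\<integral>v. h (p + \<tau> *\<^sub>R circle_arc v) \<partial>unit_interval)\<^sup>2)"
proof -
  let ?II = "unit_interval \<Otimes>\<^sub>M unit_interval"
  let ?\<gamma> = "\<lambda>v. \<tau> *\<^sub>R circle_arc v"
  have sq: "(\<integral>v. h (p + ?\<gamma> v) \<partial>unit_interval)\<^sup>2 = (\<integral>x. h (p + ?\<gamma> (fst x)) * h (p + ?\<gamma> (snd x)) \<partial>?II)" for p
  proof -
    have "integrable ?II (\<lambda>x. h (p + ?\<gamma> (fst x)) * h (p + ?\<gamma> (snd x)))"
      by (rule integrable_bounded_finite[where B=1])
         (auto intro!: interval_pair.finite_measure_axioms mult_le_one h1 simp: abs_mult)
    from interval_pair.integral_fst'[OF this] show ?thesis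
      by (simp add: power2_eq_square)
  qed
  have int1: "integrable (lborel \<Otimes>\<^sub>M ?II) (\<lambda>(p, x). h (p + ?\<gamma> (fst x)) * h (p + ?\<gamma> (snd x)))"
  proof (rule integrable_bounded_support[where B=1 and a="(- \<tau>, - \<tau>)" and b="(1, 1)"])
    fix p :: "real \<times> real" and x :: "real \<times> real" assume "p \<notin> cbox (- \<tau>, - \<tau>) (1, 1)"
    from shift_support[OF \<tau> this]
    show "(case (p, x) of (p, x) \<Rightarrow> h (p + ?\<gamma> (fst x)) * h (p + ?\<gamma> (snd x))) = 0" using supp by simp
  qed (auto intro!: interval_pair.finite_measure_axioms mult_le_one h1 simp: abs_mult)
  have int2: "integrable (lborel \<Otimes>\<^sub>M ?II) (\<lambda>(p, x). h p * h (p + (?\<gamma> (snd x) - ?\<gamma> (fst x))))"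
  proof (rule integrable_bounded_support[where B=1 and a="(0, 0)" and b="(1, 1)"])
    fix p :: "real \<times> real" and x :: "real \<times> real" assume "p \<notin> cbox (0, 0) (1, 1)"
    then have "p \<notin> unit_square" by (cases p) (auto simp: unit_square_def cbox_Pair_iff)
    then show "(case (p, x) of (p, x) \<Rightarrow> h p * h (p + (?\<gamma> (snd x) - ?\<gamma> (fst x)))) = 0" using supp by simp
  qed (auto intro!: interval_pair.finite_measure_axioms mult_le_one h1 simp: abs_mult)
  show "integrable lborel (\<lambda>p. (\<integral>v. h (p + ?\<gamma> v) \<partial>unit_interval)\<^sup>2)"
    unfolding sq by (rule lborel_interval_pair.integrable_fst[OF int1])
  have hint: "integrable lborel (\<lambda>p. \<bar>h p\<bar>)"
    using h1 supp by (intro integrable_unit_square[where B=1]) auto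
  have e: "0 \<le> e" using small[of 0] by (rule order_trans[OF abs_ge_zero])
  have "(\<integral>p. (\<integral>v. h (p + ?\<gamma> v) \<partial>unit_interval)\<^sup>2 \<partial>lborel) =
      (\<integral>x. (\<integral>p. h (p + ?\<gamma> (fst x)) * h (p + ?\<gamma> (snd x)) \<partial>lborel) \<partial>?II)"
    unfolding sq by (rule lborel_interval_pair.Fubini_integral[OF int1, symmetric])
  also have "\<dots> = (\<integral>x. (\<integral>p. h p * h (p + (?\<gamma> (snd x) - ?\<gamma> (fst x))) \<partial>lborel) \<partial>?II)"
  proof (rule Bochner_Integration.integral_cong[OF refl])
    fix x
    have "(\<lambda>p. h p * h (p + (?\<gamma> (snd x) - ?\<gamma> (fst x)))) \<in> borel_measurable borel" by measurable
    from lborel_integral_translate[OF this, of "?\<gamma> (fst x)"]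
    show "(\<integral>p. h (p + ?\<gamma> (fst x)) * h (p + ?\<gamma> (snd x)) \<partial>lborel) = (\<integral>p. h p * h (p + (?\<gamma> (snd x) - ?\<gamma> (fst x))) \<partial>lborel)"
      by (simp add: algebra_simps)
  qed
  also have "\<dots> = (\<integral>p. (\<integral>x. h p * h (p + (?\<gamma> (snd x) - ?\<gamma> (fst x))) \<partial>?II) \<partial>lborel)"
    by (rule lborel_interval_pair.Fubini_integral[OF int2])
  also have "\<dots> \<le> (\<integral>p. e * \<bar>h p\<bar> \<partial>lborel)"
  proof (rule integral_mono)
    show "integrable lborel (\<lambda>p. \<integral>x. h p * h (p + (?\<gamma> (snd x) - ?\<gamma> (fst x))) \<partial>?II)"
      by (rule lborel_interval_pair.integrable_fst[OF int2])
    fix p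
    have "(\<integral>x. h p * h (p + (?\<gamma> (snd x) - ?\<gamma> (fst x))) \<partial>?II) \<le> \<bar>h p * (\<integral>x. h (p + \<tau> *\<^sub>R (circle_arc (snd x) - circle_arc (fst x))) \<partial>?II)\<bar>"
      by (simp add: scaleR_diff_right)
    also have "\<dots> \<le> \<bar>h p\<bar> * e"
      unfolding abs_mult using small by (intro mult_left_mono) auto
    finally show "(\<integral>x. h p * h (p + (?\<gamma> (snd x) - ?\<gamma> (fst x))) \<partial>?II) \<le> e * \<bar>h p\<bar>" by (simp add: mult.commute)
  qed (use hint in auto)
  \<comment> \<open>As \<open>h\<close> is bounded by 1 and lives on a square of area 1, the factor
    multiplying \<open>e\<close> is at most 1.\<close>
  also have "\<dots> = e * (\<integral>p. \<bar>h p\<bar> \<partial>square_measure)"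
    using supp by (subst integral_square_measure) auto
  also have "\<dots> \<le> e * (\<integral>p. 1 \<partial>square_measure)"
    using e h1 by (intro mult_left_mono integral_mono integrable_bounded_finite[where B=1] square.finite_measure_axioms) auto
  also have "\<dots> = e" using square.prob_space by simp
  finally show "(\<integral>p. (\<integral>v. h (p + ?\<gamma> v) \<partial>unit_interval)\<^sup>2 \<partial>lborel) \<le> e" .
qed

text \<open>Up to discarded pairs, the two forms differ by the pairing of \<open>g\<close> with the
  arc average of its oscillation, which is small in L2 by
  \<open>integral_shift_average_square_le\<close>. The threshold \<open>s\<close> is uniform in the
  radius, the levels and \<open>g\<close>.\<close>

lemma quad_form_smooth_le_circle:
  assumes e: "0 < e"
  shows "\<exists>s>0. \<forall>\<tau> m l g. 0 < \<tau> \<longrightarrow> 2 / (2 ^ l * \<tau>) \<le> s \<longrightarrow> test_fun unit_square g \<longrightarrow>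
    quad_form (smooth_coupling \<tau> m l) g \<le> quad_form (circle_coupling \<tau>) g + e"
proof -
  let ?II = "unit_interval \<Otimes>\<^sub>M unit_interval"
  let ?PV = "square_measure \<Otimes>\<^sub>M unit_interval"
  \<comment> \<open>The bound \<open>e\<^sup>2 / 4\<close> matches the parameter
    \<open>e / 2\<close> in \<open>abs_le_square_tradeoff\<close>: both terms become
    \<open>e / 2\<close>.\<close>
  obtain s where s: "s > 0" "\<And>h. balanced_on_cells s h \<Longrightarrow>
      \<bar>\<integral>x. h (circle_arc (snd x) - circle_arc (fst x)) \<partial>?II\<bar> \<le> e\<^sup>2 / 4"
    using balanced_arc_difference_small[of "e\<^sup>2 / 4"] e by auto
  have "quad_form (smooth_coupling \<tau> m l) g \<le> quad_form (circle_coupling \<tau>) g + e"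
    if \<tau>: "0 < \<tau>" and sl: "2 / (2 ^ l * \<tau>) \<le> s" and g: "test_fun unit_square g" for \<tau> m l g
  proof -
    note gD = test_funD[OF g] and aD = test_funD[OF test_fun_cell_avg[OF g, of l]]
    have [measurable]: "g \<in> borel_measurable borel" "cell_avg l g \<in> borel_measurable borel"
      using gD aD by auto
    define h where "h q = g q - cell_avg l g q" for q
    have hm[measurable]: "h \<in> borel_measurable borel" unfolding h_def by measurable
    have h1: "\<bar>h q\<bar> \<le> 1" for q using gD(2,3)[of q] aD(2,3)[of q] by (simp add: h_def)
    have supp: "h q = 0" if "q \<notin> unit_square" for q using gD(4) aD(4) that by (simp add: h_def)
    have small: "\<bar>\<integral>x. h (p + \<tau> *\<^sub>R (circle_arc (snd x) - circle_arc (fst x))) \<partial>?II\<bar> \<le> e\<^sup>2 / 4" for p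
      using s(2)[OF balanced_on_cells_mono[OF balanced_oscillation[OF g \<tau>, of l p] sl]] by (simp add: h_def)
    define k where "k p = (\<integral>v. h (p + \<tau> *\<^sub>R circle_arc v) \<partial>unit_interval)" for p
    note k2 = integral_shift_average_square_le[OF \<tau> hm h1 supp small, folded k_def]
    have km[measurable]: "k \<in> borel_measurable borel" unfolding k_def by measurable
    have k1: "\<bar>k p\<bar> \<le> 1" for p
    proof -
      have "norm (k p) \<le> (\<integral>v. 1 \<partial>unit_interval)"
        unfolding k_def using h1 by (intro Bochner_Integration.integral_norm_bound_integral integrable_bounded_finite[where B=1] interval.finite_measure_axioms) auto
      then show ?thesis using interval.prob_space by simp
    qed
    have intk: "integrable square_measure (\<lambda>p. \<bar>k p\<bar>)" "integrable square_measure (\<lambda>p. e / 2 + (k p)\<^sup>2 / (e / 2))"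
       "integrable square_measure (\<lambda>p. g p * k p)" "integrable square_measure (\<lambda>p. (k p)\<^sup>2)"
    proof -
      show i2: "integrable square_measure (\<lambda>p. (k p)\<^sup>2)"
        using k1 by (intro integrable_bounded_finite[where B=1] square.finite_measure_axioms) (auto simp: abs_square_le_1)
      show "integrable square_measure (\<lambda>p. \<bar>k p\<bar>)"
        using k1 by (intro integrable_bounded_finite[where B=1] square.finite_measure_axioms) auto
      show "integrable square_measure (\<lambda>p. g p * k p)"
        using k1 gD by (intro integrable_bounded_finite[where B=1] square.finite_measure_axioms) (auto simp: abs_mult intro!: mult_le_one)
      show "integrable square_measure (\<lambda>p. e / 2 + (k p)\<^sup>2 / (e / 2))" using i2 by simp
    qed
    have intb: "integrable ?PV F" if "F \<in> borel_measurable ?PV" "\<And>x. \<bar>F x\<bar> \<le> 1" for F :: "_ \<Rightarrow> real"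
      using that by (intro integrable_bounded_finite[where B=1] square_interval.finite_measure_axioms) auto
    let ?q = "\<lambda>x. fst x + \<tau> *\<^sub>R circle_arc (snd x)"
    have i1: "integrable ?PV (\<lambda>x. g (fst x) * g (?q x))" "integrable ?PV (\<lambda>x. g (fst x) * cell_avg l g (?q x))"
      "integrable ?PV (\<lambda>x. g (fst x) * h (?q x))"
      by (auto intro!: intb mult_le_one gD(5) aD(5) h1 simp: abs_mult)
    \<comment> \<open>Dropping the condition on cells only adds nonnegative contributions.\<close>
    have "quad_form (smooth_coupling \<tau> m l) g \<le> (\<integral>x. g (fst x) * cell_avg l g (?q x) \<partial>?PV)"
      unfolding quad_form_smooth[OF g]
      by (intro integral_mono i1 intb)
         (auto intro!: mult_le_one mult_nonneg_nonneg gD(2,3,5) aD(2,3,5) simp: abs_mult)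
    also have "\<dots> = quad_form (circle_coupling \<tau>) g + - (\<integral>x. g (fst x) * h (?q x) \<partial>?PV)"
      unfolding quad_form_circle[OF g] using i1 by (simp add: h_def right_diff_distrib flip: Bochner_Integration.integral_diff)
    also have "(\<integral>x. g (fst x) * h (?q x) \<partial>?PV) = (\<integral>p. g p * k p \<partial>square_measure)"
      using square_interval.integral_fst'[OF i1(3)] by (simp add: k_def)
    also have "- (\<integral>p. g p * k p \<partial>square_measure) \<le> (\<integral>p. \<bar>k p\<bar> \<partial>square_measure)"
    proof -
      have "- (g p * k p) \<le> \<bar>k p\<bar>" for p
      proof -
        have "- (g p * k p) \<le> g p * \<bar>k p\<bar>"
          using gD(2)[of p] by (metis abs_ge_minus_self abs_mult abs_of_nonneg)
        also have "\<dots> \<le> 1 * \<bar>k p\<bar>" using gD by (intro mult_right_mono) auto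
        finally show ?thesis by simp
      qed
      then have "(\<integral>p. - (g p * k p) \<partial>square_measure) \<le> (\<integral>p. \<bar>k p\<bar> \<partial>square_measure)"
        using intk by (intro integral_mono) auto
      then show ?thesis by simp
    qed
    also have "(\<integral>p. \<bar>k p\<bar> \<partial>square_measure) \<le> (\<integral>p. e / 2 + (k p)\<^sup>2 / (e / 2) \<partial>square_measure)"
      using e by (intro integral_mono intk abs_le_square_tradeoff) auto
    also have "\<dots> = e / 2 + (\<integral>p. (k p)\<^sup>2 \<partial>square_measure) / (e / 2)"
      using intk square.prob_space by simp
    also have "(\<integral>p. (k p)\<^sup>2 \<partial>square_measure) \<le> e\<^sup>2 / 4"
      using integral_square_measure_le[OF k2(2)] k2(1) by simp
    finally show ?thesis
      using e by (simp add: divide_right_mono power2_eq_square field_simps)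
  qed
  with s(1) show ?thesis by blast
qed

text \<open>A crossing forces \<open>x\<close> to lie within \<open>a\<close> to the left of one of
  the \<open>2 ^ m\<close> grid points in (0, 1].\<close>

lemma emeasure_floor_crossing:
  fixes a :: real
  assumes a: "0 \<le> a"
  shows "emeasure lborel {x \<in> {0..<1}. \<lfloor>2 ^ m * x\<rfloor> \<noteq> \<lfloor>2 ^ m * (x + a)\<rfloor>} \<le> ennreal (2 ^ m * a)"
proof -
  let ?I = "\<lambda>i. {(real i + 1) / 2 ^ m - a ..< (real i + 1) / 2 ^ m}"
  have "{x \<in> {0..<1}. \<lfloor>2 ^ m * x\<rfloor> \<noteq> \<lfloor>2 ^ m * (x + a)\<rfloor>} \<subseteq> (\<Union>i<2 ^ m. ?I i)"
  proof clarify
    fix x :: real assume x: "x \<in> {0..<1}" "\<lfloor>2 ^ m * x\<rfloor> \<noteq> \<lfloor>2 ^ m * (x + a)\<rfloor>"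
    define i where "i = nat \<lfloor>2 ^ m * x\<rfloor>"
    have i: "real i = of_int \<lfloor>2 ^ m * x\<rfloor>" using x by (simp add: i_def)
    have "2 ^ m * x < 2 ^ m * 1" using x by (intro mult_strict_left_mono) auto
    then have "real i < 2 ^ m" using i by linarith
    then have "i < 2 ^ m" by (metis of_nat_less_iff of_nat_numeral of_nat_power)
    have "\<lfloor>2 ^ m * x\<rfloor> \<le> \<lfloor>2 ^ m * (x + a)\<rfloor>" using a by (intro floor_mono mult_left_mono) auto
    then have "\<lfloor>2 ^ m * x\<rfloor> + 1 \<le> \<lfloor>2 ^ m * (x + a)\<rfloor>" using x by linarith
    then have "real i + 1 \<le> 2 ^ m * (x + a)" using i by linarith
    moreover have "2 ^ m * x < real i + 1" using i by linarith
    ultimately have "x \<in> ?I i" by (simp add: field_simps)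
    with \<open>i < 2 ^ m\<close> show "x \<in> (\<Union>i<2 ^ m. ?I i)" by blast
  qed
  then have "emeasure lborel {x \<in> {0..<1}. \<lfloor>2 ^ m * x\<rfloor> \<noteq> \<lfloor>2 ^ m * (x + a)\<rfloor>} \<le> emeasure lborel (\<Union>i<2 ^ m. ?I i)"
    by (intro emeasure_mono) auto
  also have "\<dots> \<le> (\<Sum>i<2 ^ m. emeasure lborel (?I i))"
    by (intro emeasure_subadditive_finite) auto
  also have "\<dots> = (\<Sum>i<(2::nat) ^ m. ennreal a)"
    using a by (intro sum.cong refl) (subst emeasure_lborel_Ico, auto)
  also have "\<dots> = ennreal (2 ^ m * a)"
    using a by (simp add: ennreal_mult'' ennreal_power[symmetric] ennreal_numeral)
  finally show ?thesis .
qed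

lemma nn_integral_square_interval:
  assumes [measurable]: "f \<in> borel_measurable (borel \<Otimes>\<^sub>M borel)"
  shows "(\<integral>\<^sup>+x. f x \<partial>(square_measure \<Otimes>\<^sub>M unit_interval)) =
    (\<integral>\<^sup>+v. (\<integral>\<^sup>+p. indicator unit_square p * f (p, v) \<partial>lborel) \<partial>unit_interval)"
proof -
  have "(\<integral>\<^sup>+x. f x \<partial>(square_measure \<Otimes>\<^sub>M unit_interval)) = (\<integral>\<^sup>+v. (\<integral>\<^sup>+p. f (p, v) \<partial>square_measure) \<partial>unit_interval)"
    using square_interval.nn_integral_snd[of "\<lambda>(p, v). f (p, v)"] by simp
  also have "\<dots> = (\<integral>\<^sup>+v. (\<integral>\<^sup>+p. indicator unit_square p * f (p, v) \<partial>lborel) \<partial>unit_interval)"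
    unfolding square_measure_def by (subst nn_integral_density) auto
  finally show ?thesis .
qed

text \<open>Separating the two points takes a grid crossing in one of the two coordinates, each
  shifted by at most \<open>\<tau>\<close>; hence the factor 2.\<close>

lemma emeasure_cell_crossing:
  assumes \<tau>: "0 < \<tau>"
  shows "emeasure (square_measure \<Otimes>\<^sub>M unit_interval)
    {x. cell m (fst x) \<noteq> cell m (fst x + \<tau> *\<^sub>R circle_arc (snd x))} \<le> ennreal (2 * (2 ^ m * \<tau>))"
proof -
  let ?C = "{x. cell m (fst x) \<noteq> cell m (fst x + \<tau> *\<^sub>R circle_arc (snd x))}"
  have "{x \<in> space (borel \<Otimes>\<^sub>M borel). cell m (fst x) \<noteq> cell m (fst x + \<tau> *\<^sub>R circle_arc (snd x))} \<in> sets (borel \<Otimes>\<^sub>M borel)"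
    by measurable
  then have C[measurable]: "?C \<in> sets (borel \<Otimes>\<^sub>M borel)" by (simp add: space_pair_measure)
  then have C': "?C \<in> sets (square_measure \<Otimes>\<^sub>M unit_interval)"
    by (simp cong: sets_pair_measure_cong)
  have slice: "(\<integral>\<^sup>+p. indicator unit_square p * indicator ?C (p, v) \<partial>lborel) \<le> ennreal (2 * (2 ^ m * \<tau>))" for v
  proof -
    define a where "a = \<tau> * fst (circle_arc v)"
    define b where "b = \<tau> * snd (circle_arc v)"
    have ab: "0 \<le> a" "a \<le> \<tau>" "0 \<le> b" "b \<le> \<tau>"
      using circle_arc_bounds[of v] \<tau> by (auto simp: a_def b_def mult_left_le)
    let ?X = "\<lambda>a. {x \<in> {0..<1::real}. \<lfloor>2 ^ m * x\<rfloor> \<noteq> \<lfloor>2 ^ m * (x + a)\<rfloor>}"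
    have X[measurable]: "?X a \<in> sets borel" for a by measurable
    have "(\<integral>\<^sup>+p. indicator unit_square p * indicator ?C (p, v) \<partial>lborel)
        \<le> (\<integral>\<^sup>+p. indicator (?X a \<times> {0..<1} \<union> {0..<1} \<times> ?X b) p \<partial>lborel)"
    proof (intro nn_integral_mono)
      fix p :: "real \<times> real"
      have "p \<in> ?X a \<times> {0..<1} \<union> {0..<1} \<times> ?X b" if "p \<in> unit_square" "(p, v) \<in> ?C"
        using that by (cases p) (auto simp: unit_square_def cell_def a_def b_def)
      then show "indicator unit_square p * indicator ?C (p, v) \<le> (indicator (?X a \<times> {0..<1} \<union> {0..<1} \<times> ?X b) p :: ennreal)"
        by (auto split: split_indicator)
    qed
    also have "\<dots> = emeasure lborel (?X a \<times> {0..<1} \<union> {0..<1} \<times> ?X b)"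
      by (intro nn_integral_indicator) (auto intro!: borel_Times sets.Un)
    also have "\<dots> \<le> emeasure lborel (?X a \<times> {0..<1::real}) + emeasure lborel ({0..<1::real} \<times> ?X b)"
      by (intro emeasure_subadditive) (auto intro!: borel_Times)
    also have "\<dots> = emeasure lborel (?X a) + emeasure lborel (?X b)"
      unfolding lborel_prod[symmetric] by (simp add: lborel.emeasure_pair_measure_Times)
    also have "\<dots> \<le> ennreal (2 ^ m * a) + ennreal (2 ^ m * b)"
      using ab by (intro add_mono emeasure_floor_crossing)
    also have "\<dots> \<le> ennreal (2 * (2 ^ m * \<tau>))"
    proof -
      have "2 ^ m * a \<le> 2 ^ m * \<tau>" "2 ^ m * b \<le> 2 ^ m * \<tau>" using ab by auto
      then have "2 ^ m * a + 2 ^ m * b \<le> 2 * (2 ^ m * \<tau>)" by linarith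
      then show ?thesis using ab by (simp flip: ennreal_plus add: ennreal_leI)
    qed
    finally show ?thesis .
  qed
  have "emeasure (square_measure \<Otimes>\<^sub>M unit_interval) ?C = (\<integral>\<^sup>+x. indicator ?C x \<partial>(square_measure \<Otimes>\<^sub>M unit_interval))"
    using C' by simp
  also have "\<dots> = (\<integral>\<^sup>+v. (\<integral>\<^sup>+p. indicator unit_square p * indicator ?C (p, v) \<partial>lborel) \<partial>unit_interval)"
    by (rule nn_integral_square_interval) measurable
  also have "\<dots> \<le> (\<integral>\<^sup>+v. ennreal (2 * (2 ^ m * \<tau>)) \<partial>unit_interval)"
    by (intro nn_integral_mono slice)
  also have "\<dots> = ennreal (2 * (2 ^ m * \<tau>))"
    using interval.emeasure_space_1 by simp
  finally show ?thesis .
qed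

text \<open>For each fixed \<open>v\<close>, drop the restriction to the square and use translation
  invariance.\<close>

lemma integral_shift_le:
  fixes f :: "real \<times> real \<Rightarrow> real"
  assumes f: "integrable lborel f" and f0: "\<And>p. 0 \<le> f p"
  shows "(\<integral>x. f (fst x + \<tau> *\<^sub>R circle_arc (snd x)) \<partial>(square_measure \<Otimes>\<^sub>M unit_interval)) \<le> (\<integral>p. f p \<partial>lborel)"
proof -
  have [measurable]: "f \<in> borel_measurable borel" using f by auto
  let ?PV = "square_measure \<Otimes>\<^sub>M unit_interval"
  have "(\<integral>\<^sup>+x. ennreal (f (fst x + \<tau> *\<^sub>R circle_arc (snd x))) \<partial>?PV) =
      (\<integral>\<^sup>+v. (\<integral>\<^sup>+p. indicator unit_square p * ennreal (f (p + \<tau> *\<^sub>R circle_arc v)) \<partial>lborel) \<partial>unit_interval)"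
    by (subst nn_integral_square_interval) auto
  also have "\<dots> \<le> (\<integral>\<^sup>+v. (\<integral>\<^sup>+p. ennreal (f p) \<partial>lborel) \<partial>unit_interval)"
  proof (rule nn_integral_mono)
    fix v
    have "(\<integral>\<^sup>+p. indicator unit_square p * ennreal (f (p + \<tau> *\<^sub>R circle_arc v)) \<partial>lborel) \<le> (\<integral>\<^sup>+p. ennreal (f (\<tau> *\<^sub>R circle_arc v + p)) \<partial>lborel)"
      by (intro nn_integral_mono) (auto split: split_indicator simp: add.commute)
    also have "\<dots> = (\<integral>\<^sup>+p. ennreal (f p) \<partial>distr lborel borel ((+) (\<tau> *\<^sub>R circle_arc v)))"
      by (subst nn_integral_distr) auto
    finally show "(\<integral>\<^sup>+p. indicator unit_square p * ennreal (f (p + \<tau> *\<^sub>R circle_arc v)) \<partial>lborel) \<le> (\<integral>\<^sup>+p. ennreal (f p) \<partial>lborel)"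
      by (simp add: lborel_distr_plus)
  qed
  also have "\<dots> = ennreal (\<integral>p. f p \<partial>lborel)"
    using f f0 interval.emeasure_space_1 by (simp add: nn_integral_eq_integral)
  finally have "enn2real (\<integral>\<^sup>+x. ennreal (f (fst x + \<tau> *\<^sub>R circle_arc (snd x))) \<partial>?PV) \<le> (\<integral>p. f p \<partial>lborel)"
    using f0 by (intro enn2real_leI) auto
  then show ?thesis
    using f0 by (subst integral_eq_nn_integral) auto
qed

text \<open>If \<open>p\<close> and its endpoint share a cell of level \<open>m\<close>, the coarse
  averages at both agree, and exchanging coarse for fine at the endpoint costs at most
  \<open>e + \<Delta> / e\<close>. The other pairs have measure at most \<open>e\<close>. The
  integral of \<open>\<Delta>\<close> over the plane is the increment of the quadratic form.\<close>

lemma quad_form_cell_le_smooth: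
  assumes g: "test_fun unit_square g" and \<tau>: "0 < \<tau>" and e: "0 < e" and ml: "m \<le> l" and small: "2 ^ m * \<tau> \<le> e / 2"
  shows "quad_form (cell_coupling m) g \<le> quad_form (smooth_coupling \<tau> m l) g + 2 * e
    + 1 / e * (quad_form (cell_coupling l) g - quad_form (cell_coupling m) g)"
proof -
  note gD = test_funD[OF g] and aD = test_funD[OF test_fun_cell_avg[OF g]]
  have [measurable]: "g \<in> borel_measurable borel" "cell_avg k g \<in> borel_measurable borel" for k
    using gD aD by auto
  let ?PV = "square_measure \<Otimes>\<^sub>M unit_interval"
  let ?q = "\<lambda>x. fst x + \<tau> *\<^sub>R circle_arc (snd x)"
  let ?S = "\<lambda>x. cell m (fst x) = cell m (?q x)"
  let ?C = "{x. cell m (fst x) \<noteq> cell m (?q x)}"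
  define \<Delta> where "\<Delta> p = (cell_avg l g p - cell_avg m g p)\<^sup>2" for p
  have [measurable]: "\<Delta> \<in> borel_measurable borel" unfolding \<Delta>_def by measurable
  have \<Delta>1: "0 \<le> \<Delta> p" "\<bar>\<Delta> p\<bar> \<le> 1" for p
    using aD(2,3)[of l p] aD(2,3)[of m p] by (auto simp: \<Delta>_def abs_square_le_1)
  have intb: "integrable ?PV F" if "F \<in> borel_measurable ?PV" "\<And>x. \<bar>F x\<bar> \<le> 1" for F :: "_ \<Rightarrow> real"
    using that by (intro integrable_bounded_finite[where B=1] square_interval.finite_measure_axioms) auto
  have "{x \<in> space (borel \<Otimes>\<^sub>M borel). cell m (fst x) \<noteq> cell m (?q x)} \<in> sets (borel \<Otimes>\<^sub>M borel)"
    by measurable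
  then have C[measurable]: "?C \<in> sets ?PV"
    by (simp add: space_pair_measure cong: sets_pair_measure_cong)
  have i: "integrable ?PV (\<lambda>x. g (fst x) * cell_avg m g (fst x))"
    "integrable ?PV (\<lambda>x. if ?S x then g (fst x) * cell_avg l g (?q x) else 0)"
    "integrable ?PV (indicator ?C :: _ \<Rightarrow> real)"
    "integrable ?PV (\<lambda>x. \<Delta> (?q x))"
    by (auto intro!: intb mult_le_one gD(2,3,5) aD(2,3,5) \<Delta>1 simp: abs_mult split: split_indicator)
  have "quad_form (cell_coupling m) g = (\<integral>x. g (fst x) * cell_avg m g (fst x) \<partial>?PV)"
    using square_interval.integral_fst'[OF i(1)] interval.prob_space by (simp add: quad_form_cell[OF g])
  also have "\<dots> \<le> (\<integral>x. (if ?S x then g (fst x) * cell_avg l g (?q x) else 0) + indicator ?C x + (e + \<Delta> (?q x) / e) \<partial>?PV)"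
  proof (rule integral_mono)
    fix x
    show "g (fst x) * cell_avg m g (fst x) \<le> (if ?S x then g (fst x) * cell_avg l g (?q x) else 0) + indicator ?C x + (e + \<Delta> (?q x) / e)"
    proof (cases "?S x")
      case True
      have "g (fst x) * cell_avg m g (fst x) = g (fst x) * cell_avg m g (?q x)"
        using cell_avg_const[OF True] by simp
      also have "\<dots> = g (fst x) * cell_avg l g (?q x) + g (fst x) * (cell_avg m g (?q x) - cell_avg l g (?q x))"
        by (simp add: algebra_simps)
      also have "g (fst x) * (cell_avg m g (?q x) - cell_avg l g (?q x)) \<le> 1 * \<bar>cell_avg l g (?q x) - cell_avg m g (?q x)\<bar>"
      proof -
        have "g (fst x) * (cell_avg m g (?q x) - cell_avg l g (?q x)) \<le> g (fst x) * \<bar>cell_avg l g (?q x) - cell_avg m g (?q x)\<bar>"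
          using gD(2) by (intro mult_left_mono) auto
        also have "\<dots> \<le> 1 * \<bar>cell_avg l g (?q x) - cell_avg m g (?q x)\<bar>"
          using gD(3) by (intro mult_right_mono) auto
        finally show ?thesis .
      qed
      also have "\<dots> \<le> e + \<Delta> (?q x) / e"
        using abs_le_square_tradeoff[OF e] by (simp add: \<Delta>_def)
      finally show ?thesis using True by simp
    next
      case False
      have "g (fst x) * cell_avg m g (fst x) \<le> 1" using gD(2,3) aD(2,3) by (intro mult_le_one) auto
      moreover have "0 \<le> e + \<Delta> (?q x) / e" using e \<Delta>1 by simp
      ultimately show ?thesis using False by simp
    qed
  qed (use i in auto)
  also have "\<dots> = quad_form (smooth_coupling \<tau> m l) g + measure ?PV ?C + (e + (\<integral>x. \<Delta> (?q x) \<partial>?PV) / e)"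
    using i square_interval.prob_space by (simp add: quad_form_smooth[OF g] Int_absorb2[OF sets.sets_into_space[OF C]])
  also have "measure ?PV ?C \<le> e"
    using emeasure_cell_crossing[OF \<tau>, of m] small \<tau>
    by (simp add: square_interval.emeasure_eq_measure)
  also have "(\<integral>x. \<Delta> (?q x) \<partial>?PV) \<le> quad_form (cell_coupling l) g - quad_form (cell_coupling m) g"
  proof -
    have "integrable lborel \<Delta>"
      using \<Delta>1 aD(4) by (intro integrable_unit_square[where B=1]) (auto simp: \<Delta>_def)
    from integral_shift_le[OF this \<Delta>1(1)] show ?thesis
      using integral_cell_avg_diff_square[OF g ml] by (simp add: \<Delta>_def[abs_def] quad_form_cell_lborel[OF g])
  qed
  finally show ?thesis using e by (simp add: divide_right_mono)
qed

section \<open>Existence of a good scale\<close>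

text \<open>The unit square is a single cell of level 0, so two independent uniform points form the
  coarsest cell coupling.\<close>

lemma quad_form_square_product:
  assumes g: "test_fun unit_square g"
  shows "quad_form (square_measure \<Otimes>\<^sub>M square_measure) g = quad_form (cell_coupling 0) g"
proof -
  note gD = test_funD[OF g]
  have [measurable]: "g \<in> borel_measurable borel" using gD by simp
  interpret SS: pair_prob_space square_measure square_measure ..
  have "integrable (square_measure \<Otimes>\<^sub>M square_measure) (\<lambda>z. g (fst z) * g (snd z))"
    by (rule integrable_bounded_finite[where B=1])
       (auto intro!: SS.finite_measure_axioms mult_le_one gD(2,3,5) simp: abs_mult)
  from SS.integral_fst'[OF this]
  have "quad_form (square_measure \<Otimes>\<^sub>M square_measure) g = (\<integral>p. g p * (\<integral>q. g q \<partial>square_measure) \<partial>square_measure)"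
    by (simp add: quad_form_def)
  also have "(\<lambda>p. g p * (\<integral>q. g q \<partial>square_measure)) = (\<lambda>p. g p * cell_avg 0 g p)"
  proof
    fix p
    show "g p * (\<integral>q. g q \<partial>square_measure) = g p * cell_avg 0 g p"
    proof (cases "p \<in> unit_square")
      case True
      have "cell_kernel 0 p q * g q = g q" for q
        using True gD(4)[of q] unit_square_iff_cell[of p] unit_square_iff_cell[of q]
        by (auto simp: cell_kernel_def)
      then have "(\<lambda>q. cell_kernel 0 p q * g q) = g" by (rule ext)
      then have "cell_avg 0 g p = (\<integral>q. g q \<partial>lborel)" by (simp add: cell_avg_def)
      also have "\<dots> = (\<integral>q. g q \<partial>square_measure)" using gD(1,4) by (intro integral_square_measure[symmetric])
      finally show ?thesis by simp
    qed (simp add: gD(4))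
  qed
  finally show ?thesis by (simp add: quad_form_cell[OF g])
qed

lemma dyadic_scale_exists:
  fixes t d :: real
  assumes "0 < t" "t \<le> d"
  shows "\<exists>m::nat. d / 2 < 2 ^ m * t \<and> 2 ^ m * t \<le> d"
proof -
  obtain n0 where "d / t < 2 ^ n0" using real_arch_pow[of 2 "d / t"] by auto
  then have ex: "d < 2 ^ n0 * t" using assms by (simp add: field_simps)
  \<comment> \<open>The first exponent that overshoots \<open>d\<close>; its predecessor is the
    level wanted, and exists because \<open>t \<le> d\<close>.\<close>
  define n where "n = (LEAST n. d < 2 ^ n * t)"
  have n: "d < 2 ^ n * t" unfolding n_def by (rule LeastI[of "\<lambda>n. d < 2 ^ n * t", OF ex])
  then have "n \<noteq> 0" using assms by (cases n) auto
  then obtain m where m: "n = Suc m" using not0_implies_Suc by blast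
  have "\<not> d < 2 ^ m * t" using not_less_Least[of m "\<lambda>n. d < 2 ^ n * t"] m by (simp add: n_def)
  then show ?thesis using n m by (intro exI[of _ m]) auto
qed

lemma box_form_cell_mono:
  assumes "box_weight f unit_square" "\<And>k. m k \<le> m' k"
  shows "box_form f (\<lambda>k. cell_coupling (m k)) \<le> box_form f (\<lambda>k. cell_coupling (m' k))"
  using box_weight.box_form_mono[OF assms(1), of "\<lambda>k. cell_coupling (m k)" "\<lambda>k. cell_coupling (m' k)" 0] assms(2)
  by (simp add: sub_coupling_cell quad_form_cell_mono)

text \<open>Pigeonhole for a bounded monotone quantity: over many separated scales some increment of
  \<open>G\<close> is small, and there \<open>box_form_transfer\<close> leaves a positive remainder.
  The quantities \<open>e\<close>, \<open>L\<close> and \<open>J\<close> depend only on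
  \<open>\<delta>\<close> and \<open>CARD('n)\<close>, so they are available before the weight and
  the scales.\<close>

lemma exists_good_scale:
  assumes \<delta>: "0 < \<delta>"
  shows "\<exists>e>0. \<exists>L J::nat. \<forall>f :: ('n::finite \<Rightarrow> real \<times> real) \<Rightarrow> real. \<forall>\<tau> :: nat \<Rightarrow> 'n \<Rightarrow> real.
    box_weight f unit_square \<longrightarrow> \<delta> \<le> (\<integral>z. f (\<lambda>k. fst (z k)) \<partial>Pi\<^sub>M UNIV (\<lambda>_. square_measure \<Otimes>\<^sub>M square_measure)) \<longrightarrow>
    (\<forall>j k. j < J \<longrightarrow> 0 < \<tau> j k \<and> \<tau> j k \<le> e) \<longrightarrow>
    (\<forall>j k. Suc j < J \<longrightarrow> 2 ^ L * \<tau> j k \<le> \<tau> (Suc j) k) \<longrightarrow>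
    (\<exists>j<J. 0 < box_form f (\<lambda>k. circle_coupling (\<tau> j k)))"
proof -
  define n where "n = real CARD('n)"
  have n: "n > 0" by (simp add: n_def)
  define D where "D = \<delta> ^ (2 ^ CARD('n))"
  have D: "D > 0" using \<delta> by (simp add: D_def)
  \<comment> \<open>Makes the total error \<open>n * (e + 2 * e)\<close> equal to
    \<open>D / 4\<close>.\<close>
  define e where "e = D / (12 * n)"
  have e: "e > 0" using D n by (simp add: e_def)
  obtain s where s: "s > 0" "\<And>\<tau> m l g. 0 < \<tau> \<Longrightarrow> 2 / (2 ^ l * \<tau>) \<le> s \<Longrightarrow> test_fun unit_square g \<Longrightarrow>
    quad_form (smooth_coupling \<tau> m l) g \<le> quad_form (circle_coupling \<tau>) g + e"
    using quad_form_smooth_le_circle[OF e] by metis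
  \<comment> \<open>With \<open>2 ^ m * \<tau>\<close> above \<open>e / 4\<close>, this makes the
    cells of level \<open>m + L\<close> fine enough for \<open>s\<close>.\<close>
  obtain L where L: "8 / (e * s) < 2 ^ L" using real_arch_pow[of 2 "8 / (e * s)"] by auto
  define C :: real where "C = 4 ^ L"
  define B where "B = n * (1 / e) * C ^ CARD('n)"
  have B: "B > 0" using n e by (simp add: B_def C_def)
  \<comment> \<open>An increment of at most \<open>1 / real J\<close> then costs at most
    \<open>D / 4\<close>.\<close>
  obtain J where J: "4 * B / D < real J" using reals_Archimedean2 by blast
  have J0: "J > 0" using J B D by (cases J) (auto simp: field_simps)
  show ?thesis
  \<comment> \<open>The bound \<open>e / 2\<close> guarantees a level \<open>m\<close> as
    \<open>quad_form_cell_le_smooth\<close> requires. The extra factor 2 in the separation absorbs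
    the rounding to powers of two.\<close>
  proof (rule exI[of _ "e / 2"], rule conjI, use e in simp, rule exI[of _ "Suc L"], rule exI[of _ J], intro allI impI)
    fix f :: "('n \<Rightarrow> real \<times> real) \<Rightarrow> real" and \<tau> :: "nat \<Rightarrow> 'n \<Rightarrow> real"
    assume "box_weight f unit_square"
      and avg: "\<delta> \<le> (\<integral>z. f (\<lambda>k. fst (z k)) \<partial>Pi\<^sub>M UNIV (\<lambda>_. square_measure \<Otimes>\<^sub>M square_measure))"
      and \<tau>: "\<forall>j k. j < J \<longrightarrow> 0 < \<tau> j k \<and> \<tau> j k \<le> e / 2"
      and sep: "\<forall>j k. Suc j < J \<longrightarrow> 2 ^ Suc L * \<tau> j k \<le> \<tau> (Suc j) k"
    interpret box_weight f unit_square by fact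
    have "\<exists>m. j < J \<longrightarrow> e / 2 / 2 < 2 ^ m * \<tau> j k \<and> 2 ^ m * \<tau> j k \<le> e / 2" for j k
      using dyadic_scale_exists[of "\<tau> j k" "e / 2"] \<tau> by blast
    then obtain m :: "nat \<Rightarrow> 'n \<Rightarrow> nat" where m: "\<And>j k. j < J \<Longrightarrow> e / 2 / 2 < 2 ^ m j k * \<tau> j k \<and> 2 ^ m j k * \<tau> j k \<le> e / 2"
      by metis
    define G where "G m = box_form f (\<lambda>k. cell_coupling (m k))" for m
    let ?G1 = "\<lambda>j. G (\<lambda>k. m j k + L)" and ?G0 = "\<lambda>j. G (m j)"
    \<comment> \<open>Larger lengths have coarser levels, so the levels decrease in
      \<open>j\<close>, by at least \<open>L\<close> each time.\<close>
    have next_scale: "m (Suc j) k + L \<le> m j k" if "Suc j < J" for j k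
    proof -
      have p: "0 < \<tau> (Suc j) k" "0 < \<tau> j k" using \<tau> that by auto
      have "2 ^ m (Suc j) k * (2 ^ Suc L * \<tau> j k) \<le> 2 ^ m (Suc j) k * \<tau> (Suc j) k"
        using sep that by (intro mult_left_mono) auto
      also have "\<dots> \<le> e / 2" using m[OF that] by auto
      also have "\<dots> < 2 * (2 ^ m j k * \<tau> j k)" using m[of j k] that by auto
      finally have "(2::real) ^ (m (Suc j) k + L) * \<tau> j k < 2 ^ m j k * \<tau> j k"
        by (simp add: power_add)
      then have "(2::real) ^ (m (Suc j) k + L) < 2 ^ m j k" using p by simp
      then have "m (Suc j) k + L < m j k" by (rule power_less_imp_less_exp[rotated]) simp
      then show ?thesis by simp
    qed
    \<comment> \<open>By \<open>next_scale\<close> the level ranges from \<open>m j\<close> to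
      \<open>m j + L\<close> do not overlap, so monotonicity of \<open>G\<close> lets the increments
      telescope.\<close>
    have telescope: "(\<Sum>j<Suc i. ?G1 j - ?G0 j) \<le> ?G1 0 - ?G0 i" if "i < J" for i
      using that
    proof (induction i)
      case (Suc i)
      have "?G1 (Suc i) \<le> ?G0 i"
        unfolding G_def using next_scale[OF Suc.prems] by (intro box_form_cell_mono \<open>box_weight f unit_square\<close>) auto
      then show ?case using Suc by simp
    qed simp
    have bnd: "0 \<le> G m" "G m \<le> 1" for m
      unfolding G_def using box_form_bounds[of "\<lambda>k. cell_coupling (m k)"] by (auto simp: sub_coupling_cell)
    have "(\<Sum>j<J. ?G1 j - ?G0 j) \<le> 1"
      using telescope[of "J - 1"] J0 bnd(2)[of "\<lambda>k. m 0 k + L"] bnd(1)[of "m (J - 1)"] by simp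
    have "\<exists>j<J. ?G1 j - ?G0 j \<le> 1 / real J"
    proof (rule ccontr)
      assume "\<not> ?thesis"
      then have "\<And>j. j < J \<Longrightarrow> 1 / real J < ?G1 j - ?G0 j" by force
      then have "(\<Sum>j<J. 1 / real J) < (\<Sum>j<J. ?G1 j - ?G0 j)"
        using J0 by (intro sum_strict_mono) auto
      then show False using \<open>(\<Sum>j<J. ?G1 j - ?G0 j) \<le> 1\<close> J0 by simp
    qed
    then obtain j where j: "j < J" "?G1 j - ?G0 j \<le> 1 / real J" by auto
    have fine: "2 / (2 ^ (m j k + L) * \<tau> j k) \<le> s" for k
    proof -
      have "e / 4 \<le> 2 ^ m j k * \<tau> j k" using m[OF j(1), of k] by simp
      then have "s * (2 ^ L * (e / 4)) \<le> s * (2 ^ L * (2 ^ m j k * \<tau> j k))"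
        using s(1) by (intro mult_left_mono) auto
      moreover have "8 < 2 ^ L * (e * s)" using L e s(1) by (simp add: field_simps)
      ultimately have "2 \<le> s * (2 ^ (m j k + L) * \<tau> j k)" by (simp add: power_add mult_ac)
      moreover have "0 < 2 ^ (m j k + L) * \<tau> j k" using \<tau> j by simp
      ultimately show ?thesis by (simp add: divide_le_eq)
    qed
    have \<tau>j: "0 < \<tau> j k" "2 ^ m j k * \<tau> j k \<le> e / 2" for k using \<tau> m j by auto
    \<comment> \<open>Cauchy-Schwarz bounds the form at the coarsest level from below; monotonicity
      carries the bound to level \<open>m j\<close>.\<close>
    have "D \<le> (\<integral>z. f (\<lambda>k. fst (z k)) \<partial>Pi\<^sub>M UNIV (\<lambda>_. square_measure \<Otimes>\<^sub>M square_measure)) ^ (2 ^ CARD('n))"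
      unfolding D_def using avg \<delta> by (intro power_mono) auto
    also have "\<dots> \<le> box_form f (\<lambda>_. square_measure \<Otimes>\<^sub>M square_measure)"
      by (rule power_average_le_box_form) (auto intro: prob_space_square_measure)
    also have "\<dots> \<le> box_form f (\<lambda>_. cell_coupling 0) + real CARD('n) * 0"
    proof (rule box_form_mono)
      interpret SS: pair_prob_space square_measure square_measure ..
      show "\<forall>k::'n. sub_coupling (square_measure \<Otimes>\<^sub>M square_measure)"
        using SS.emeasure_space_1 by (simp add: sub_coupling_def sets_pair_borel)
    qed (auto simp: sub_coupling_cell quad_form_square_product)
    also have "\<dots> \<le> ?G0 j"
      unfolding G_def using box_form_cell_mono[OF \<open>box_weight f unit_square\<close>, of "\<lambda>_. 0" "m j"] by simp
    finally have "D \<le> ?G0 j" .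
    also have "?G0 j \<le> box_form f (\<lambda>k. circle_coupling (\<tau> j k)) + real CARD('n) * (e + 2 * e)
        + real CARD('n) * (1 / e) * C ^ CARD('n) * (?G1 j - ?G0 j)"
      unfolding G_def
    proof (rule box_form_transfer[where V="\<lambda>k. smooth_coupling (\<tau> j k) (m j k) (m j k + L)"])
      fix k :: 'n and g assume g: "test_fun unit_square g"
      show "quad_form (smooth_coupling (\<tau> j k) (m j k) (m j k + L)) g \<le> quad_form (circle_coupling (\<tau> j k)) g + e"
        by (rule s(2)[OF \<tau>j(1) fine g])
      show "quad_form (cell_coupling (m j k)) g \<le> quad_form (smooth_coupling (\<tau> j k) (m j k) (m j k + L)) g + 2 * e
          + 1 / e * (quad_form (cell_coupling (m j k + L)) g - quad_form (cell_coupling (m j k)) g)"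
        by (rule quad_form_cell_le_smooth[OF g \<tau>j(1) e _ \<tau>j(2)]) simp
      show "quad_form (cell_coupling (m j k)) g \<le> quad_form (cell_coupling (m j k + L)) g"
        by (rule quad_form_cell_mono[OF g]) simp
    next
      fix k :: 'n and \<phi> :: "(real \<times> real) \<times> (real \<times> real) \<Rightarrow> real"
      assume "\<phi> \<in> borel_measurable borel" "\<And>y. 0 \<le> \<phi> y \<and> \<phi> y \<le> 1"
      from smooth_coupling_dominated[OF this, of "m j k" "m j k + L" "\<tau> j k"]
      show "(\<integral>y. \<phi> y \<partial>smooth_coupling (\<tau> j k) (m j k) (m j k + L)) \<le> C * (\<integral>y. \<phi> y \<partial>cell_coupling (m j k))"
        by (simp add: C_def)
    qed (use e in \<open>auto simp: sub_coupling_cell sub_coupling_circle sub_coupling_smooth C_def\<close>)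
    also have "real CARD('n) * (1 / e) * C ^ CARD('n) * (?G1 j - ?G0 j) \<le> B * (1 / real J)"
      unfolding B_def n_def using j(2) e by (intro mult_left_mono) (auto simp: C_def)
    also have "B * (1 / real J) \<le> D / 4"
      using J J0 D by (simp add: field_simps)
    also have "real CARD('n) * (e + 2 * e) = D / 4" using n by (simp add: e_def n_def)
    finally have "0 < box_form f (\<lambda>k. circle_coupling (\<tau> j k))" using D by simp
    then show "\<exists>j<J. 0 < box_form f (\<lambda>k. circle_coupling (\<tau> j k))" using j(1) by blast
  qed
qed

text \<open>Almost every tuple has the prescribed side lengths. Were the corner product zero for all
  of them, the integral would vanish.\<close>

lemma box_form_circle_pos_imp_box:
  assumes "box_weight f unit_square" and "0 < box_form f (\<lambda>k::'n::finite. circle_coupling (\<tau> k))" and "\<And>k. 0 \<le> \<tau> k"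
  shows "\<exists>z :: 'n \<Rightarrow> (real \<times> real) \<times> (real \<times> real). (\<forall>k. norm (snd (z k) - fst (z k)) = \<tau> k) \<and> (\<forall>S. f (mix z S) \<noteq> 0)"
proof (rule ccontr)
  assume contra: "\<not> ?thesis"
  interpret box_weight f unit_square by fact
  have "AE y in circle_coupling (\<tau> k). norm (snd y - fst y) = \<tau> k" for k
    unfolding circle_coupling_def
  proof (subst AE_distr_iff[OF circle_pair_measurable])
    show "{x \<in> space borel. norm (snd x - fst x :: real \<times> real) = \<tau> k} \<in> sets borel"
      by measurable
    show "AE x in square_measure \<Otimes>\<^sub>M unit_interval. norm (snd (case x of (p, v) \<Rightarrow> (p, p + \<tau> k *\<^sub>R circle_arc v)) -
        fst (case x of (p, v) \<Rightarrow> (p, p + \<tau> k *\<^sub>R circle_arc v))) = \<tau> k"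
      by (rule AE_I2) (use assms(3) in \<open>auto simp: norm_circle_arc\<close>)
  qed
  then have "AE z in Pi\<^sub>M UNIV (\<lambda>k. circle_coupling (\<tau> k)). norm (snd (z k) - fst (z k)) = \<tau> k" for k
    by (intro AE_PiM_component prob_space_circle_coupling) auto
  then have "AE z in Pi\<^sub>M UNIV (\<lambda>k. circle_coupling (\<tau> k)). \<forall>k\<in>UNIV. norm (snd (z k) - fst (z k)) = \<tau> k"
    by (intro AE_finite_allI) auto
  then have "AE z in Pi\<^sub>M UNIV (\<lambda>k. circle_coupling (\<tau> k)). corners f UNIV z = 0"
  proof eventually_elim
    case (elim z)
    then obtain S where "f (mix z S) = 0" using contra by auto
    then show ?case unfolding corners_def by (intro prod_zero) auto
  qed
  then have "box_form f (\<lambda>k. circle_coupling (\<tau> k)) = 0"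
    unfolding box_form_def by (rule integral_eq_zero_AE)
  with assms(2) show False by simp
qed

section \<open>Return to the original set\<close>

text \<open>Passes from tuples of pairs, on which the product measures live, to the vector type of
  the theorem.\<close>

definition assemble :: "('n \<Rightarrow> real \<times> real) \<Rightarrow> (real ^ 2) ^ 'n" where
  "assemble w = (\<chi> k. vector [fst (w k), snd (w k)])"

lemma assemble_nth[simp]: "assemble w $ k $ 1 = fst (w k)" "assemble w $ k $ 2 = snd (w k)"
  by (simp_all add: assemble_def)

section \<open>Lebesgue measure on the product of planes\<close>

lemma Basis_vec2: "(Basis :: ((real ^ 2) ^ 'n::finite) set) = (\<lambda>(k, i). axis k (axis i 1)) ` UNIV"
  by (auto simp: Basis_vec_def image_iff)

lemma axis_axis_Basis: "(axis k (axis i 1) :: (real ^ 2) ^ 'n::finite) \<in> Basis"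
  unfolding Basis_vec2 by (rule image_eqI[of _ _ "(k, i)"]) auto

lemma inner_axis_axis_1: "(x :: (real ^ 2) ^ 'n::finite) \<bullet> axis k (axis i 1) = x $ k $ i"
  by (simp add: inner_axis)

lemma mem_box_vec2:
  "x \<in> box l u \<longleftrightarrow> (\<forall>k i. l $ k $ i < x $ k $ i \<and> x $ k $ i < u $ k $ i)" for x :: "(real ^ 2) ^ 'n::finite"
  unfolding mem_box Basis_vec2 by (auto simp: inner_axis_axis_1)

lemma assemble_measurable:
  "assemble \<in> Pi\<^sub>M UNIV (\<lambda>_::'n::finite. borel) \<rightarrow>\<^sub>M borel"
proof (subst borel_measurable_euclidean_space, rule ballI)
  fix b :: "(real ^ 2) ^ 'n" assume "b \<in> Basis"
  then obtain k i where b: "b = axis k (axis i 1)" by (auto simp: Basis_vec2)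
  have c: "(\<lambda>w. w k) \<in> Pi\<^sub>M UNIV (\<lambda>_::'n. borel :: (real \<times> real) measure) \<rightarrow>\<^sub>M borel"
    by (rule measurable_component_singleton) simp
  have "i = 1 \<or> i = 2" by (rule exhaust_2)
  then show "(\<lambda>w. assemble w \<bullet> b) \<in> borel_measurable (Pi\<^sub>M UNIV (\<lambda>_. borel))"
    using measurable_compose[OF c fst_snd_borel(1)] measurable_compose[OF c fst_snd_borel(2)]
    by (auto simp: b inner_axis_axis_1)
qed

text \<open>Lebesgue measure is determined by boxes, and the preimage of a box is a product of
  planar boxes.\<close>

lemma distr_assemble_lborel:
  "distr (Pi\<^sub>M UNIV (\<lambda>_::'n::finite. lborel)) borel assemble = lborel"
proof (rule lborel_eqI[symmetric])
  interpret P: product_sigma_finite "\<lambda>_::'n. lborel :: (real \<times> real) measure" ..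
  have sets: "sets (Pi\<^sub>M UNIV (\<lambda>_::'n. lborel :: (real \<times> real) measure)) = sets (Pi\<^sub>M UNIV (\<lambda>_. borel))"
    by (intro sets_PiM_cong) auto
  have m: "assemble \<in> Pi\<^sub>M UNIV (\<lambda>_::'n. lborel) \<rightarrow>\<^sub>M borel"
    using assemble_measurable by (simp cong: measurable_cong_sets add: sets)
  fix l u :: "(real ^ 2) ^ 'n" assume le: "\<And>b. b \<in> Basis \<Longrightarrow> l \<bullet> b \<le> u \<bullet> b"
  have lu: "l $ k $ i \<le> u $ k $ i" for k i
    using le[of "axis k (axis i 1)"] by (simp add: inner_axis_axis_1 axis_axis_Basis)
  let ?Q = "\<lambda>k. {l $ k $ 1 <..< u $ k $ 1} \<times> {l $ k $ 2 <..< u $ k $ 2}"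
  have Q: "?Q k \<in> sets borel" for k by (intro borel_Times) auto
  have "assemble -` box l u \<inter> space (Pi\<^sub>M UNIV (\<lambda>_::'n. lborel :: (real \<times> real) measure)) = Pi\<^sub>E UNIV ?Q"
    by (auto simp: mem_box_vec2 forall_2 space_PiM PiE_iff mem_Times_iff)
  then have "emeasure (distr (Pi\<^sub>M UNIV (\<lambda>_::'n. lborel)) borel assemble) (box l u) = emeasure (Pi\<^sub>M UNIV (\<lambda>_::'n. lborel)) (Pi\<^sub>E UNIV ?Q)"
    by (simp add: emeasure_distr[OF m])
  also have "\<dots> = (\<Prod>k\<in>UNIV. emeasure lborel (?Q k))"
    using Q by (intro P.emeasure_PiM) auto
  also have "\<dots> = (\<Prod>k\<in>UNIV. ennreal ((u $ k $ 1 - l $ k $ 1) * (u $ k $ 2 - l $ k $ 2)))"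
    using lu by (intro prod.cong refl)
      (simp add: lborel_prod[symmetric] lborel.emeasure_pair_measure_Times ennreal_mult)
  also have "\<dots> = ennreal (\<Prod>k\<in>UNIV. (u $ k $ 1 - l $ k $ 1) * (u $ k $ 2 - l $ k $ 2))"
    using lu by (intro prod_ennreal) auto
  also have "(\<Prod>k\<in>UNIV. (u $ k $ 1 - l $ k $ 1) * (u $ k $ 2 - l $ k $ 2)) = (\<Prod>k\<in>UNIV. \<Prod>i\<in>UNIV. (u - l) $ k $ i)"
    by (simp add: UNIV_2)
  also have "\<dots> = (\<Prod>(k, i)\<in>UNIV. (u - l) $ k $ i)"
    by (simp add: prod.cartesian_product)
  also have "\<dots> = (\<Prod>b\<in>Basis. (u - l) \<bullet> b)"
    unfolding Basis_vec2
    by (subst prod.reindex) (auto simp: inj_on_def axis_eq_axis inner_axis_axis_1 intro!: prod.cong)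
  finally show "emeasure (distr (Pi\<^sub>M UNIV (\<lambda>_::'n. lborel)) borel assemble) (box l u) = (\<Prod>b\<in>Basis. (u - l) \<bullet> b)" .
qed simp

lemma PiM_square_measure:
  "Pi\<^sub>M UNIV (\<lambda>_::'n::finite. square_measure) =
    density (Pi\<^sub>M UNIV (\<lambda>_. lborel)) (indicator (\<Pi>\<^sub>E k\<in>UNIV. unit_square))"
proof -
  interpret S: product_prob_space "\<lambda>_::'n. square_measure" ..
  interpret P: product_sigma_finite "\<lambda>_::'n. lborel :: (real \<times> real) measure" ..
  let ?P = "Pi\<^sub>M UNIV (\<lambda>_::'n. lborel :: (real \<times> real) measure)"
  have U: "(\<Pi>\<^sub>E k\<in>UNIV. unit_square) \<in> sets ?P" by (intro sets_PiM_I_finite) auto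
  show ?thesis
  proof (rule S.PiM_eqI[symmetric])
    show "sets (density ?P (indicator (\<Pi>\<^sub>E k\<in>UNIV. unit_square))) = sets (Pi\<^sub>M UNIV (\<lambda>_::'n. square_measure))"
      by (simp, intro sets_PiM_cong) auto
    fix A :: "'n \<Rightarrow> (real \<times> real) set" assume A: "\<And>i. i \<in> UNIV \<Longrightarrow> A i \<in> sets square_measure"
    then have A': "A i \<in> sets borel" for i by simp
    have AP: "Pi\<^sub>E UNIV A \<in> sets ?P" using A' by (intro sets_PiM_I_finite) auto
    have "emeasure (density ?P (indicator (\<Pi>\<^sub>E k\<in>UNIV. unit_square))) (Pi\<^sub>E UNIV A) =
        (\<integral>\<^sup>+w. indicator (\<Pi>\<^sub>E k\<in>UNIV. unit_square \<inter> A k) w \<partial>?P)"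
      using U AP by (subst emeasure_density) (auto intro!: nn_integral_cong split: split_indicator simp: PiE_iff)
    also have "\<dots> = emeasure ?P (\<Pi>\<^sub>E k\<in>UNIV. unit_square \<inter> A k)"
      using A' by (intro nn_integral_indicator sets_PiM_I_finite) auto
    also have "\<dots> = (\<Prod>k\<in>UNIV. emeasure lborel (unit_square \<inter> A k))"
      using A' by (intro P.emeasure_PiM) auto
    also have "\<dots> = (\<Prod>k\<in>UNIV. emeasure square_measure (A k))"
    proof (intro prod.cong refl)
      fix k
      have "emeasure square_measure (A k) = (\<integral>\<^sup>+p. indicator (unit_square \<inter> A k) p \<partial>lborel)"
        unfolding square_measure_def using A'[of k]
        by (subst emeasure_density)
           (auto intro!: nn_integral_cong split: split_indicator simp del: nn_integral_indicator)
      then show "emeasure lborel (unit_square \<inter> A k) = emeasure square_measure (A k)"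
        using A'[of k] by simp
    qed
    finally show "emeasure (density ?P (indicator (\<Pi>\<^sub>E k\<in>UNIV. unit_square))) (Pi\<^sub>E UNIV A) =
      (\<Prod>i\<in>UNIV. emeasure square_measure (A i))" .
  qed simp
qed

text \<open>The first points are uniform in the unit cube and \<open>assemble\<close> carries their
  law to Lebesgue measure there; \<open>B\<close> lies in the cube, so its average is its
  measure.\<close>

lemma integral_square_average:
  fixes B :: "((real ^ 2) ^ 'n::finite) set"
  assumes B: "B \<in> sets borel" "\<And>w k. assemble w \<in> B \<Longrightarrow> w k \<in> unit_square"
  shows "(\<integral>z. indicator B (assemble (\<lambda>k. fst (z k))) \<partial>Pi\<^sub>M UNIV (\<lambda>_::'n. square_measure \<Otimes>\<^sub>M square_measure)) = measure lborel B"
proof -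
  let ?S = "Pi\<^sub>M UNIV (\<lambda>_::'n. square_measure)"
  let ?P = "Pi\<^sub>M UNIV (\<lambda>_::'n. lborel :: (real \<times> real) measure)"
  have sets: "sets ?S = sets (Pi\<^sub>M UNIV (\<lambda>_. borel))" "sets ?P = sets (Pi\<^sub>M UNIV (\<lambda>_. borel))"
    by (intro sets_PiM_cong; simp)+
  have m: "assemble \<in> ?P \<rightarrow>\<^sub>M borel" "assemble \<in> ?S \<rightarrow>\<^sub>M borel"
    using assemble_measurable by (simp_all cong: measurable_cong_sets add: sets)
  define h :: "('n \<Rightarrow> real \<times> real) \<Rightarrow> real" where "h w = indicator B (assemble w)" for w
  have h[measurable]: "h \<in> borel_measurable ?P" "h \<in> borel_measurable ?S"
    unfolding h_def using m B by (auto intro!: measurable_compose[OF _ borel_measurable_indicator])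
  have U[measurable]: "(\<Pi>\<^sub>E k\<in>UNIV. unit_square) \<in> sets ?P" by (intro sets_PiM_I_finite) auto
  interpret SS: pair_prob_space square_measure square_measure ..
  have meas: "(\<lambda>z k. fst (z k)) \<in> Pi\<^sub>M UNIV (\<lambda>_::'n. square_measure \<Otimes>\<^sub>M square_measure) \<rightarrow>\<^sub>M ?S"
    by (rule measurable_PiM_single') (auto simp: space_PiM space_pair_measure PiE_iff mem_Times_iff)
  have "(\<integral>z. h (\<lambda>k. fst (z k)) \<partial>Pi\<^sub>M UNIV (\<lambda>_::'n. square_measure \<Otimes>\<^sub>M square_measure)) = (\<integral>w. h w \<partial>?S)"
    using integral_distr[OF meas h(2)] distr_PiM_fst[OF prob_space_square_measure, where 'n='n] by simp
  also have "\<dots> = (\<integral>w. h w \<partial>density ?P (\<lambda>w. ennreal (indicator (\<Pi>\<^sub>E k\<in>UNIV. unit_square) w)))"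
    unfolding PiM_square_measure by (simp add: ennreal_indicator)
  also have "\<dots> = (\<integral>w. indicator (\<Pi>\<^sub>E k\<in>UNIV. unit_square) w *\<^sub>R h w \<partial>?P)"
    by (subst integral_density) auto
  also have "\<dots> = (\<integral>w. h w \<partial>?P)"
    using B(2) by (intro Bochner_Integration.integral_cong) (auto simp: h_def PiE_iff split: split_indicator)
  also have "\<dots> = (\<integral>y. indicator B y \<partial>distr ?P borel assemble)"
    using B(1) by (subst integral_distr[OF m(1)]) (auto simp: h_def[abs_def])
  also have "\<dots> = measure lborel B"
    unfolding distr_assemble_lborel using B(1) by simp
  finally show ?thesis by (simp add: h_def)
qed

text \<open>Passing to the open cube discards a null set and later places the result in the
  half-open unit square in each plane. The main part of a Lebesgue set is a Borel subset of equal
  measure, and rescaling divides measure by \<open>R ^ DIM('a)\<close>.\<close>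

lemma rescaled_borel_part:
  fixes A :: "'a::euclidean_space set"
  assumes A: "A \<in> sets lebesgue" and R: "0 < R"
    and dens: "\<delta> < measure lebesgue (A \<inter> ((+) x ` cbox 0 (R *\<^sub>R One))) / R ^ DIM('a)"
  obtains B where "B \<in> sets borel" "B \<subseteq> box 0 One" "\<And>y. y \<in> B \<Longrightarrow> x + R *\<^sub>R y \<in> A" "\<delta> < measure lborel B"
proof -
  define u where "u = x + R *\<^sub>R One"
  define E where "E = A \<inter> box x u"
  have E: "E \<in> sets lebesgue" unfolding E_def using A by auto
  have Efin: "E \<in> lmeasurable"
    by (rule bounded_set_imp_lmeasurable[OF _ E]) (auto simp: E_def intro: bounded_subset[OF bounded_box])
  define M where "M = main_part lborel E"
  have M: "M \<in> sets borel" "M \<subseteq> E" "measure lborel M = measure lebesgue E"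
  proof -
    show "M \<in> sets borel" using main_part_sets[OF E] by (simp add: M_def)
    show "M \<subseteq> E" unfolding M_def using main_part_null_part_Un[OF E] by blast
    show "measure lborel M = measure lebesgue E" using E by (simp add: M_def measure_def)
  qed
  have [measurable]: "M \<in> sets borel" by (rule M)
  have "A \<inter> ((+) x ` cbox 0 (R *\<^sub>R One)) = A \<inter> cbox x u"
    using cbox_translation[of x 0 "R *\<^sub>R One"] by (simp add: u_def)
  moreover have "measure lebesgue (A \<inter> cbox x u) = measure lebesgue E"
  proof (rule measure_negligible_symdiff[OF Efin])
    show "negligible (E - A \<inter> cbox x u \<union> (A \<inter> cbox x u - E))"
      by (rule negligible_subset[OF negligible_frontier_interval[of x u]])
         (use box_subset_cbox[of x u] in \<open>auto simp: E_def\<close>)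
  qed
  ultimately have dE: "\<delta> * R ^ DIM('a) < measure lborel M"
    using dens R M(3) by (simp add: field_simps)
  define B where "B = (\<lambda>y. x + R *\<^sub>R y) -` M"
  have B[measurable]: "B \<in> sets borel"
    unfolding B_def using measurable_sets[of "\<lambda>y. x + R *\<^sub>R y" borel borel M] by simp
  have "measure lborel M = R ^ DIM('a) * measure lborel B"
  proof -
    have "(\<integral>z. indicator M z \<partial>lborel) = \<bar>R\<bar> ^ DIM('a) * (\<integral>z. indicator M (x + R *\<^sub>R z) \<partial>lborel)"
      using R by (intro lborel_integral_affine) auto
    also have "(\<lambda>z. indicator M (x + R *\<^sub>R z)) = (indicator B :: _ \<Rightarrow> real)"
      by (auto simp: B_def split: split_indicator)
    finally show ?thesis using R by simp
  qed
  with dE R have "\<delta> < measure lborel B" by (simp add: mult.commute)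
  moreover have "y \<in> box 0 One" if "y \<in> B" for y
  proof -
    have "x + R *\<^sub>R y \<in> box x u" using that M(2) by (auto simp: B_def E_def)
    then show ?thesis using R by (auto simp: mem_box u_def inner_add_left zero_less_mult_iff)
  qed
  moreover have "x + R *\<^sub>R y \<in> A" if "y \<in> B" for y
    using that M(2) by (auto simp: B_def E_def)
  ultimately show thesis using B by (intro that[of B]) auto
qed

lemma box_weight_indicator:
  fixes B :: "((real ^ 2) ^ 'n::finite) set"
  assumes "B \<in> sets borel" "B \<subseteq> box 0 One"
  shows "box_weight (\<lambda>w. indicator B (assemble w)) unit_square"
    and "assemble w \<in> B \<Longrightarrow> w k \<in> unit_square"
proof -
  show sq: "w k \<in> unit_square" if "assemble w \<in> B" for w k
  proof -
    have "assemble w \<in> box 0 One" using that assms(2) by auto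
    then have "0 < assemble w $ k $ i \<and> assemble w $ k $ i < (One :: (real ^ 2) ^ 'n) \<bullet> axis k (axis i 1)" for i
      by (simp add: mem_box_vec2 inner_axis_axis_1)
    then have "0 < assemble w $ k $ i \<and> assemble w $ k $ i < 1" for i
      by (simp add: axis_axis_Basis)
    from this[of 1] this[of 2] show ?thesis by (cases "w k") (auto simp: unit_square_def)
  qed
  show "box_weight (\<lambda>w. indicator B (assemble w)) unit_square"
  proof
    show "(\<lambda>w. indicator B (assemble w)) \<in> borel_measurable (Pi\<^sub>M UNIV (\<lambda>_. borel))"
      using assms(1) by (intro measurable_compose[OF assemble_measurable borel_measurable_indicator]) auto
    show "w k \<notin> unit_square \<Longrightarrow> indicator B (assemble w) = 0" for w k
      using sq[of w k] by (auto split: split_indicator)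
  qed (auto split: split_indicator)
qed

text \<open>Choose a real \<open>\<delta>\<close> strictly below the density. If all large cubes had
  relative measure at most \<open>\<delta>\<close>, so would the upper limit.\<close>

lemma upper_banach_density_witness:
  fixes A :: "'a::euclidean_space set"
  assumes "0 < upper_banach_density A"
  obtains \<delta> where "0 < \<delta>"
    "\<And>R0. \<exists>R\<ge>R0. \<exists>x. \<delta> < measure lebesgue (A \<inter> ((+) x ` cbox 0 (R *\<^sub>R One))) / R ^ DIM('a)"
proof -
  obtain \<delta> where \<delta>: "0 < ereal \<delta>" "ereal \<delta> < upper_banach_density A"
    using ereal_dense2[OF assms] by auto
  let ?d = "\<lambda>R x. measure lebesgue (A \<inter> ((+) x ` cbox 0 (R *\<^sub>R One))) / R ^ DIM('a)"
  have "\<exists>R\<ge>R0. \<exists>x. \<delta> < ?d R x" for R0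
  proof (rule ccontr)
    assume "\<not> ?thesis"
    then have "\<And>R x. R0 \<le> R \<Longrightarrow> ?d R x \<le> \<delta>" by (meson not_le)
    then have "eventually (\<lambda>R. (SUP x. ereal (?d R x)) \<le> ereal \<delta>) at_top"
      by (intro eventually_at_top_linorderI[of R0] SUP_least) auto
    then have "upper_banach_density A \<le> ereal \<delta>"
      unfolding upper_banach_density_def by (rule Limsup_bounded)
    with \<delta> show False by simp
  qed
  then show thesis using \<delta>(1) by (intro that[of \<delta>]) auto
qed

lemma norm_vector_2: "norm (vector [fst p, snd p] :: real ^ 2) = norm p"
  by (cases p) (simp add: norm_vec_def L2_set_def sum_2 norm_Pair)

theorem theorem2:
  fixes a b :: "'n::finite \<Rightarrow> real"
    and A :: "((real ^ 2) ^ 'n) set"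
  assumes "\<And>k. a k > 0"
    and "\<And>k. b k > 0"
    and "A \<in> sets lebesgue"
    and "upper_banach_density A > 0"
  shows "\<exists>lam0::real. lam0 > 0 \<and> (\<forall>lam\<ge>lam0. \<exists>x y :: (real ^ 2) ^ 'n.
           {(\<chi> k. x $ k + r k *\<^sub>R y $ k) | r :: 'n \<Rightarrow> real. \<forall>k. r k \<in> {0, 1}} \<subseteq> A \<and>
           (\<forall>k. norm (y $ k) = lam powr a k * b k))"
proof (rule ccontr)
  define good where "good lam \<longleftrightarrow> (\<exists>x y :: (real ^ 2) ^ 'n.
           {(\<chi> k. x $ k + r k *\<^sub>R y $ k) | r :: 'n \<Rightarrow> real. \<forall>k. r k \<in> {0, 1}} \<subseteq> A \<and>
           (\<forall>k. norm (y $ k) = lam powr a k * b k))" for lam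
  assume "\<not> ?thesis"
  then have bad: "\<exists>lam\<ge>lam0. \<not> good lam" if "lam0 > 0" for lam0
    using that unfolding good_def[symmetric] by blast
  obtain \<delta> where \<delta>: "0 < \<delta>"
    "\<And>R0. \<exists>R\<ge>R0. \<exists>x. \<delta> < measure lebesgue (A \<inter> ((+) x ` cbox 0 (R *\<^sub>R One))) / R ^ DIM((real ^ 2) ^ 'n)"
    using upper_banach_density_witness[OF assms(4)] by blast
  obtain e L J where e: "e > 0" and good_scale: "\<And>(f :: ('n \<Rightarrow> real \<times> real) \<Rightarrow> real) \<tau> :: nat \<Rightarrow> 'n \<Rightarrow> real.
    box_weight f unit_square \<Longrightarrow> \<delta> \<le> (\<integral>z. f (\<lambda>k. fst (z k)) \<partial>Pi\<^sub>M UNIV (\<lambda>_. square_measure \<Otimes>\<^sub>M square_measure)) \<Longrightarrow>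
    (\<forall>j k. j < J \<longrightarrow> 0 < \<tau> j k \<and> \<tau> j k \<le> e) \<Longrightarrow>
    (\<forall>j k. Suc j < J \<longrightarrow> 2 ^ L * \<tau> j k \<le> \<tau> (Suc j) k) \<Longrightarrow>
    (\<exists>j<J. 0 < box_form f (\<lambda>k. circle_coupling (\<tau> j k)))"
    using exists_good_scale[OF \<delta>(1), where 'n='n] by metis
  \<comment> \<open>Multiplying \<open>lam\<close> by \<open>\<Lambda>\<close> enlarges every side
    length at least \<open>2 ^ L\<close> times, whatever its exponent: the sum dominates each term,
    and the summand 1 gives \<open>1 \<le> \<Lambda>\<close>.\<close>
  define \<Lambda> :: real where "\<Lambda> = 1 + (\<Sum>k\<in>UNIV. (2 ^ L) powr (1 / a k))"
  have \<Lambda>: "2 ^ L \<le> \<Lambda> powr a k" "1 \<le> \<Lambda>" for k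
  proof -
    have le: "(2 ^ L) powr (1 / a k) \<le> (\<Sum>k\<in>UNIV. (2 ^ L) powr (1 / a k))"
      by (rule member_le_sum) auto
    then have "((2 ^ L) powr (1 / a k)) powr a k \<le> \<Lambda> powr a k"
      using assms(1)[of k] by (intro powr_mono2) (auto simp: \<Lambda>_def)
    then show "2 ^ L \<le> \<Lambda> powr a k" using assms(1)[of k] by (simp add: powr_powr)
    show "1 \<le> \<Lambda>" by (simp add: \<Lambda>_def sum_nonneg)
  qed
  \<comment> \<open>Bad values occur arbitrarily far out, so they can be picked successively with
    ratio at least \<open>\<Lambda>\<close>.\<close>
  have "\<exists>lam :: nat \<Rightarrow> real. \<forall>j. (1 \<le> lam j \<and> \<not> good (lam j)) \<and> \<Lambda> * lam j \<le> lam (Suc j)"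
  proof (rule dependent_nat_choice)
    show "\<exists>x. 1 \<le> x \<and> \<not> good x" using bad[of 1] by auto
    fix x :: real and n :: nat assume x: "1 \<le> x \<and> \<not> good x"
    then have "1 * 1 \<le> \<Lambda> * x" using \<Lambda>(2) by (intro mult_mono) auto
    then have 1: "1 \<le> \<Lambda> * x" by simp
    then obtain y where "\<Lambda> * x \<le> y" "\<not> good y" using bad[of "\<Lambda> * x"] by auto
    then show "\<exists>y. (1 \<le> y \<and> \<not> good y) \<and> \<Lambda> * x \<le> y" using 1 by (meson order_trans)
  qed
  then obtain lam :: "nat \<Rightarrow> real" where lam: "\<And>j. 1 \<le> lam j" "\<And>j. \<not> good (lam j)" "\<And>j. \<Lambda> * lam j \<le> lam (Suc j)"
    by auto
  define t where "t j k = lam j powr a k * b k" for j k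
  have t: "0 < t j k" for j k using assms(2)[of k] lam(1)[of j] by (simp add: t_def)
  have t_Suc: "2 ^ L * t j k \<le> t (Suc j) k" for j k
  proof -
    have "2 ^ L * lam j powr a k \<le> \<Lambda> powr a k * lam j powr a k"
      using \<Lambda>(1) by (intro mult_right_mono) auto
    also have "\<dots> = (\<Lambda> * lam j) powr a k"
      using \<Lambda>(2) lam(1)[of j] by (simp add: powr_mult)
    also have "\<dots> \<le> lam (Suc j) powr a k"
      using lam(1)[of j] lam(3)[of j] \<Lambda>(2) assms(1)[of k] by (intro powr_mono2) auto
    finally have "2 ^ L * lam j powr a k * b k \<le> lam (Suc j) powr a k * b k"
      using assms(2)[of k] by (intro mult_right_mono) auto
    then show ?thesis by (simp add: t_def mult.assoc)
  qed
  \<comment> \<open>The first \<open>J\<close> bad scales are fixed before the cube. Beyond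
    \<open>R0\<close> every rescaled side is at most \<open>e\<close>; the summand 1 keeps
    \<open>R\<close> positive.\<close>
  define R0 where "R0 = 1 + (\<Sum>j<J. \<Sum>k\<in>UNIV. t j k) / e"
  obtain R x0 where R: "R \<ge> R0" "\<delta> < measure lebesgue (A \<inter> ((+) x0 ` cbox 0 (R *\<^sub>R One))) / R ^ DIM((real ^ 2) ^ 'n)"
    using \<delta>(2) by blast
  have "0 \<le> (\<Sum>j<J. \<Sum>k\<in>UNIV. t j k) / e"
    using e by (intro divide_nonneg_pos sum_nonneg less_imp_le[OF t]) auto
  then have R_pos: "0 < R" using R(1) unfolding R0_def by linarith
  have tR: "t j k / R \<le> e" if "j < J" for j k
  proof -
    have "t j k \<le> (\<Sum>k\<in>UNIV. t j k)"
      by (rule member_le_sum) (auto intro: less_imp_le[OF t])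
    also have "\<dots> \<le> (\<Sum>j<J. \<Sum>k\<in>UNIV. t j k)"
      using that by (intro member_le_sum[where f="\<lambda>j. \<Sum>k\<in>UNIV. t j k"]) (auto intro!: sum_nonneg less_imp_le[OF t])
    also have "\<dots> \<le> e * R"
      using R(1) e unfolding R0_def by (simp add: field_simps)
    finally show ?thesis using R_pos by (simp add: field_simps)
  qed
  obtain B where B: "B \<in> sets borel" "B \<subseteq> box 0 One" "\<And>y. y \<in> B \<Longrightarrow> x0 + R *\<^sub>R y \<in> A" "\<delta> < measure lborel B"
    using rescaled_borel_part[OF assms(3) R_pos R(2)] by blast
  define f :: "('n \<Rightarrow> real \<times> real) \<Rightarrow> real" where "f w = indicator B (assemble w)" for w
  have f: "box_weight f unit_square" unfolding f_def[abs_def] by (rule box_weight_indicator[OF B(1,2)])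
  have "\<exists>j<J. 0 < box_form f (\<lambda>k. circle_coupling (t j k / R))"
  proof (rule good_scale[OF f])
    show "\<delta> \<le> (\<integral>z. f (\<lambda>k. fst (z k)) \<partial>Pi\<^sub>M UNIV (\<lambda>_. square_measure \<Otimes>\<^sub>M square_measure))"
    proof -
      have "(\<integral>z. f (\<lambda>k. fst (z k)) \<partial>Pi\<^sub>M UNIV (\<lambda>_. square_measure \<Otimes>\<^sub>M square_measure)) = measure lborel B"
        unfolding f_def
        by (rule integral_square_average[OF B(1)]) (rule box_weight_indicator(2)[OF B(1,2)])
      then show ?thesis using B(4) by simp
    qed
    show "\<forall>j k. j < J \<longrightarrow> 0 < t j k / R \<and> t j k / R \<le> e"
      using t R_pos tR by auto
    show "\<forall>j k. Suc j < J \<longrightarrow> 2 ^ L * (t j k / R) \<le> t (Suc j) k / R"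
      using t_Suc R_pos by (auto simp: divide_right_mono)
  qed
  \<comment> \<open>One index \<open>j\<close> serves all coordinates, so the box has the side
    lengths belonging to the single value \<open>lam j\<close>.\<close>
  then obtain j where "0 < box_form f (\<lambda>k. circle_coupling (t j k / R))" by blast
  from box_form_circle_pos_imp_box[OF f this] obtain z :: "'n \<Rightarrow> (real \<times> real) \<times> (real \<times> real)"
    where z: "\<And>k. norm (snd (z k) - fst (z k)) = t j k / R" "\<And>S. f (mix z S) \<noteq> 0"
    using t[of j] R_pos by (auto simp: less_imp_le)
  define x where "x = x0 + R *\<^sub>R assemble (\<lambda>k. fst (z k))"
  define y where "y = R *\<^sub>R assemble (\<lambda>k. snd (z k) - fst (z k))"
  have "(\<chi> k. x $ k + r k *\<^sub>R y $ k) \<in> A" if r: "\<forall>k. r k \<in> {0, 1}" for r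
  proof -
    \<comment> \<open>Coordinates with \<open>r k = 1\<close> take the second point of their pair,
      the others the first.\<close>
    let ?S = "{k. r k = 1}"
    have "(\<chi> k. x $ k + r k *\<^sub>R y $ k) = x0 + R *\<^sub>R assemble (mix z ?S)"
    proof (simp only: vec_eq_iff, intro allI)
      fix k :: 'n and i :: 2
      have "i = 1 \<or> i = 2" by (rule exhaust_2)
      moreover have "r k = 0 \<or> r k = 1" using r by auto
      ultimately show "(\<chi> k. x $ k + r k *\<^sub>R y $ k) $ k $ i = (x0 + R *\<^sub>R assemble (mix z ?S)) $ k $ i"
        by (auto simp: x_def y_def mix_def algebra_simps)
    qed
    moreover have "assemble (mix z ?S) \<in> B" using z(2)[of ?S] by (auto simp: f_def split: split_indicator_asm)
    ultimately show ?thesis using B(3) by simp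
  qed
  moreover have "norm (y $ k) = lam j powr a k * b k" for k
  proof -
    have "norm (y $ k) = R * norm (snd (z k) - fst (z k))"
      using R_pos norm_vector_2[of "snd (z k) - fst (z k)"] by (simp add: y_def assemble_def)
    then show ?thesis using z(1)[of k] R_pos by (simp add: t_def)
  qed
  ultimately have "good (lam j)" unfolding good_def by blast
  with lam(2) show False by blast
qed

end
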